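(* Let $\vec{\xi}$, $\vec{w}$, $A$, $\gamma_0$, $\vec{f}_0$, $\mu_0$ be as described in the context, and let $\vec{x}(\vec{u},t)$, $\vec{u}\in\mathbb{R}^3$, $t\geq 0$, be the solution of $$d\vec{x}(\vec{u},t)=A\Big(\vec{x}(\vec{u},t)-\int_{\mathbb{R}^3}\vec{x}(\vec{v},t)\,\mu_0(d\vec{v})\Big)dt+d\vec{w}(t),\qquad \vec{x}(\vec{u},0)=\vec{u},\ \vec{u}\in\mathbb{R}^3.$$ For $t\ge0$ let $\gamma_t=\vec{x}(\gamma_0,t)$ and let $\Gamma_t=\vec{\xi}(\gamma_t)$ be the random closed curve parametrized by $s\mapsto\vec{\xi}(\vec{x}(\vec{f}_0(s),t))$, $s\in[0,2\pi]$. Let $G_1,G_2$ be two deterministic knots in $\mathbb{R}^3$ which are not of the same type. Then there exists $t_0>0$ such that $$P\{\Gamma_0\text{ has type }G_1,\ \Gamma_{t_0}\text{ has type }G_2\}>0.$$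
   Context: $C^2_p([0,2\pi],\mathbb{R}^3)$ is the set of twice continuously differentiable $2\pi$-periodic functions with values in $\mathbb{R}^3$. $\vec{\xi}=(\xi_1,\xi_2,\xi_3):\mathbb{R}^3\to\mathbb{R}^3$ is a centered Gaussian random field with independent identically distributed coordinates with covariance $E\,\xi_1(\vec{u})\xi_1(\vec{v})=e^{-\|\vec{u}-\vec{v}\|^2}$, $\vec{u},\vec{v}\in\mathbb{R}^3$, taken with infinitely differentiable sample paths. $\vec{w}$ is a standard Wiener process in $\mathbb{R}^3$ (started at $0$), independent of $\vec{\xi}$. $A$ is a real $3\times3$ matrix that generates a group of orthogonal operators: the solution $U_t$ of $dU_t=AU_t\,dt$, $U_0=I$, satisfies $U_t^*=U_t^{-1}$ for all $t\geq0$. $\gamma_0$ is a closed smooth curve in $\mathbb{R}^3$ without self-intersections, parametrized by $\vec{f}_0\in C^2_p([0,2\pi],\mathbb{R}^3)$ (so $\vec{f}_0'$ never vanishes and $\vec{f}_0$ is injective on $[0,2\pi)$), and $\mu_0$ is its visitation measure, the probability measure $\mu_0(\Delta)=\frac{1}{2\pi}\int_0^{2\pi}\mathbf{1}_\Delta(\vec{f}_0(s))\,ds$, $\Delta\in\mathcal{B}(\mathbb{R}^3)$. A (deterministic) knot is a smooth closed curve in $\mathbb{R}^3$ without self-intersections, i.e. one having a $2\pi$-periodic $C^2$ parametrization with nowhere vanishing derivative that is injective on $[0,2\pi)$. A closed curve has type $G$ if it has no self-intersections and there is an orientation-preserving homeomorphism of $\mathbb{R}^3$ carrying its image onto $G$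 (equivalently, it is ambient isotopic to $G$). *)

theory Defs
  imports "HOL-Probability.Probability" "HOL-Homology.Homology"
begin

(* All derivatives are global, so C_k k f is the class C^k on the whole space. Since f is required
   to be (Frechet) differentiable, the maps x |-> Df(x) v with v ranging over all vectors are C^k
   iff Df is. *)
primrec C_k :: "nat \<Rightarrow> ('a::euclidean_space \<Rightarrow> 'b::real_normed_vector) \<Rightarrow> bool" where
  "C_k 0 f \<longleftrightarrow> continuous_on UNIV f"
| "C_k (Suc k) f \<longleftrightarrow>
     f differentiable_on UNIV \<and> (\<forall>v. C_k k (\<lambda>x. frechet_derivative f (at x) v))"

definition smooth :: "('a::euclidean_space \<Rightarrow> 'b::real_normed_vector) \<Rightarrow> bool" where
  "smooth f \<longleftrightarrow> (\<forall>k. C_k k f)"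


(* Periodic functions on [0, 2 pi] are represented by their periodic extensions to the real line. *)
definition C2_periodic :: "(real \<Rightarrow> real^3) \<Rightarrow> bool" where
  "C2_periodic f \<longleftrightarrow> C_k 2 f \<and> (\<forall>s. f (s + 2 * pi) = f s)"

definition no_self_intersections :: "(real \<Rightarrow> real^3) \<Rightarrow> bool" where
  "no_self_intersections f \<longleftrightarrow> inj_on f {0..<2 * pi}"

definition knot_parametrization :: "(real \<Rightarrow> real^3) \<Rightarrow> bool" where
  "knot_parametrization f \<longleftrightarrow>
     C2_periodic f \<and> (\<forall>s. vector_derivative f (at s) \<noteq> 0) \<and> no_self_intersections f"

definition knot :: "(real^3) set \<Rightarrow> bool" where
  "knot G \<longleftrightarrow> (\<exists>f. knot_parametrization f \<and> G = f ` {0..2 * pi})"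

(* A homeomorphism h of R^3 preserves orientation iff its local degree is +1, i.e. iff, after
   translating a and h(a) to the origin, it acts as the identity on the local homology group
   H_3(R^3, R^3 - {0}), which is infinite cyclic. (The choice of a is immaterial.) *)
definition orientation_preserving :: "(real^3 \<Rightarrow> real^3) \<Rightarrow> bool" where
  "orientation_preserving h \<longleftrightarrow>
     (\<forall>a. \<forall>c \<in> carrier (relative_homology_group 3 euclidean (UNIV - {0 :: real^3})).
        hom_induced 3 euclidean (UNIV - {0}) euclidean (UNIV - {0}) (\<lambda>x. h (a + x) - h a) c = c)"

definition same_type :: "(real^3) set \<Rightarrow> (real^3) set \<Rightarrow> bool" where
  "same_type S T \<longleftrightarrow>
     (\<exists>h k. homeomorphism UNIV UNIV h k \<and> orientation_preserving h \<and> h ` S = T)"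

definition has_type :: "(real \<Rightarrow> real^3) \<Rightarrow> (real^3) set \<Rightarrow> bool" where
  "has_type c G \<longleftrightarrow> no_self_intersections c \<and> same_type (c ` {0..2 * pi}) G"


(* Centred Gaussian real variables, including the degenerate one (\<sigma> = 0). *)
definition centered_gaussian :: "'w measure \<Rightarrow> ('w \<Rightarrow> real) \<Rightarrow> bool" where
  "centered_gaussian M X \<longleftrightarrow> X \<in> borel_measurable M \<and>
     (\<exists>\<sigma>\<ge>0. distr M borel X = distr std_normal_distribution borel (\<lambda>z. \<sigma> * z))"

definition centered_gaussian_process :: "'w measure \<Rightarrow> ('i \<Rightarrow> 'w \<Rightarrow> real) \<Rightarrow> bool" where
  "centered_gaussian_process M X \<longleftrightarrow>
     (\<forall>F c. finite F \<longrightarrow> centered_gaussian M (\<lambda>\<omega>. \<Sum>i\<in>F. c i * X i \<omega>))"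

(* Independence of the coordinates is independence of the whole coordinate fields, as random
   elements of the product space. They are identically distributed because a centred Gaussian
   field is determined in law by its covariance. *)
definition smooth_gaussian_field :: "'w measure \<Rightarrow> (real^3 \<Rightarrow> 'w \<Rightarrow> real^3) \<Rightarrow> bool" where
  "smooth_gaussian_field M \<xi> \<longleftrightarrow>
     (\<forall>i. centered_gaussian_process M (\<lambda>u \<omega>. \<xi> u \<omega> $ i)) \<and>
     (\<forall>i u v. (\<integral>\<omega>. \<xi> u \<omega> $ i * \<xi> v \<omega> $ i \<partial>M) = exp (- (norm (u - v))\<^sup>2)) \<and>
     prob_space.indep_vars M (\<lambda>_. Pi\<^sub>M (UNIV :: (real^3) set) (\<lambda>_. borel :: real measure))
       (\<lambda>i \<omega> u. \<xi> u \<omega> $ i) (UNIV :: 3 set) \<and>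
     (AE \<omega> in M. smooth (\<lambda>u. \<xi> u \<omega>))"

definition wiener_process :: "'w measure \<Rightarrow> (real \<Rightarrow> 'w \<Rightarrow> real^3) \<Rightarrow> bool" where
  "wiener_process M w \<longleftrightarrow>
     (\<forall>t\<ge>0. w t \<in> borel_measurable M) \<and>
     (AE \<omega> in M. w 0 \<omega> = 0) \<and>
     (AE \<omega> in M. continuous_on {0..} (\<lambda>t. w t \<omega>)) \<and>
     (\<forall>n (t :: nat \<Rightarrow> real). 0 \<le> t 0 \<and> (\<forall>k<n. t k \<le> t (Suc k)) \<longrightarrow>
        prob_space.indep_vars M (\<lambda>_. borel) (\<lambda>k \<omega>. w (t (Suc k)) \<omega> - w (t k) \<omega>) {..<n}) \<and>
     (\<forall>s t. 0 \<le> s \<and> s < t \<longrightarrow>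
        (\<forall>i. distributed M lborel (\<lambda>\<omega>. (w t \<omega> - w s \<omega>) $ i) (normal_density 0 (sqrt (t - s)))) \<and>
        prob_space.indep_vars M (\<lambda>_. borel) (\<lambda>i \<omega>. (w t \<omega> - w s \<omega>) $ i) (UNIV :: 3 set))"

(* Library independence of two random elements (indep_var) requires a common type of values, so
   independence of the generated sigma-algebras is used directly. *)
definition independent_processes ::
    "'w measure \<Rightarrow> (real^3 \<Rightarrow> 'w \<Rightarrow> real^3) \<Rightarrow> (real \<Rightarrow> 'w \<Rightarrow> real^3) \<Rightarrow> bool" where
  "independent_processes M \<xi> w \<longleftrightarrow>
     prob_space.indep_set M
       (sets (vimage_algebra (space M) (\<lambda>\<omega> u. \<xi> u \<omega>) (Pi\<^sub>M UNIV (\<lambda>_. borel))))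
       (sets (vimage_algebra (space M) (\<lambda>\<omega>. \<lambda>t\<in>{0..}. w t \<omega>) (Pi\<^sub>M {0..} (\<lambda>_. borel))))"


(* The solution U of dU = A U dt, U(0) = I, exists and is unique. *)
definition generates_orthogonal_group :: "real^3^3 \<Rightarrow> bool" where
  "generates_orthogonal_group A \<longleftrightarrow>
     (\<exists>U :: real \<Rightarrow> real^3^3. U 0 = mat 1 \<and>
        (\<forall>t\<ge>0. (U has_vector_derivative A ** U t) (at t within {0..})) \<and>
        (\<forall>t\<ge>0. orthogonal_matrix (U t)))"

definition visitation_measure :: "(real \<Rightarrow> real^3) \<Rightarrow> (real^3) measure" where
  "visitation_measure f = distr (uniform_measure lborel {0..2 * pi}) borel f"

(* The noise is additive, so the stochastic equation is the pathwise integral equation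
   x(u,t) = u + \<integral>_0^t A (x(u,r) - \<integral> x(v,r) \<mu>(dv)) dr + w(t),
   stated here for one path w of the noise. *)
definition solves_flow_equation ::
    "real^3^3 \<Rightarrow> (real^3) measure \<Rightarrow> (real \<Rightarrow> real^3) \<Rightarrow> (real^3 \<Rightarrow> real \<Rightarrow> real^3) \<Rightarrow> bool" where
  "solves_flow_equation A \<mu> w x \<longleftrightarrow>
     (\<forall>t\<ge>0. integrable \<mu> (\<lambda>v. x v t)) \<and>
     (\<forall>u. continuous_on {0..} (x u)) \<and>
     (\<forall>u. x u 0 = u) \<and>
     (\<forall>u. \<forall>t\<ge>0. ((\<lambda>r. A *v (x u r - (\<integral>v. x v r \<partial>\<mu>))) has_integral (x u t - u - w t)) {0..t})"

end

theory Submission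
  imports Defs
begin

text \<open>Write \<open>f\<^sub>0\<close> for the parametrization of the initial curve and \<open>m\<close> for the mean of its visitation measure.
The difference of two solutions of the flow equation feels neither the noise nor the mean, so it is
transported by the orthogonal group \<open>U\<close>; hence the flow is the random rigid motion
\<open>u \<mapsto> U\<^sub>t (u - m) + m + w(t)\<close> (\<open>flow_equation_solution\<close>). The loop at time \<open>0\<close> is \<open>\<xi> \<circ> f\<^sub>0\<close>,
and the loop at time \<open>1\<close> is \<open>\<xi> \<circ> (z + w(1))\<close>, where \<open>z\<close> is a fixed congruent copy of \<open>f\<^sub>0\<close>.
As \<open>w(1)\<close> is independent of \<open>\<xi>\<close> and has full support, it moves \<open>z\<close> far away from \<open>f\<^sub>0\<close> with positive
probability, and then \<open>\<xi>\<close> acts on two distant curves, on which it can be close to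
prescribed parametrizations of the two knots simultaneously. Closeness is measured throughout
by the Lipschitz constant of the difference.

Stability. Suppose that \<open>c\<close> is a loop which expands distances on the circle by at least a factor \<open>m > 0\<close>
and that \<open>c' - c\<close> has a small Lipschitz constant. Then \<open>c' - c\<close>, read as a function on the image of \<open>c\<close>,
is a Lipschitz function with a small constant; it extends to a contraction \<open>g\<close> of the whole space, and
\<open>id + g\<close> is a homeomorphism, isotopic to the identity through the maps \<open>id + t g\<close>, that carries \<open>c\<close>
to \<open>c'\<close> (\<open>has_type_stable\<close>).

Support of the field. Let \<open>h\<close> be a finite sum of kernels \<open>a exp (- \<bar>u - v\<bar>\<^sup>2)\<close>. Regressing \<open>\<xi>\<close> on
one Gaussian variable splits it in law into a multiple of \<open>h\<close> and an independent remainder that is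
small with positive probability, so \<open>\<xi>\<close> is close to \<open>h\<close> on a ball with positive probability
(\<open>gaussian_field_support\<close>). Along an embedded loop, kernel sums approximate every continuously
differentiable periodic function together with its derivative (\<open>kernel_sums_dense\<close>), and they are flat
at infinity; therefore \<open>h\<^sub>1 + h\<^sub>2 (\<cdot> - p)\<close> with \<open>p\<close> far away is good on both curves at once
(\<open>two_loop_target\<close>).

Measurability. Being of type \<open>G\<close> is an open condition on immersed loops, by stability, in a
separable topology generated by conditions on countably many values of the field. So the event is
measurable up to the event that a loop has a stationary point, and the latter is null because
three independent coordinates would have to vanish along a one-parameter family
(\<open>AE_immersed\<close>, \<open>has_type_measurable\<close>).\<close>

section \<open>Stability of the knot type under Lipschitz-small perturbations\<close>

text \<open>McShane's formula: the largest \<open>L\<close>-Lipschitz function below all the cones \<open>f y + L \<bar>x - y\<bar>\<close>.\<close>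

lemma lipschitz_extension_real:
  fixes f :: "'a::metric_space \<Rightarrow> real"
  assumes "L-lipschitz_on S f" "S \<noteq> {}"
  obtains F where "L-lipschitz_on UNIV F" "\<And>x. x \<in> S \<Longrightarrow> F x = f x"
proof -
  have L: "0 \<le> L" using assms(1) by (rule lipschitz_on_nonneg)
  define F where "F x = (INF y\<in>S. f y + L * dist x y)" for x
  obtain z where z: "z \<in> S" using assms(2) by auto
  have bdd: "bdd_below ((\<lambda>y. f y + L * dist x y) ` S)" for x
  proof (rule bdd_belowI2)
    fix y assume "y \<in> S"
    then have "f z - f y \<le> L * dist z y"
      using lipschitz_onD[OF assms(1) z, of y] by (simp add: dist_real_def)
    also have "\<dots> \<le> L * (dist z x + dist x y)"
      by (intro mult_left_mono dist_triangle L)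
    finally show "f z - L * dist z x \<le> f y + L * dist x y" by (simp add: algebra_simps)
  qed
  have step: "F x \<le> F x' + L * dist x x'" for x x'
  proof -
    have "F x - L * dist x x' \<le> F x'"
      unfolding F_def
    proof (rule cINF_greatest[OF assms(2)])
      fix y assume y: "y \<in> S"
      have "(INF y\<in>S. f y + L * dist x y) \<le> f y + L * dist x y"
        by (rule cINF_lower[OF bdd y])
      also have "\<dots> \<le> f y + L * (dist x x' + dist x' y)"
        by (intro add_left_mono mult_left_mono dist_triangle L)
      finally show "(INF y\<in>S. f y + L * dist x y) - L * dist x x' \<le> f y + L * dist x' y"
        by (simp add: algebra_simps)
    qed
    then show ?thesis by simp
  qed
  have "L-lipschitz_on UNIV F"
  proof (rule lipschitz_onI[OF _ L])
    fix x y :: 'a show "dist (F x) (F y) \<le> L * dist x y"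
      using step[of x y] step[of y x] by (auto simp: dist_real_def dist_commute abs_le_iff)
  qed
  moreover have "F x = f x" if x: "x \<in> S" for x
  proof (rule antisym)
    show "F x \<le> f x" unfolding F_def using cINF_lower[OF bdd x, of x] by simp
    show "f x \<le> F x" unfolding F_def
    proof (rule cINF_greatest[OF assms(2)])
      fix y assume "y \<in> S"
      then show "f x \<le> f y + L * dist x y"
        using lipschitz_onD[OF assms(1) x, of y] by (auto simp: dist_real_def abs_le_iff)
    qed
  qed
  ultimately show ?thesis by (rule that)
qed

lemma lipschitz_on_vec_nth:
  fixes f :: "'a::metric_space \<Rightarrow> real^'n"
  assumes "L-lipschitz_on S f" shows "L-lipschitz_on S (\<lambda>x. f x $ i)"
proof (rule lipschitz_onI)
  fix x y assume "x \<in> S" "y \<in> S"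
  then show "dist (f x $ i) (f y $ i) \<le> L * dist x y"
    using lipschitz_onD[OF assms, of x y] dist_vec_nth_le[of "f x" i "f y"] by linarith
qed (rule lipschitz_on_nonneg[OF assms])

lemma lipschitz_on_vec:
  fixes f :: "'a::metric_space \<Rightarrow> real^3"
  assumes "\<And>i. L-lipschitz_on S (\<lambda>x. f x $ i)" shows "(3 * L)-lipschitz_on S f"
proof (rule lipschitz_onI)
  show "0 \<le> 3 * L" using lipschitz_on_nonneg[OF assms] by simp
  fix x y assume xy: "x \<in> S" "y \<in> S"
  have "dist (f x) (f y) \<le> (\<Sum>i\<in>UNIV. \<bar>(f x - f y) $ i\<bar>)"
    unfolding dist_norm by (rule norm_le_l1_cart)
  also have "\<dots> \<le> (\<Sum>i\<in>(UNIV::3 set). L * dist x y)"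
    by (intro sum_mono) (use lipschitz_onD[OF assms xy] in \<open>auto simp: dist_real_def\<close>)
  finally show "dist (f x) (f y) \<le> 3 * L * dist x y" by simp
qed

text \<open>Extending coordinate by coordinate costs a factor in the constant, which is harmless here.\<close>

lemma lipschitz_extension:
  fixes f :: "'a::metric_space \<Rightarrow> real^3"
  assumes "L-lipschitz_on S f" "S \<noteq> {}"
  obtains F where "(3 * L)-lipschitz_on UNIV F" "\<And>x. x \<in> S \<Longrightarrow> F x = f x"
proof -
  have "\<exists>F. L-lipschitz_on UNIV F \<and> (\<forall>x\<in>S. F x = f x $ i)" for i
    using lipschitz_extension_real[OF lipschitz_on_vec_nth[OF assms(1)] assms(2), of i] by metis
  then obtain F where F: "\<And>i. L-lipschitz_on UNIV (F i)" "\<And>i x. x \<in> S \<Longrightarrow> F i x = f x $ i"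
    by metis
  have "(3 * L)-lipschitz_on UNIV (\<lambda>x. \<chi> i. F i x)"
    using F(1) by (intro lipschitz_on_vec) simp
  then show ?thesis by (rule that) (simp add: vec_eq_iff F(2))
qed

text \<open>Solving \<open>x + g x = y\<close> is finding the fixed point of the contraction \<open>x \<mapsto> y - g x\<close>, and
\<open>\<bar>x + g x - (y + g y)\<bar> \<ge> (1 - L) \<bar>x - y\<bar>\<close> makes the inverse Lipschitz.\<close>

lemma homeomorphism_id_plus_contraction:
  fixes g :: "'a::banach \<Rightarrow> 'a"
  assumes "L-lipschitz_on UNIV g" "L < 1"
  obtains k where "homeomorphism UNIV UNIV (\<lambda>x. x + g x) k"
proof -
  have L: "0 \<le> L" using assms(1) by (rule lipschitz_on_nonneg)
  have expand: "(1 - L) * dist x y \<le> dist (x + g x) (y + g y)" for x y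
  proof -
    have "dist x y = norm ((x + g x - (y + g y)) - (g x - g y))" by (simp add: dist_norm algebra_simps)
    also have "\<dots> \<le> dist (x + g x) (y + g y) + dist (g x) (g y)"
      unfolding dist_norm by (rule norm_triangle_ineq4)
    finally show ?thesis using lipschitz_onD[OF assms(1), of x y] by (simp add: algebra_simps)
  qed
  have surj: "\<exists>x. x + g x = y" for y
  proof -
    have "dist (y - g u) (y - g v) \<le> L * dist u v" for u v
      using lipschitz_onD[OF assms(1), of u v] by (simp add: dist_norm norm_minus_commute)
    then have "\<exists>!u. y - g u = u"
      by (intro banach_fix_type[OF L assms(2)]) auto
    then show ?thesis by (metis add.commute diff_add_cancel)
  qed
  have inj: "inj (\<lambda>x. x + g x)"
  proof (rule injI)
    fix x y assume "x + g x = y + g y"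
    then show "x = y" using expand[of x y] assms(2) zero_le_dist[of x y] by (simp add: mult_le_0_iff)
  qed
  define k where "k = inv_into UNIV (\<lambda>x. x + g x)"
  have k1: "k (x + g x) = x" for x
    unfolding k_def using inv_into_f_f[OF inj, of x] by simp
  have k2: "k y + g (k y) = y" for y
    using surj[of y] k1 by metis
  have "(1 / (1 - L))-lipschitz_on UNIV k"
  proof (rule lipschitz_onI)
    fix x y show "dist (k x) (k y) \<le> 1 / (1 - L) * dist x y"
      using expand[of "k x" "k y"] assms(2) by (simp add: k2 field_simps)
  qed (use assms(2) in auto)
  then have "continuous_on UNIV k" by (rule lipschitz_on_continuous_on)
  moreover have "continuous_on UNIV (\<lambda>x. x + g x)"
    by (intro continuous_intros lipschitz_on_continuous_on[OF assms(1)])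
  ultimately have "homeomorphism UNIV UNIV (\<lambda>x. x + g x) k"
    unfolding homeomorphism_def using k1 k2 surj by (auto simp: surj_def) (metis k1)+
  then show ?thesis by (rule that)
qed

text \<open>After moving \<open>a\<close> and its image to the origin, the straight-line homotopy from the identity stays
away from \<open>0\<close> because the perturbation at \<open>x\<close> is shorter than \<open>x\<close>.\<close>

lemma orientation_preserving_id_plus_contraction:
  assumes "L-lipschitz_on UNIV g" "L < 1"
  shows "orientation_preserving (\<lambda>x. x + g x)"
  unfolding orientation_preserving_def
proof (intro allI ballI)
  fix a :: "real^3" and c
  assume c: "c \<in> carrier (relative_homology_group 3 euclidean (UNIV - {0 :: real^3}))"
  let ?h = "\<lambda>x. a + x + g (a + x) - (a + g a)"
  have gc: "continuous_on UNIV g" using assms(1) by (rule lipschitz_on_continuous_on)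
  have "homotopic_with (\<lambda>h. h \<in> (UNIV - {0}) \<rightarrow> (UNIV - {0})) euclidean euclidean id ?h"
    unfolding homotopic_with_def
  proof (intro exI conjI ballI allI)
    let ?k = "\<lambda>(t, x). x + t *\<^sub>R (g (a + x) - g a)"
    have cont: "continuous_on ({0..1} \<times> UNIV) ?k"
      unfolding case_prod_beta
      by (intro continuous_intros continuous_on_compose2[OF gc]) auto
    have eq: "prod_topology (top_of_set {0..1::real}) euclidean = top_of_set ({0..1} \<times> (UNIV :: (real^3) set))"
      by (metis subtopology_UNIV prod_topology_subtopology_eu)
    show "continuous_map (prod_topology (top_of_set {0..1}) euclidean) euclidean ?k"
      unfolding eq using cont by (rule iffD2[OF continuous_map_iff_continuous])
    fix t :: real assume t: "t \<in> {0..1}"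
    show "(\<lambda>x. ?k (t, x)) \<in> (UNIV - {0}) \<rightarrow> (UNIV - {0})"
    proof
      fix x :: "real^3" assume "x \<in> UNIV - {0}"
      then have x: "x \<noteq> 0" by simp
      have "x + t *\<^sub>R (g (a + x) - g a) \<noteq> 0"
      proof
        assume "x + t *\<^sub>R (g (a + x) - g a) = 0"
        then have "norm x = norm (t *\<^sub>R (g (a + x) - g a))"
          by (metis add_eq_0_iff norm_minus_cancel)
        also have "\<dots> \<le> norm (g (a + x) - g a)"
          using t by (simp add: mult_left_le_one_le)
        also have "\<dots> \<le> L * norm x"
          using lipschitz_onD[OF assms(1), of "a + x" a] by (simp add: dist_norm)
        finally show False using x assms(2) by (simp add: mult_le_cancel_right1)
      qed
      then show "?k (t, x) \<in> UNIV - {0}" by simp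
    qed
  qed auto
  then have "hom_induced 3 euclidean (UNIV - {0}) euclidean (UNIV - {0}) id =
    hom_induced 3 euclidean (UNIV - {0 :: real^3}) euclidean (UNIV - {0}) ?h"
    by (rule homology_homotopy_axiom)
  then show "hom_induced 3 euclidean (UNIV - {0}) euclidean (UNIV - {0}) ?h c = c"
    using hom_induced_id[OF c] by simp
qed

lemma orientation_preserving_compose:
  assumes "homeomorphism UNIV UNIV h k" "homeomorphism UNIV UNIV h' k'"
    and "orientation_preserving h" "orientation_preserving h'"
  shows "orientation_preserving (h' \<circ> h)"
  unfolding orientation_preserving_def
proof (intro allI ballI)
  fix a :: "real^3" and c
  assume c: "c \<in> carrier (relative_homology_group 3 euclidean (UNIV - {0 :: real^3}))"
  have inj: "h x = h y \<longleftrightarrow> x = y" "h' x = h' y \<longleftrightarrow> x = y" for x y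
    using assms(1,2) by (auto simp: homeomorphism_def) metis+
  have co: "continuous_on UNIV h" "continuous_on UNIV h'"
    using assms(1,2) by (auto simp: homeomorphism_def)
  let ?p = "\<lambda>x. h (a + x) - h a" and ?q = "\<lambda>x. h' (h a + x) - h' (h a)"
  have comp: "(\<lambda>x. (h' \<circ> h) (a + x) - (h' \<circ> h) a) = ?q \<circ> ?p" by (auto simp: fun_eq_iff)
  have "hom_induced 3 euclidean (UNIV - {0}) euclidean (UNIV - {0}) (?q \<circ> ?p) c =
     hom_induced 3 euclidean (UNIV - {0}) euclidean (UNIV - {0}) ?q
       (hom_induced 3 euclidean (UNIV - {0}) euclidean (UNIV - {0}) ?p c)"
  proof (rule hom_induced_compose'[symmetric])
    show "continuous_map euclidean euclidean ?p" "continuous_map euclidean euclidean ?q"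
      by (auto intro!: continuous_intros continuous_on_compose2[OF co(1)] continuous_on_compose2[OF co(2)])
    show "?p \<in> UNIV - {0} \<rightarrow> UNIV - {0}" "?q \<in> UNIV - {0} \<rightarrow> UNIV - {0}"
      by (auto simp: inj)
  qed
  also have "\<dots> = c"
    using assms(3,4) c unfolding orientation_preserving_def by metis
  finally show "hom_induced 3 euclidean (UNIV - {0}) euclidean (UNIV - {0})
     (\<lambda>x. (h' \<circ> h) (a + x) - (h' \<circ> h) a) c = c"
    unfolding comp .
qed

lemma same_type_trans:
  assumes "same_type S T" "same_type T U" shows "same_type S U"
proof -
  obtain h k where hk: "homeomorphism UNIV UNIV h k" "orientation_preserving h" "h ` S = T"
    using assms(1) by (auto simp: same_type_def)
  obtain h' k' where hk': "homeomorphism UNIV UNIV h' k'" "orientation_preserving h'" "h' ` T = U"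
    using assms(2) by (auto simp: same_type_def)
  have "homeomorphism UNIV UNIV (h' \<circ> h) (k \<circ> k')"
    by (rule homeomorphism_compose[OF hk(1) hk'(1)])
  then show ?thesis
    using orientation_preserving_compose[OF hk(1) hk'(1) hk(2) hk'(2)] hk(3) hk'(3)
    unfolding same_type_def by (metis image_comp)
qed

text \<open>The inequality is the lower half of a bi-Lipschitz bound with respect to the distance on the circle:
for parameters at most half a period apart, that distance is the difference of the parameters.\<close>

definition bilipschitz_loop :: "real \<Rightarrow> (real \<Rightarrow> real^3) \<Rightarrow> bool" where
  "bilipschitz_loop m c \<longleftrightarrow> (\<forall>s. c (s + 2 * pi) = c s) \<and>
     (\<forall>s s'. \<bar>s - s'\<bar> \<le> pi \<longrightarrow> m * \<bar>s - s'\<bar> \<le> norm (c s - c s'))"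

lemma periodic_shift_int:
  fixes c :: "real \<Rightarrow> 'a"
  assumes "\<And>s. c (s + 2 * pi) = c s" shows "c (s + 2 * pi * of_int n) = c s"
proof (induction n rule: int_induct[where k = 0])
  case (step1 i) then show ?case using assms[of "s + 2 * pi * of_int i"] by (simp add: algebra_simps)
next
  case (step2 i) then show ?case using assms[of "s + 2 * pi * of_int (i - 1)"] by (simp add: algebra_simps)
qed simp

lemma ex_period_near:
  obtains n :: int where "\<bar>s - (s' + 2 * pi * of_int n)\<bar> \<le> pi"
proof -
  \<comment> \<open>the period for which the translate of \<open>s'\<close> is nearest to \<open>s\<close>\<close>
  define n where "n = round ((s - s') / (2 * pi))"
  have "\<bar>of_int n - (s - s') / (2 * pi)\<bar> \<le> 1/2" unfolding n_def by (rule of_int_round_abs_le)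
  then have "2 * pi * \<bar>of_int n - (s - s') / (2 * pi)\<bar> \<le> 2 * pi * (1/2)"
    by (intro mult_left_mono) auto
  then have "\<bar>2 * pi * (of_int n - (s - s') / (2 * pi))\<bar> \<le> pi"
    by (simp add: abs_mult)
  moreover have "2 * pi * (of_int n - (s - s') / (2 * pi)) = - (s - (s' + 2 * pi * of_int n))"
    by (simp add: field_simps)
  ultimately have "\<bar>s - (s' + 2 * pi * of_int n)\<bar> \<le> pi" by (metis abs_minus_cancel)
  then show ?thesis by (rule that)
qed

lemma bilipschitz_loop_inj:
  assumes "bilipschitz_loop m c" "0 < m" shows "no_self_intersections c"
  unfolding no_self_intersections_def
proof (rule inj_onI)
  fix s s' assume s: "s \<in> {0..<2 * pi}" "s' \<in> {0..<2 * pi}" "c s = c s'"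
  obtain n :: int where n: "\<bar>s - (s' + 2 * pi * of_int n)\<bar> \<le> pi" by (rule ex_period_near)
  have p: "c (s' + 2 * pi * of_int n) = c s'"
    using assms(1) by (intro periodic_shift_int) (auto simp: bilipschitz_loop_def)
  have "m * \<bar>s - (s' + 2 * pi * of_int n)\<bar> \<le> norm (c s - c (s' + 2 * pi * of_int n))"
    using assms(1) n unfolding bilipschitz_loop_def by blast
  then have "m * \<bar>s - (s' + 2 * pi * of_int n)\<bar> \<le> 0" using p s(3) by simp
  then have eq: "s = s' + 2 * pi * of_int n" using assms(2) by (simp add: mult_le_0_iff)
  then have "\<bar>2 * pi * of_int n\<bar> < 2 * pi * 1" using s(1,2) by auto
  then have "2 * pi * \<bar>of_int n\<bar> < 2 * pi * (1::real)" by (simp add: abs_mult)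
  then have "\<bar>of_int n\<bar> < (1::real)" using mult_less_cancel_left_pos[of "2 * pi"] by simp
  then have "n = 0" by linarith
  then show "s = s'" using eq by simp
qed

text \<open>The perturbation \<open>c' - c\<close> is \<open>(e / m)\<close>-Lipschitz as a function of the point \<open>c s\<close>. Its extension to the
whole space is a contraction, and adding it to the identity carries \<open>c\<close> to \<open>c'\<close>.\<close>

lemma same_type_if_lipschitz_close:
  assumes c: "bilipschitz_loop m c" and m: "0 < m" and c': "\<And>s. c' (s + 2 * pi) = c' s"
    and close: "e-lipschitz_on UNIV (\<lambda>s. c' s - c s)" and e: "3 * e < m"
  shows "same_type (c ` {0..2 * pi}) (c' ` {0..2 * pi})"
proof -
  have e0: "0 \<le> e" using close by (rule lipschitz_on_nonneg)
  have per: "c (s + 2 * pi) = c s" for s using c by (auto simp: bilipschitz_loop_def)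
  have key: "dist (c' s - c s) (c' s' - c s') \<le> e / m * dist (c s) (c s')" for s s'
  proof -
    obtain n :: int where n: "\<bar>s - (s' + 2 * pi * of_int n)\<bar> \<le> pi" by (rule ex_period_near)
    define r where "r = s' + 2 * pi * of_int n"
    have cr: "c r = c s'" "c' r = c' s'"
      unfolding r_def by (rule periodic_shift_int, rule per, rule periodic_shift_int, rule c')
    have "m * \<bar>s - r\<bar> \<le> norm (c s - c r)" using c n unfolding bilipschitz_loop_def r_def by blast
    then have "\<bar>s - r\<bar> \<le> dist (c s) (c r) / m" using m by (simp add: field_simps dist_norm)
    then have "e * \<bar>s - r\<bar> \<le> e * (dist (c s) (c r) / m)" by (rule mult_left_mono[OF _ e0])
    moreover have "dist (c' s - c s) (c' r - c r) \<le> e * \<bar>s - r\<bar>"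
      using lipschitz_onD[OF close, of s r] by (simp add: dist_real_def)
    ultimately show ?thesis unfolding cr by (simp add: field_simps)
  qed
  \<comment> \<open>any parameter of the point \<open>p\<close> may be chosen, by the inequality above\<close>
  define g0 where "g0 = (\<lambda>p. (\<lambda>s. c' s - c s) (SOME s. c s = p))"
  have g0: "g0 (c s) = c' s - c s" for s
  proof -
    have "c (SOME r. c r = c s) = c s" by (rule someI[where x = s]) simp
    then show ?thesis using key[of "SOME r. c r = c s" s] by (simp add: g0_def)
  qed
  have "(e / m)-lipschitz_on (range c) g0"
  proof (rule lipschitz_onI)
    fix x y assume "x \<in> range c" "y \<in> range c"
    then show "dist (g0 x) (g0 y) \<le> e / m * dist x y" using key by (auto simp: g0)
  qed (use e0 m in auto)
  then obtain g where g: "(3 * (e / m))-lipschitz_on UNIV g" "\<And>x. x \<in> range c \<Longrightarrow> g x = g0 x"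
    using lipschitz_extension[of "e / m" "range c" g0] by auto
  have lt: "3 * (e / m) < 1" using e m by (simp add: field_simps)
  obtain k where k: "homeomorphism UNIV UNIV (\<lambda>x. x + g x) k"
    using homeomorphism_id_plus_contraction[OF g(1) lt] .
  have "c s + g (c s) = c' s" for s using g(2)[of "c s"] g0 by simp
  then have "(\<lambda>x. x + g x) ` (c ` {0..2 * pi}) = c' ` {0..2 * pi}" by (simp add: image_image)
  then show ?thesis
    using k orientation_preserving_id_plus_contraction[OF g(1) lt] unfolding same_type_def by blast
qed

lemma bilipschitz_loop_perturb:
  assumes c: "bilipschitz_loop m c" and c': "\<And>s. c' (s + 2 * pi) = c' s"
    and close: "e-lipschitz_on UNIV (\<lambda>s. c' s - c s)"
  shows "bilipschitz_loop (m - e) c'"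
  unfolding bilipschitz_loop_def
proof (intro conjI allI impI)
  fix s s' :: real assume s: "\<bar>s - s'\<bar> \<le> pi"
  have "m * \<bar>s - s'\<bar> \<le> norm (c s - c s')" using c s by (auto simp: bilipschitz_loop_def)
  also have "c s - c s' = (c' s - c' s') - ((c' s - c s) - (c' s' - c s'))" by simp
  also have "norm \<dots> \<le> norm (c' s - c' s') + norm ((c' s - c s) - (c' s' - c s'))"
    by (rule norm_triangle_ineq4)
  also have "norm ((c' s - c s) - (c' s' - c s')) \<le> e * \<bar>s - s'\<bar>"
    using lipschitz_onD[OF close, of s s'] by (simp add: dist_norm)
  finally show "(m - e) * \<bar>s - s'\<bar> \<le> norm (c' s - c' s')" by (simp add: algebra_simps)
qed (rule c')

text \<open>The perturbed loop is itself bi-Lipschitz, so the roles of the two loops can be exchanged, which gives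
the ambient homeomorphism in the direction that the definition of type asks for.\<close>

lemma has_type_stable:
  assumes c: "bilipschitz_loop m c" and m: "0 < m" and c': "\<And>s. c' (s + 2 * pi) = c' s"
    and close: "e-lipschitz_on UNIV (\<lambda>s. c' s - c s)" and e: "4 * e < m"
    and G: "same_type (c ` {0..2 * pi}) G"
  shows "has_type c' G"
proof -
  have e0: "0 \<le> e" using close by (rule lipschitz_on_nonneg)
  have b: "bilipschitz_loop (m - e) c'" by (rule bilipschitz_loop_perturb[OF c c' close])
  have "e-lipschitz_on UNIV (\<lambda>s. c s - c' s)"
    using lipschitz_on_minus[OF close] by simp
  then have "same_type (c' ` {0..2 * pi}) (c ` {0..2 * pi})"
    using b c e e0 by (intro same_type_if_lipschitz_close) (auto simp: bilipschitz_loop_def)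
  then show ?thesis
    unfolding has_type_def using same_type_trans[OF _ G] bilipschitz_loop_inj[OF b] e e0 by simp
qed

section \<open>Immersed loops are bi-Lipschitz\<close>

text \<open>The derivative is a second argument rather than existentially hidden, so that a loop whose
derivative is again such a loop expresses twice continuous differentiability.\<close>

definition C1_loop :: "(real \<Rightarrow> 'a::real_normed_vector) \<Rightarrow> (real \<Rightarrow> 'a) \<Rightarrow> bool" where
  "C1_loop c c' \<longleftrightarrow> (\<forall>s. (c has_vector_derivative c' s) (at s)) \<and> continuous_on UNIV c' \<and>
     (\<forall>s. c (s + 2 * pi) = c s)"

lemma C1_loop_continuous: "C1_loop c c' \<Longrightarrow> continuous_on S c"
  unfolding C1_loop_def
  by (metis continuous_at_imp_continuous_on has_vector_derivative_continuous)

lemma C1_loop_derivative_periodic: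
  assumes "C1_loop c c'" shows "c' (s + 2 * pi) = c' s"
proof -
  have D: "(c has_vector_derivative c' r) (at r)" for r using assms by (auto simp: C1_loop_def)
  have "((\<lambda>r. r + 2 * pi) has_vector_derivative 1) (at s)"
    by (auto intro!: derivative_eq_intros)
  then have "((c \<circ> (\<lambda>r. r + 2 * pi)) has_vector_derivative 1 *\<^sub>R c' (s + 2 * pi)) (at s)"
    by (rule vector_diff_chain_at) (rule D)
  moreover have "c \<circ> (\<lambda>r. r + 2 * pi) = c" using assms by (auto simp: C1_loop_def fun_eq_iff)
  ultimately show ?thesis using vector_derivative_unique_at[OF _ D[of s]] by auto
qed

lemma C1_loop_eq_mod_period:
  assumes "\<And>s. c (s + 2 * pi) = c s" "no_self_intersections c" "c s = c s'"
  obtains n :: int where "s = s' + 2 * pi * of_int n"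
proof -
  define i where "i r = \<lfloor>r / (2 * pi)\<rfloor>" for r :: real
  have mem: "r - 2 * pi * of_int (i r) \<in> {0..<2 * pi}" for r
  proof -
    have "of_int (i r) \<le> r / (2 * pi)" "r / (2 * pi) < of_int (i r) + 1"
      unfolding i_def by linarith+
    then show ?thesis by (simp add: field_simps)
  qed
  have eq: "c (r - 2 * pi * of_int (i r)) = c r" for r
    using periodic_shift_int[of c, OF assms(1), of r "- i r"] by simp
  have "s - 2 * pi * of_int (i s) = s' - 2 * pi * of_int (i s')"
    using assms(2) mem eq assms(3) unfolding no_self_intersections_def inj_on_def by metis
  then have "s = s' + 2 * pi * of_int (i s - i s')" by (simp add: algebra_simps)
  then show ?thesis by (rule that)
qed

text \<open>For close parameters the chord is comparable to the derivative, which is bounded away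
from zero; for the remaining pairs of parameters, which form a compact set, injectivity bounds the chord from below.\<close>

lemma immersed_loop_bilipschitz:
  assumes c: "C1_loop c c'" and nz: "\<And>s. c' s \<noteq> 0" and inj: "no_self_intersections c"
  obtains m where "0 < m" "bilipschitz_loop m c"
proof -
  have per: "c (s + 2 * pi) = c s" for s using c by (auto simp: C1_loop_def)
  have D: "(c has_vector_derivative c' s) (at s within S)" for s S
    by (rule has_vector_derivative_at_within) (use c in \<open>auto simp: C1_loop_def\<close>)
  have cc: "continuous_on S c" "continuous_on S c'" for S
    using C1_loop_continuous[OF c] c continuous_on_subset[OF _ subset_UNIV] by (auto simp: C1_loop_def)
  let ?K = "{-pi..3 * pi}"
  have Kne: "?K \<noteq> {}" using pi_ge_zero by auto
  obtain s1 where s1: "s1 \<in> ?K" "\<And>s. s \<in> ?K \<Longrightarrow> norm (c' s1) \<le> norm (c' s)"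
    using continuous_attains_inf[OF compact_Icc Kne continuous_on_norm[OF cc(2)]] by metis
  define m1 where "m1 = norm (c' s1)"
  have m1: "0 < m1" using nz by (simp add: m1_def)
  have "uniformly_continuous_on ?K c'"
    by (rule compact_uniformly_continuous[OF cc(2) compact_Icc])
  then obtain d where d: "0 < d" "\<And>s s'. s \<in> ?K \<Longrightarrow> s' \<in> ?K \<Longrightarrow> dist s' s < d \<Longrightarrow> dist (c' s') (c' s) < m1 / 2"
    using m1 unfolding uniformly_continuous_on_def by (metis half_gt_zero)
  have near: "m1 / 2 * \<bar>s - s'\<bar> \<le> norm (c s - c s')" if "s \<in> ?K" "s' \<in> ?K" "\<bar>s - s'\<bar> < d" for s s'
  proof -
    have "norm (c s - c s' - (s - s') *\<^sub>R c' s) \<le> norm (s - s') * (m1 / 2)"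
    proof (rule vector_differentiable_bound_linearization[where S = "closed_segment s' s"])
      fix r assume r: "r \<in> closed_segment s' s"
      then have "r \<in> ?K" "\<bar>r - s\<bar> \<le> \<bar>s - s'\<bar>"
        using that by (auto simp: closed_segment_eq_real_ivl split: if_splits)
      then show "norm (c' r - c' s) \<le> m1 / 2"
        using d(2)[of s r] that by (simp add: dist_norm)
    qed (auto intro: D)
    moreover have "norm ((s - s') *\<^sub>R c' s) \<le> norm (c s - c s') + norm (c s - c s' - (s - s') *\<^sub>R c' s)"
      using norm_triangle_ineq4[of "c s - c s'" "c s - c s' - (s - s') *\<^sub>R c' s"] by simp
    moreover have "m1 * \<bar>s - s'\<bar> \<le> norm ((s - s') *\<^sub>R c' s)"
      using s1(2)[OF that(1)] by (simp add: m1_def mult_mono mult.commute)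
    ultimately show ?thesis by (simp add: algebra_simps)
  qed
  define P where "P = {p. fst p \<in> {0..2 * pi} \<and> d \<le> \<bar>fst p - snd p\<bar> \<and> \<bar>fst p - snd p\<bar> \<le> (pi::real)}"
  have "closed P" unfolding P_def atLeastAtMost_iff
    by (intro closed_Collect_conj closed_Collect_le continuous_intros)
  moreover have "P \<subseteq> {0..2 * pi} \<times> ?K"
    unfolding P_def by (rule subsetI) (simp add: mem_Times_iff, linarith)
  then have "bounded P"
    by (rule bounded_subset[rotated]) (intro bounded_Times bounded_closed_interval)
  ultimately have cP: "compact P" by (simp add: compact_eq_bounded_closed)
  have "\<exists>m2>0. \<forall>p\<in>P. m2 \<le> norm (c (fst p) - c (snd p))"
  proof (cases "P = {}")
    case False
    have "continuous_on P (\<lambda>p. c (fst p))" "continuous_on P (\<lambda>p. c (snd p))"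
      by (rule continuous_on_compose2[OF cc(1)[of UNIV]]; simp add: continuous_on_fst continuous_on_snd)+
    then have "continuous_on P (\<lambda>p. norm (c (fst p) - c (snd p)))"
      by (intro continuous_on_norm continuous_on_diff)
    then obtain p where p: "p \<in> P" "\<And>q. q \<in> P \<Longrightarrow> norm (c (fst p) - c (snd p)) \<le> norm (c (fst q) - c (snd q))"
      using continuous_attains_inf[OF cP False, of "\<lambda>p. norm (c (fst p) - c (snd p))"] by blast
    have "c (fst p) \<noteq> c (snd p)"
    proof
      assume "c (fst p) = c (snd p)"
      from C1_loop_eq_mod_period[of c, OF per inj this]
      obtain n :: int where n: "fst p = snd p + 2 * pi * of_int n" .
      then have "\<bar>fst p - snd p\<bar> = 2 * pi * \<bar>of_int n\<bar>" by (simp add: abs_mult)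
      moreover have "n \<noteq> 0" using n p(1) d(1) by (auto simp: P_def)
      then have "1 \<le> \<bar>of_int n :: real\<bar>" by linarith
      then have "2 * pi * 1 \<le> 2 * pi * \<bar>of_int n\<bar>" by (intro mult_left_mono) auto
      moreover have "\<bar>fst p - snd p\<bar> \<le> pi" using p(1) by (auto simp: P_def)
      ultimately show False using pi_gt_zero by linarith
    qed
    then show ?thesis using p by (intro exI[of _ "norm (c (fst p) - c (snd p))"]) auto
  qed (auto intro: exI[of _ 1])
  then obtain m2 where m2: "0 < m2" "\<And>p. p \<in> P \<Longrightarrow> m2 \<le> norm (c (fst p) - c (snd p))" by auto
  define m where "m = min (m1 / 2) (m2 / pi)"
  have m_le: "m \<le> m1 / 2" "m \<le> m2 / pi"
    unfolding m_def by (rule min.cobounded1, rule min.cobounded2)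
  have base: "m * \<bar>s - s'\<bar> \<le> norm (c s - c s')" if s: "s \<in> {0..2 * pi}" "\<bar>s - s'\<bar> \<le> pi" for s s'
  proof (cases "\<bar>s - s'\<bar> < d")
    case True
    have "m * \<bar>s - s'\<bar> \<le> m1 / 2 * \<bar>s - s'\<bar>" by (intro mult_right_mono m_le) simp
    also have "\<dots> \<le> norm (c s - c s')" using s True by (intro near) auto
    finally show ?thesis .
  next
    case False
    have "m * \<bar>s - s'\<bar> \<le> m2 / pi * pi" using s m2 by (intro mult_mono m_le) auto
    also have "\<dots> \<le> norm (c s - c s')" using m2(2)[of "(s, s')"] s False by (auto simp: P_def)
    finally show ?thesis .
  qed
  have "bilipschitz_loop m c" unfolding bilipschitz_loop_def
  proof (intro conjI allI impI per)
    fix s s' :: real assume s: "\<bar>s - s'\<bar> \<le> pi"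
    obtain n :: int where n: "\<bar>pi - (s + 2 * pi * of_int n)\<bar> \<le> pi" by (rule ex_period_near)
    have "m * \<bar>(s + 2 * pi * of_int n) - (s' + 2 * pi * of_int n)\<bar>
        \<le> norm (c (s + 2 * pi * of_int n) - c (s' + 2 * pi * of_int n))"
      using n s by (intro base) auto
    then show "m * \<bar>s - s'\<bar> \<le> norm (c s - c s')" by (simp add: periodic_shift_int[of c, OF per])
  qed
  moreover have "0 < m" using m1 m2 by (simp add: m_def)
  ultimately show ?thesis using that[of m] by simp
qed

text \<open>The norm of bounded Lipschitz functions. It serves as a \<open>C\<^sup>1\<close> norm that can be handled
without derivatives, and products are continuous for it (\<open>lip_small_mult\<close>).\<close>

definition lip_small :: "real \<Rightarrow> (real \<Rightarrow> real) \<Rightarrow> bool" where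
  "lip_small e f \<longleftrightarrow> (\<forall>s. \<bar>f s\<bar> \<le> e) \<and> e-lipschitz_on UNIV f"

lemma lip_smallI:
  assumes "0 \<le> e" "\<And>s. \<bar>f s\<bar> \<le> e" "\<And>s s'. \<bar>f s - f s'\<bar> \<le> e * \<bar>s - s'\<bar>"
  shows "lip_small e f"
  using assms by (auto simp: lip_small_def dist_real_def intro!: lipschitz_onI)

lemma lip_smallD:
  assumes "lip_small e f"
  shows "0 \<le> e" "\<bar>f s\<bar> \<le> e" "\<bar>f s - f s'\<bar> \<le> e * \<bar>s - s'\<bar>"
  using assms lipschitz_on_nonneg lipschitz_onD[of e UNIV f s s']
  by (auto simp: lip_small_def dist_real_def)

lemma lip_small_mono: "lip_small e f \<Longrightarrow> e \<le> e' \<Longrightarrow> lip_small e' f"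
  unfolding lip_small_def using lipschitz_on_le order_trans by metis

lemma lip_small_add:
  assumes "lip_small a f" "lip_small b g" shows "lip_small (a + b) (\<lambda>s. f s + g s)"
  using assms abs_triangle_ineq order_trans add_mono lipschitz_on_add[of a UNIV f b g]
  unfolding lip_small_def by (metis (no_types, lifting))

lemma lip_small_minus:
  assumes "lip_small a f" shows "lip_small a (\<lambda>s. - f s)"
  using assms unfolding lip_small_def by simp

lemma lip_small_mult:
  assumes f: "lip_small a f" and g: "lip_small b g" shows "lip_small (2 * a * b) (\<lambda>s. f s * g s)"
proof (rule lip_smallI)
  note F = lip_smallD[OF f] and G = lip_smallD[OF g]
  show "0 \<le> 2 * a * b" using F(1) G(1) by simp
  fix s s'
  have ab: "\<bar>f s * g s\<bar> \<le> a * b" unfolding abs_mult using F G by (intro mult_mono) auto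
  then show "\<bar>f s * g s\<bar> \<le> 2 * a * b" using F(1) G(1) mult_nonneg_nonneg[of a b] by linarith
  have "f s * g s - f s' * g s' = f s * (g s - g s') + g s' * (f s - f s')" by (simp add: algebra_simps)
  then have "\<bar>f s * g s - f s' * g s'\<bar> \<le> \<bar>f s\<bar> * \<bar>g s - g s'\<bar> + \<bar>g s'\<bar> * \<bar>f s - f s'\<bar>"
    by (metis abs_mult abs_triangle_ineq)
  also have "\<dots> \<le> a * (b * \<bar>s - s'\<bar>) + b * (a * \<bar>s - s'\<bar>)"
    using F G by (intro add_mono mult_mono) auto
  finally show "\<bar>f s * g s - f s' * g s'\<bar> \<le> 2 * a * b * \<bar>s - s'\<bar>" by (simp add: algebra_simps)
qed

lemma lipschitz_on_real_if_derivative_bound: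
  fixes f :: "real \<Rightarrow> real"
  assumes "convex S" "\<And>x. x \<in> S \<Longrightarrow> (f has_vector_derivative f' x) (at x within S)"
    and "\<And>x. x \<in> S \<Longrightarrow> \<bar>f' x\<bar> \<le> e" "0 \<le> e"
  shows "e-lipschitz_on S f"
proof (rule lipschitz_onI[OF _ assms(4)])
  fix x y assume xy: "x \<in> S" "y \<in> S"
  have "norm (f x - f y) \<le> e * norm (x - y)"
  proof (rule differentiable_bound[OF assms(1) _ _ xy])
    fix z assume z: "z \<in> S"
    show "(f has_derivative (\<lambda>h. h *\<^sub>R f' z)) (at z within S)"
      using assms(2)[OF z] by (simp add: has_vector_derivative_def)
    show "onorm (\<lambda>h. h *\<^sub>R f' z) \<le> e"
      by (rule onorm_bound) (use assms(3)[OF z] assms(4) in \<open>auto simp: abs_mult mult.commute[of e] intro!: mult_left_mono\<close>)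
  qed
  then show "dist (f x) (f y) \<le> e * dist x y" by (simp add: dist_norm)
qed

lemma periodic_bounded:
  fixes f :: "real \<Rightarrow> 'a::real_normed_vector"
  assumes "continuous_on UNIV f" "\<And>s. f (s + 2 * pi) = f s"
  obtains B where "0 \<le> B" "\<And>s. norm (f s) \<le> B"
proof -
  have "compact (f ` {0..2 * pi})"
    by (intro compact_continuous_image continuous_on_subset[OF assms(1)]) auto
  then obtain B where B: "\<And>s. s \<in> {0..2 * pi} \<Longrightarrow> norm (f s) \<le> B"
    using compact_imp_bounded bounded_iff by (metis imageI)
  have "norm (f s) \<le> B" for s
  proof -
    obtain n :: int where n: "\<bar>pi - (s + 2 * pi * of_int n)\<bar> \<le> pi" by (rule ex_period_near)
    then have "s + 2 * pi * of_int n \<in> {0..2 * pi}" unfolding atLeastAtMost_iff by linarith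
    then show ?thesis using B[of "s + 2 * pi * of_int n"] by (simp add: periodic_shift_int[of f, OF assms(2)])
  qed
  moreover have "0 \<le> B" using calculation norm_ge_zero order_trans by metis
  ultimately show ?thesis using that by blast
qed

lemma C1_loop_lip_small:
  assumes "C1_loop f f'" obtains B where "lip_small B f"
proof -
  have per: "f (s + 2 * pi) = f s" for s using assms by (auto simp: C1_loop_def)
  obtain B1 where B1: "0 \<le> B1" "\<And>s. norm (f s) \<le> B1"
    using periodic_bounded[of f, OF C1_loop_continuous[OF assms] per] by metis
  obtain B2 where B2: "0 \<le> B2" "\<And>s. norm (f' s) \<le> B2"
    using periodic_bounded[of f', OF _ C1_loop_derivative_periodic[OF assms]] assms
    by (auto simp: C1_loop_def)
  have "B2-lipschitz_on UNIV f"
    by (rule lipschitz_on_real_if_derivative_bound[where f' = f']) (use assms B2 in \<open>auto simp: C1_loop_def\<close>)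
  then have "lip_small (max B1 B2) f"
    unfolding lip_small_def using B1 by (auto intro: lipschitz_on_le simp: le_max_iff_disj)
  then show ?thesis by (rule that)
qed

section \<open>Kernel sums are dense along an embedded loop\<close>

text \<open>Up to the factor \<open>exp (- \<bar>u\<bar>\<^sup>2)\<close>, these are the sums of kernels (\<open>kernel_sum_of_exp_sum\<close>). In contrast to
kernel sums they form an algebra, which is what an approximation argument in the style of
Stone and Weierstrass needs.\<close>

inductive exp_sum :: "(real^3 \<Rightarrow> real) \<Rightarrow> bool" where
  exp_sum_base: "exp_sum (\<lambda>u. a * exp (v \<bullet> u))"
| exp_sum_add: "exp_sum E \<Longrightarrow> exp_sum F \<Longrightarrow> exp_sum (\<lambda>u. E u + F u)"

lemma exp_sum_mult:
  assumes "exp_sum E" "exp_sum F" shows "exp_sum (\<lambda>u. E u * F u)"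
  using assms(1)
proof induction
  case (exp_sum_base a v)
  from assms(2) show ?case
  proof induction
    case (exp_sum_base b w)
    have "exp_sum (\<lambda>u. (a * b) * exp ((v + w) \<bullet> u))" by (rule exp_sum.exp_sum_base)
    then show ?case by (simp add: inner_add_left exp_add mult_ac)
  next
    case (exp_sum_add E F)
    then show ?case using exp_sum.exp_sum_add by (fastforce simp: distrib_left)
  qed
next
  case (exp_sum_add E1 E2)
  then show ?case using exp_sum.exp_sum_add by (fastforce simp: distrib_right)
qed

text \<open>The closure, in the norm above, of the algebra of exponential sums restricted to the loop \<open>y\<close>. The
following lemmas show that it is closed under the algebra operations, limits and composition with
continuously differentiable functions, until it is seen to contain all \<open>C\<^sup>1\<close> loops.\<close>

definition approximable :: "(real \<Rightarrow> real^3) \<Rightarrow> (real \<Rightarrow> real) \<Rightarrow> bool" where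
  "approximable y f \<longleftrightarrow> (\<forall>e>0. \<exists>E. exp_sum E \<and> lip_small e (\<lambda>s. E (y s) - f s))"

lemma approximable_exp_sum: "exp_sum E \<Longrightarrow> approximable y (\<lambda>s. E (y s))"
  unfolding approximable_def
  by (intro allI impI exI[of _ E]) (auto intro!: lip_smallI)

lemma approximable_const: "approximable y (\<lambda>s. a)"
  using approximable_exp_sum[OF exp_sum_base[of a 0]] by simp

lemma approximable_add:
  assumes "approximable y f" "approximable y g" shows "approximable y (\<lambda>s. f s + g s)"
  unfolding approximable_def
proof (intro allI impI)
  fix e :: real assume "0 < e"
  then obtain E F where "exp_sum E" "lip_small (e/2) (\<lambda>s. E (y s) - f s)"
    and "exp_sum F" "lip_small (e/2) (\<lambda>s. F (y s) - g s)"
    using assms unfolding approximable_def by (metis half_gt_zero)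
  then show "\<exists>E. exp_sum E \<and> lip_small e (\<lambda>s. E (y s) - (f s + g s))"
    using lip_small_add[of "e/2" "\<lambda>s. E (y s) - f s" "e/2" "\<lambda>s. F (y s) - g s"]
    by (intro exI[of _ "\<lambda>u. E u + F u"]) (auto intro: exp_sum_add simp: algebra_simps)
qed

lemma approximable_limit:
  assumes "\<And>e. 0 < e \<Longrightarrow> \<exists>g. approximable y g \<and> lip_small e (\<lambda>s. g s - f s)"
  shows "approximable y f"
  unfolding approximable_def
proof (intro allI impI)
  fix e :: real assume e: "0 < e"
  then obtain g where g: "approximable y g" "lip_small (e/2) (\<lambda>s. g s - f s)"
    using assms half_gt_zero by metis
  obtain E where "exp_sum E" "lip_small (e/2) (\<lambda>s. E (y s) - g s)"
    using g(1) e unfolding approximable_def by (metis half_gt_zero)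
  then show "\<exists>E. exp_sum E \<and> lip_small e (\<lambda>s. E (y s) - f s)"
    using lip_small_add[of "e/2" "\<lambda>s. E (y s) - g s" "e/2" "\<lambda>s. g s - f s"] g(2)
    by (intro exI[of _ E]) auto
qed

lemma C1_loop_exp_sum:
  assumes y: "C1_loop y y'" and "exp_sum E" obtains E' where "C1_loop (\<lambda>s. E (y s)) E'"
proof -
  have D: "(y has_vector_derivative y' s) (at s)" and per: "y (s + 2 * pi) = y s" for s
    using y by (auto simp: C1_loop_def)
  have "\<exists>E'. C1_loop (\<lambda>s. E (y s)) E'"
    using assms(2)
  proof induction
    case (exp_sum_base a v)
    have "C1_loop (\<lambda>s. a * exp (v \<bullet> y s)) (\<lambda>s. a * (exp (v \<bullet> y s) * (v \<bullet> y' s)))"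
      unfolding C1_loop_def
    proof (intro conjI allI)
      fix s
      have "((\<lambda>s. v \<bullet> y s) has_real_derivative v \<bullet> y' s) (at s)"
        using bounded_linear.has_vector_derivative[OF bounded_linear_inner_right D]
        by (simp add: has_real_derivative_iff_has_vector_derivative)
      then have "((\<lambda>s. a * exp (v \<bullet> y s)) has_real_derivative a * (exp (v \<bullet> y s) * (v \<bullet> y' s))) (at s)"
        by (intro DERIV_cmult DERIV_fun_exp)
      then show "((\<lambda>s. a * exp (v \<bullet> y s)) has_vector_derivative a * (exp (v \<bullet> y s) * (v \<bullet> y' s))) (at s)"
        by (simp add: has_real_derivative_iff_has_vector_derivative)
      show "continuous_on UNIV (\<lambda>s. a * (exp (v \<bullet> y s) * (v \<bullet> y' s)))"
        using y by (intro continuous_intros C1_loop_continuous[OF y]) (auto simp: C1_loop_def)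
    qed (simp add: per)
    then show ?case by blast
  next
    case (exp_sum_add E F)
    then obtain E' F' where "C1_loop (\<lambda>s. E (y s)) E'" "C1_loop (\<lambda>s. F (y s)) F'" by blast
    then have "C1_loop (\<lambda>s. E (y s) + F (y s)) (\<lambda>s. E' s + F' s)"
      by (auto simp: C1_loop_def intro!: has_vector_derivative_add continuous_intros)
    then show ?case by blast
  qed
  then show ?thesis using that by blast
qed

context
  fixes y :: "real \<Rightarrow> real^3" and y' :: "real \<Rightarrow> real^3"
  assumes y: "C1_loop y y'"
begin

lemma approximable_lip_small:
  assumes "approximable y f" obtains B where "0 < B" "lip_small B f"
proof -
  obtain E where E: "exp_sum E" "lip_small 1 (\<lambda>s. E (y s) - f s)"
    using assms unfolding approximable_def by (metis zero_less_one)
  obtain E' where "C1_loop (\<lambda>s. E (y s)) E'" using C1_loop_exp_sum[OF y E(1)] .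
  then obtain B where "lip_small B (\<lambda>s. E (y s))" using C1_loop_lip_small by blast
  from lip_small_add[OF this lip_small_minus[OF E(2)]] have *: "lip_small (B + 1) f" by simp
  show ?thesis
    by (rule that[of "B + 1 + 1"]) (use lip_smallD(1)[OF *] lip_small_mono[OF *] in auto)
qed

lemma approximable_mult:
  assumes f: "approximable y f" and g: "approximable y g" shows "approximable y (\<lambda>s. f s * g s)"
proof -
  have half: "approximable y (\<lambda>s. E (y s) * g s)" if E: "exp_sum E" for E
  proof -
    obtain B where B: "0 < B" "lip_small B (\<lambda>s. E (y s))"
      using approximable_lip_small[OF approximable_exp_sum[OF E]] .
    show ?thesis unfolding approximable_def
    proof (intro allI impI)
      fix e :: real assume "0 < e"
      then obtain F where F: "exp_sum F" "lip_small (e / (2 * B)) (\<lambda>s. F (y s) - g s)"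
        using g B(1) unfolding approximable_def by (metis divide_pos_pos mult_pos_pos zero_less_numeral)
      have "lip_small (2 * B * (e / (2 * B))) (\<lambda>s. E (y s) * (F (y s) - g s))"
        by (rule lip_small_mult[OF B(2) F(2)])
      then show "\<exists>F. exp_sum F \<and> lip_small e (\<lambda>s. F (y s) - E (y s) * g s)"
        using exp_sum_mult[OF E F(1)] B(1)
        by (intro exI[of _ "\<lambda>u. E u * F u"]) (simp add: algebra_simps)
    qed
  qed
  obtain B where B: "0 < B" "lip_small B g" using approximable_lip_small[OF g] .
  show ?thesis
  proof (rule approximable_limit)
    fix e :: real assume "0 < e"
    then obtain E where E: "exp_sum E" "lip_small (e / (2 * B)) (\<lambda>s. E (y s) - f s)"
      using f B(1) unfolding approximable_def by (metis divide_pos_pos mult_pos_pos zero_less_numeral)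
    have "lip_small (2 * (e / (2 * B)) * B) (\<lambda>s. (E (y s) - f s) * g s)"
      by (rule lip_small_mult[OF E(2) B(2)])
    then show "\<exists>h. approximable y h \<and> lip_small e (\<lambda>s. h s - f s * g s)"
      using half[OF E(1)] B(1) by (intro exI[of _ "\<lambda>s. E (y s) * g s"]) (simp add: algebra_simps)
  qed
qed

lemma approximable_polynomial:
  assumes "real_polynomial_function (P :: real \<Rightarrow> real)" and f: "approximable y f"
  shows "approximable y (\<lambda>s. P (f s))"
  using assms(1)
proof induction
  case (linear P)
  have "P x = P 1 * x" for x
    using linear_scale[OF bounded_linear.linear[OF linear], of x 1] by (simp add: mult.commute)
  then have eq: "(\<lambda>s. P (f s)) = (\<lambda>s. P 1 * f s)" by (intro ext)
  show ?case unfolding eq by (rule approximable_mult[OF approximable_const f])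
next
  case (const a)
  then show ?case by (rule approximable_const)
next
  case (add P Q)
  then show ?case by (intro approximable_add)
next
  case (mult P Q)
  then show ?case by (intro approximable_mult)
qed

end

lemma polynomial_antiderivative:
  assumes "real_polynomial_function (p :: real \<Rightarrow> real)"
  obtains P where "real_polynomial_function P" "\<And>x. (P has_real_derivative p x) (at x)"
proof -
  obtain a n where p: "p = (\<lambda>x. \<Sum>i\<le>n. a i * x ^ i)"
    using assms unfolding real_polynomial_function_iff_sum by metis
  define P where "P x = (\<Sum>i\<le>n. a i / real (Suc i) * x ^ Suc i)" for x
  have "real_polynomial_function (\<lambda>x. a i / real (Suc i) * x ^ Suc i)" for i
    by (rule real_polynomial_function.intros(4)[OF real_polynomial_function.intros(2)
        real_polynomial_function_power[OF real_polynomial_function.intros(1)[OF bounded_linear_ident]]])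
  then have "real_polynomial_function P"
    unfolding P_def by (intro real_polynomial_function_sum) auto
  moreover have "(P has_real_derivative p x) (at x)" for x
  proof -
    have "((\<lambda>x. a i / real (Suc i) * x ^ Suc i) has_real_derivative a i * x ^ i) (at x)" for i
      using DERIV_cmult[OF DERIV_pow[of "Suc i" x UNIV], of "a i / real (Suc i)"]
      by (simp del: power_Suc of_nat_Suc)
    then show ?thesis unfolding P_def p by (intro DERIV_sum) auto
  qed
  ultimately show ?thesis by (rule that)
qed

context
  fixes y :: "real \<Rightarrow> real^3" and y' :: "real \<Rightarrow> real^3"
  assumes y: "C1_loop y y'"
begin

text \<open>Approximate the derivative of \<open>\<psi>\<close> uniformly by a polynomial and integrate: the resulting polynomial
is close to \<open>\<psi>\<close> in the Lipschitz norm, and polynomials of approximable functions are approximable.\<close>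

lemma approximable_compose:
  assumes f: "approximable y f" and range: "\<And>s. f s \<in> {lo..hi}"
    and D: "\<And>x. x \<in> {lo..hi} \<Longrightarrow> (\<psi> has_real_derivative \<psi>' x) (at x within {lo..hi})"
    and cont: "continuous_on {lo..hi} \<psi>'"
  shows "approximable y (\<lambda>s. \<psi> (f s))"
proof (rule approximable_limit)
  fix e :: real assume e: "0 < e"
  obtain B where B: "0 < B" "lip_small B f" using approximable_lip_small[OF y f] .
  have lohi: "lo \<le> hi" using range[of 0] by simp
  define d where "d = e / (B + (hi - lo))"
  have d: "0 < d" using e B(1) lohi by (simp add: d_def)
  have d1: "d * B \<le> e" "d * (hi - lo) \<le> e" unfolding d_def using e B(1) lohi
    by (simp_all add: divide_simps mult_left_mono)
  obtain p where p: "real_polynomial_function p" "\<And>x. x \<in> {lo..hi} \<Longrightarrow> \<bar>\<psi>' x - p x\<bar> < d"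
    using Stone_Weierstrass_real_polynomial_function[OF compact_Icc cont d] by metis
  obtain P where P: "real_polynomial_function P" "\<And>x. (P has_real_derivative p x) (at x)"
    using polynomial_antiderivative[OF p(1)] by metis
  define Q where "Q x = P x + (\<psi> lo - P lo)" for x
  have Q: "real_polynomial_function Q" unfolding Q_def
    by (intro real_polynomial_function.intros P(1))
  have L: "d-lipschitz_on {lo..hi} (\<lambda>x. Q x - \<psi> x)"
  proof (rule lipschitz_on_real_if_derivative_bound[where f' = "\<lambda>x. p x - \<psi>' x"])
    fix x assume x: "x \<in> {lo..hi}"
    have "((\<lambda>x. Q x - \<psi> x) has_real_derivative (p x + 0) - \<psi>' x) (at x within {lo..hi})"
      unfolding Q_def using D[OF x] has_field_derivative_at_within[OF P(2)]
      by (intro DERIV_diff DERIV_add) auto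
    then show "((\<lambda>x. Q x - \<psi> x) has_vector_derivative p x - \<psi>' x) (at x within {lo..hi})"
      by (simp add: has_real_derivative_iff_has_vector_derivative)
    show "\<bar>p x - \<psi>' x\<bar> \<le> d" using p(2)[OF x] by (simp add: abs_minus_commute)
  qed (use d in auto)
  have Q0: "Q lo - \<psi> lo = 0" by (simp add: Q_def)
  have "lip_small e (\<lambda>s. Q (f s) - \<psi> (f s))"
  proof (rule lip_smallI)
    fix s s'
    have "\<bar>Q (f s) - \<psi> (f s)\<bar> \<le> d * \<bar>f s - lo\<bar>"
      using lipschitz_onD[OF L range[of s], of lo] Q0 lohi by (simp add: dist_real_def)
    also have "\<dots> \<le> d * (hi - lo)" using range[of s] d by (intro mult_left_mono) auto
    finally show "\<bar>Q (f s) - \<psi> (f s)\<bar> \<le> e" using d1 by simp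
    have "\<bar>Q (f s) - \<psi> (f s) - (Q (f s') - \<psi> (f s'))\<bar> \<le> d * \<bar>f s - f s'\<bar>"
      using lipschitz_onD[OF L range[of s] range[of s']] by (simp add: dist_real_def)
    also have "\<dots> \<le> d * (B * \<bar>s - s'\<bar>)" using lip_smallD(3)[OF B(2)] d by (intro mult_left_mono) auto
    also have "\<dots> = (d * B) * \<bar>s - s'\<bar>" by simp
    also have "\<dots> \<le> e * \<bar>s - s'\<bar>" using d1 by (intro mult_right_mono) auto
    finally show "\<bar>Q (f s) - \<psi> (f s) - (Q (f s') - \<psi> (f s'))\<bar> \<le> e * \<bar>s - s'\<bar>" .
  qed (use e in auto)
  then show "\<exists>g. approximable y g \<and> lip_small e (\<lambda>s. g s - \<psi> (f s))"
    using approximable_polynomial[OF y Q f] by (intro exI[of _ "\<lambda>s. Q (f s)"] conjI)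
qed

text \<open>Composing the exponential \<open>exp (v \<bullet> y s)\<close> with the logarithm recovers the linear function.\<close>

lemma approximable_linear: "approximable y (\<lambda>s. v \<bullet> y s)"
proof -
  have "exp_sum (\<lambda>u. 1 * exp (v \<bullet> u))" by (rule exp_sum_base)
  then have f: "approximable y (\<lambda>s. exp (v \<bullet> y s))" using approximable_exp_sum by fastforce
  obtain B where B: "0 \<le> B" "\<And>s. norm (v \<bullet> y s) \<le> B"
  proof (rule periodic_bounded[of "\<lambda>s. v \<bullet> y s"])
    show "continuous_on UNIV (\<lambda>s. v \<bullet> y s)"
      by (intro continuous_intros C1_loop_continuous[OF y])
  qed (use y in \<open>auto simp: C1_loop_def\<close>)
  have "approximable y (\<lambda>s. ln (exp (v \<bullet> y s)))"
  proof (rule approximable_compose[OF f, of "exp (- B)" "exp B" ln "\<lambda>x. 1 / x"])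
    show "exp (v \<bullet> y s) \<in> {exp (- B)..exp B}" for s using B(2)[of s] by auto
    fix x assume "x \<in> {exp (- B)..exp B}"
    then have "0 < x" using exp_gt_zero[of "- B"] less_le_trans[of 0 "exp (- B)" x] by (simp del: exp_gt_zero)
    then show "(ln has_real_derivative 1 / x) (at x within {exp (- B)..exp B})"
      by (rule has_field_derivative_at_within[OF DERIV_ln_divide])
  next
    show "continuous_on {exp (- B)..exp B} (\<lambda>x. 1 / x)"
    proof (intro continuous_on_divide continuous_on_const continuous_on_id ballI)
      fix x assume "x \<in> {exp (- B)..exp B}"
      then show "x \<noteq> 0" using exp_gt_zero[of "- B"] unfolding atLeastAtMost_iff by linarith
    qed
  qed
  then show ?thesis by simp
qed

lemma approximable_dist_square: "approximable y (\<lambda>s. (norm (y s - p))\<^sup>2)"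
proof -
  have c: "approximable y (\<lambda>s. y s $ i - p $ i)" for i
    using approximable_add[OF approximable_linear[of "axis i 1"] approximable_const[of y "- p $ i"]]
    unfolding inner_axis' inner_real_def by simp
  have eq: "(\<lambda>s. (norm (y s - p))\<^sup>2) = (\<lambda>s. (y s $ 1 - p $ 1) * (y s $ 1 - p $ 1) +
     (y s $ 2 - p $ 2) * (y s $ 2 - p $ 2) + (y s $ 3 - p $ 3) * (y s $ 3 - p $ 3))"
    unfolding power2_norm_eq_inner inner_vec_def sum_3 by (simp only: vector_minus_component inner_real_def)
  show ?thesis unfolding eq
    by (rule approximable_add[OF approximable_add[OF approximable_mult[OF y c c]
        approximable_mult[OF y c c]] approximable_mult[OF y c c]])
qed

end

text \<open>The square makes the truncation continuously differentiable; it is the profile of the bump functions below.\<close>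

lemma has_derivative_positive_part_square:
  "((\<lambda>z::real. (max 0 z)\<^sup>2) has_real_derivative 2 * max 0 z) (at z)"
proof -
  consider "0 < z" | "z < 0" | "z = 0" by linarith
  then show ?thesis
  proof cases
    case 1
    have "((\<lambda>x. x ^ 2) has_real_derivative 2 * z) (at z)"
      using DERIV_pow[of 2 z UNIV] by simp
    then have "((\<lambda>x. (max 0 x)\<^sup>2) has_real_derivative 2 * z) (at z)"
      by (rule has_field_derivative_transform_within_open[of _ _ _ "{0<..}"]) (use 1 in auto)
    then show ?thesis using 1 by simp
  next
    case 2
    have "((\<lambda>x. (max 0 x)\<^sup>2) has_real_derivative 0) (at z)"
      by (rule has_field_derivative_transform_within_open[OF DERIV_const[of 0], of "{..<0}"]) (use 2 in auto)
    then show ?thesis using 2 by simp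
  next
    case 3
    have "((\<lambda>h::real. ((max 0 (0 + h))\<^sup>2 - (max 0 0)\<^sup>2) / h) \<longlongrightarrow> 0) (at 0)"
    proof (rule tendsto_0_le[where K = 1])
      show "((\<lambda>h::real. h) \<longlongrightarrow> 0) (at 0)" by (rule tendsto_ident_at)
      have "norm (((max 0 (0 + h))\<^sup>2 - (max 0 0)\<^sup>2) / h) \<le> norm h * 1" for h :: real
        by (cases "0 < h") (simp_all add: power2_eq_square)
      then show "\<forall>\<^sub>F h::real in at 0. norm (((max 0 (0 + h))\<^sup>2 - (max 0 0)\<^sup>2) / h) \<le> norm h * 1"
        by (intro always_eventually allI)
    qed
    then show ?thesis unfolding 3 DERIV_def by simp
  qed
qed

lemma lip_small_if_derivative_bound:
  assumes "\<And>s. (f has_vector_derivative f' s) (at s)" "\<And>s. \<bar>f s\<bar> \<le> e" "\<And>s. \<bar>f' s\<bar> \<le> e"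
  shows "lip_small e f"
proof -
  have "0 \<le> e" using assms(2)[of 0] by linarith
  then have "e-lipschitz_on UNIV f"
    using assms by (intro lipschitz_on_real_if_derivative_bound[where f' = f']) auto
  then show ?thesis using assms(2) by (simp add: lip_small_def)
qed

lemma C1_loop_mult:
  fixes f g :: "real \<Rightarrow> real"
  assumes "C1_loop f f'" "C1_loop g g'" shows "C1_loop (\<lambda>s. f s * g s) (\<lambda>s. f s * g' s + f' s * g s)"
  unfolding C1_loop_def
proof (intro conjI allI)
  show "continuous_on UNIV (\<lambda>s. f s * g' s + f' s * g s)"
    using assms by (intro continuous_intros C1_loop_continuous[OF assms(1)] C1_loop_continuous[OF assms(2)])
       (auto simp: C1_loop_def)
  show "((\<lambda>s. f s * g s) has_vector_derivative f s * g' s + f' s * g s) (at s)" for s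
    using assms by (intro has_vector_derivative_mult) (auto simp: C1_loop_def)
qed (use assms in \<open>auto simp: C1_loop_def\<close>)

lemma C1_loop_compose:
  fixes f :: "real \<Rightarrow> real"
  assumes f: "C1_loop f f'" and g: "\<And>s. (g has_real_derivative g' (f s)) (at (f s))"
    and cont: "continuous_on (range f) g'"
  shows "C1_loop (\<lambda>s. g (f s)) (\<lambda>s. f' s * g' (f s))"
  unfolding C1_loop_def
proof (intro conjI allI)
  show "continuous_on UNIV (\<lambda>s. f' s * g' (f s))"
    using f by (intro continuous_intros continuous_on_compose2[OF cont C1_loop_continuous[OF f]])
       (auto simp: C1_loop_def)
  show "((\<lambda>s. g (f s)) has_vector_derivative f' s * g' (f s)) (at s)" for s
    using DERIV_chain2[where f = g and g = f and x = s, OF g[of s], of "f' s" UNIV] f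
    by (simp add: C1_loop_def has_real_derivative_iff_has_vector_derivative mult.commute)
qed (use f in \<open>auto simp: C1_loop_def\<close>)

lemma C1_loop_inner:
  assumes "C1_loop y y'" shows "C1_loop (\<lambda>s. v \<bullet> y s) (\<lambda>s. v \<bullet> y' s)"
  unfolding C1_loop_def
proof (intro conjI allI)
  show "continuous_on UNIV (\<lambda>s. v \<bullet> y' s)"
    using assms by (intro continuous_intros) (auto simp: C1_loop_def)
  show "((\<lambda>s. v \<bullet> y s) has_vector_derivative v \<bullet> y' s) (at s)" for s
    using assms by (intro bounded_linear.has_vector_derivative[OF bounded_linear_inner_right])
       (auto simp: C1_loop_def)
qed (use assms in \<open>auto simp: C1_loop_def\<close>)

lemma C1_loop_dist_square:
  fixes y :: "real \<Rightarrow> real^3"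
  assumes "C1_loop y y'" shows "C1_loop (\<lambda>s. (norm (y s - p))\<^sup>2) (\<lambda>s. 2 * ((y s - p) \<bullet> y' s))"
  unfolding C1_loop_def
proof (intro conjI allI)
  show "continuous_on UNIV (\<lambda>s. 2 * ((y s - p) \<bullet> y' s))"
    using assms by (intro continuous_intros C1_loop_continuous[OF assms]) (auto simp: C1_loop_def)
  fix s
  have "((\<lambda>s. y s - p) has_derivative (\<lambda>h. h *\<^sub>R y' s)) (at s)"
    using assms by (auto simp: C1_loop_def has_vector_derivative_def intro!: derivative_eq_intros)
  from has_derivative_inner[OF this this]
  show "((\<lambda>s. (norm (y s - p))\<^sup>2) has_vector_derivative 2 * ((y s - p) \<bullet> y' s)) (at s)"
    unfolding has_vector_derivative_def power2_norm_eq_inner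
    by (rule has_derivative_eq_rhs) (auto simp: fun_eq_iff inner_commute algebra_simps)
qed (use assms in \<open>auto simp: C1_loop_def\<close>)

text \<open>Near \<open>s0\<close> the function \<open>q s = y' s0 \<bullet> y s\<close> is a coordinate on the loop, so \<open>f' / q'\<close> is a continuous
function of \<open>q\<close> and uniformly close to a polynomial in \<open>q\<close>. Integrating, \<open>f\<close> is close, with its derivative,
to a polynomial \<open>Q\<close> in \<open>q\<close> on a whole arc. The bump \<open>\<eta>\<close> is a function of \<open>\<bar>y s - y s0\<bar>\<^sup>2\<close>, hence approximable,
and, as the loop is embedded, it vanishes off that arc; so \<open>\<eta> f\<close> is close to the approximable function \<open>\<eta> Q(q)\<close>.\<close>

lemma approximable_localized:
  assumes y: "C1_loop y y'" and m: "0 < m" "bilipschitz_loop m y" and nz: "y' s0 \<noteq> 0"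
  obtains \<eta> \<eta>' where "C1_loop \<eta> \<eta>'" "\<And>s. 0 \<le> \<eta> s" "0 < \<eta> s0"
    "\<And>f f'. C1_loop f f' \<Longrightarrow> approximable y (\<lambda>s. \<eta> s * f s)"
proof -
  define v where "v = y' s0"
  define q where "q s = v \<bullet> y s" for s
  define q' where "q' s = v \<bullet> y' s" for s
  have q: "C1_loop q q'" unfolding q_def q'_def by (rule C1_loop_inner[OF y])
  have qD: "(q has_vector_derivative q' s) (at s)" for s using q by (auto simp: C1_loop_def)
  have q'c: "continuous_on S q'" for S
    using q continuous_on_subset[OF _ subset_UNIV] by (auto simp: C1_loop_def)
  have "0 < q' s0" using nz by (simp add: q'_def v_def)
  then have "\<forall>\<^sub>F s in nhds s0. 0 < q' s"
    using q'c[of UNIV] by (metis continuous_on_eq_continuous_at open_UNIV UNIV_I isCont_def tendsto_at_iff_tendsto_nhds order_tendstoD(1))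
  then obtain r0 where r0: "0 < r0" "\<And>s. dist s s0 < r0 \<Longrightarrow> 0 < q' s"
    unfolding eventually_nhds_metric by blast
  define r where "r = min (r0 / 2) pi"
  have r: "0 < r" "r \<le> pi" using r0 by (auto simp: r_def)
  let ?J = "{s0 - r..s0 + r}"
  have q'pos: "0 < q' s" if "s \<in> ?J" for s
    using that r0 by (intro r0(2)) (auto simp: dist_real_def r_def abs_le_iff)
  have mono: "q a < q b" if "a < b" "a \<in> ?J" "b \<in> ?J" for a b
  proof (rule DERIV_pos_imp_increasing[OF that(1)])
    fix x assume "a \<le> x" "x \<le> b"
    then show "\<exists>D. (q has_real_derivative D) (at x) \<and> 0 < D"
      using qD q'pos[of x] that by (auto simp: has_real_derivative_iff_has_vector_derivative)
  qed
  have inj: "inj_on q ?J"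
    by (rule linorder_inj_onI') (use mono in \<open>auto simp: less_imp_neq\<close>)
  define g where "g = the_inv_into ?J q"
  have gq: "g (q s) = s" if "s \<in> ?J" for s using inj that by (simp add: g_def the_inv_into_f_f)
  have gcont: "continuous_on (q ` ?J) g"
    by (rule continuous_on_inv[OF C1_loop_continuous[OF q] compact_Icc]) (use gq in auto)
  define \<rho> where "\<rho> = (m * r)\<^sup>2"
  have \<rho>: "0 < \<rho>" using m r by (simp add: \<rho>_def)
  have near: "\<exists>n::int. s + 2 * pi * of_int n \<in> ?J" if "(norm (y s - y s0))\<^sup>2 < \<rho>" for s
  proof -
    obtain n :: int where n: "\<bar>s0 - (s + 2 * pi * of_int n)\<bar> \<le> pi" by (rule ex_period_near)
    have "m * \<bar>s0 - (s + 2 * pi * of_int n)\<bar> \<le> norm (y s0 - y (s + 2 * pi * of_int n))"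
      using m(2) n unfolding bilipschitz_loop_def by blast
    also have "\<dots> = norm (y s - y s0)"
      using y by (subst periodic_shift_int[of y]) (auto simp: C1_loop_def norm_minus_commute)
    also have "\<dots> < m * r"
      by (rule power_less_imp_less_base[of _ 2]) (use that m r in \<open>auto simp: \<rho>_def\<close>)
    finally have "\<bar>s0 - (s + 2 * pi * of_int n)\<bar> < r" using m by simp
    then have "s + 2 * pi * of_int n \<in> ?J" unfolding atLeastAtMost_iff by linarith
    then show ?thesis by blast
  qed
  define \<beta> where "\<beta> x = (max 0 (\<rho> - x))\<^sup>2" for x
  have \<beta>D: "(\<beta> has_real_derivative - (2 * max 0 (\<rho> - x))) (at x)" for x
  proof -
    have "((\<lambda>x. \<rho> - x) has_real_derivative - 1) (at x)" by (auto intro!: derivative_eq_intros)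
    from DERIV_chain2[where f = "\<lambda>z. (max 0 z)\<^sup>2", OF has_derivative_positive_part_square this]
    show ?thesis unfolding \<beta>_def by simp
  qed
  have \<beta>'c: "continuous_on S (\<lambda>x. - (2 * max 0 (\<rho> - x)))" for S by (intro continuous_intros)
  define d where "d s = (norm (y s - y s0))\<^sup>2" for s
  define d' where "d' s = 2 * ((y s - y s0) \<bullet> y' s)" for s
  have d: "C1_loop d d'" unfolding d_def d'_def by (rule C1_loop_dist_square[OF y])
  define \<eta> where "\<eta> s = \<beta> (d s)" for s
  define \<eta>' where "\<eta>' s = d' s * - (2 * max 0 (\<rho> - d s))" for s
  have \<eta>: "C1_loop \<eta> \<eta>'" unfolding \<eta>_def \<eta>'_def by (rule C1_loop_compose[OF d \<beta>D \<beta>'c])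
  have off: "\<eta> s = 0" "\<eta>' s = 0" if "\<rho> \<le> d s" for s using that by (auto simp: \<eta>_def \<eta>'_def \<beta>_def)
  have \<eta>approx: "approximable y \<eta>"
  proof -
    obtain B where B: "0 \<le> B" "\<And>s. norm (d s) \<le> B"
      using periodic_bounded[of d] C1_loop_continuous[OF d] d by (auto simp: C1_loop_def)
    show ?thesis unfolding \<eta>_def
    proof (rule approximable_compose[OF y, of d 0 B])
      show "approximable y d" unfolding d_def by (rule approximable_dist_square[OF y])
      show "d s \<in> {0..B}" for s using B(2)[of s] by (simp add: d_def)
      show "(\<beta> has_real_derivative - (2 * max 0 (\<rho> - x))) (at x within {0..B})" for x
        by (rule has_field_derivative_at_within[OF \<beta>D])
    qed (rule \<beta>'c)
  qed
  have "approximable y (\<lambda>s. \<eta> s * f s)" if f: "C1_loop f f'" for f f'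
  proof (rule approximable_limit)
    fix e :: real assume e: "0 < e"
    have fD: "(f has_vector_derivative f' s) (at s)" for s using f by (auto simp: C1_loop_def)
    have f'c: "continuous_on S f'" for S
      using f continuous_on_subset[OF _ subset_UNIV] by (auto simp: C1_loop_def)
    obtain Bq where Bq: "0 \<le> Bq" "\<And>s. norm (q' s) \<le> Bq"
      using periodic_bounded[of q', OF q'c C1_loop_derivative_periodic[OF q]] by metis
    obtain B1 where B1: "0 \<le> B1" "\<And>s. norm (\<eta> s) \<le> B1"
      using periodic_bounded[of \<eta>] C1_loop_continuous[OF \<eta>] \<eta> by (auto simp: C1_loop_def)
    obtain B2 where B2: "0 \<le> B2" "\<And>s. norm (\<eta>' s) \<le> B2"
      using periodic_bounded[of \<eta>', OF _ C1_loop_derivative_periodic[OF \<eta>]] \<eta> by (auto simp: C1_loop_def)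
    define C where "C = (B1 + B2 * r + B1 * r) * Bq + 1"
    have C: "0 < C" using B1 B2 Bq r by (simp add: C_def add_nonneg_pos)
    define \<epsilon> where "\<epsilon> = e / C"
    have \<epsilon>: "0 < \<epsilon>" using e C by (simp add: \<epsilon>_def)
    have Ce: "(B1 + B2 * r + B1 * r) * (\<epsilon> * Bq) \<le> e"
    proof -
      have "(B1 + B2 * r + B1 * r) * (\<epsilon> * Bq) \<le> C * \<epsilon>"
        using \<epsilon> by (simp add: C_def algebra_simps)
      then show ?thesis using C by (simp add: \<epsilon>_def)
    qed
    have cont: "continuous_on (q ` ?J) (\<lambda>t. f' (g t) / q' (g t))"
      by (intro continuous_intros continuous_on_compose2[OF f'c gcont] continuous_on_compose2[OF q'c gcont])
         (use q'pos gq in \<open>auto simp: less_imp_neq[symmetric]\<close>)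
    have cpt: "compact (q ` ?J)"
      by (intro compact_continuous_image C1_loop_continuous[OF q] compact_Icc)
    obtain p where p: "real_polynomial_function p"
      "\<And>t. t \<in> q ` ?J \<Longrightarrow> \<bar>f' (g t) / q' (g t) - p t\<bar> < \<epsilon>"
      using Stone_Weierstrass_real_polynomial_function[OF cpt cont \<epsilon>] by blast
    obtain P where P: "real_polynomial_function P" "\<And>x. (P has_real_derivative p x) (at x)"
      using polynomial_antiderivative[OF p(1)] by blast
    define Q where "Q x = P x + (f s0 - P (q s0))" for x
    have Q: "real_polynomial_function Q" unfolding Q_def
      by (intro real_polynomial_function.intros P(1))
    have Qq: "C1_loop (\<lambda>s. Q (q s)) (\<lambda>s. q' s * p (q s))"
    proof (rule C1_loop_compose[OF q])
      show "(Q has_real_derivative p (q s)) (at (q s))" for s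
        unfolding Q_def using DERIV_add[OF P(2) DERIV_const] by simp
      show "continuous_on (range q) p"
        using p(1) by (intro continuous_on_polymonial_function) (simp add: real_polynomial_function_eq)
    qed
    define \<theta> where "\<theta> s = Q (q s) - f s" for s
    define \<theta>' where "\<theta>' s = q' s * p (q s) - f' s" for s
    have \<theta>: "C1_loop \<theta> \<theta>'"
      unfolding C1_loop_def
    proof (intro conjI allI)
      fix s
      have "((\<lambda>s. Q (q s) - f s) has_vector_derivative q' s * p (q s) - f' s) (at s)"
        by (rule has_vector_derivative_diff) (use Qq f in \<open>auto simp: C1_loop_def\<close>)
      then show "(\<theta> has_vector_derivative \<theta>' s) (at s)" by (simp add: \<theta>_def[abs_def] \<theta>'_def)
      show "\<theta> (s + 2 * pi) = \<theta> s" using Qq f by (simp add: \<theta>_def C1_loop_def)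
      show "continuous_on UNIV \<theta>'"
        using Qq f by (auto simp: \<theta>'_def[abs_def] C1_loop_def intro: continuous_on_diff)
    qed
    have \<theta>'J: "\<bar>\<theta>' s\<bar> \<le> \<epsilon> * Bq" if s: "s \<in> ?J" for s
    proof -
      have "\<theta>' s = - (q' s * (f' s / q' s - p (q s)))"
        using q'pos[OF s] by (simp add: \<theta>'_def field_simps)
      then have "\<bar>\<theta>' s\<bar> = \<bar>q' s\<bar> * \<bar>f' s / q' s - p (q s)\<bar>" by (simp add: abs_mult)
      also have "\<dots> \<le> Bq * \<epsilon>"
        using Bq p(2)[of "q s"] s by (intro mult_mono) (auto simp: gq less_imp_le)
      finally show ?thesis by (simp add: mult.commute)
    qed
    have \<theta>D: "(\<theta> has_vector_derivative \<theta>' s) (at s)" for s using \<theta> by (auto simp: C1_loop_def)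
    have "(\<epsilon> * Bq)-lipschitz_on ?J \<theta>"
      by (rule lipschitz_on_real_if_derivative_bound[where f' = \<theta>'])
         (use has_vector_derivative_at_within[OF \<theta>D] \<theta>'J \<epsilon> Bq in auto)
    moreover have "\<theta> s0 = 0" by (simp add: \<theta>_def Q_def)
    ultimately have \<theta>J: "\<bar>\<theta> s\<bar> \<le> \<epsilon> * Bq * r" if s: "s \<in> ?J" for s
    proof -
      have "\<bar>\<theta> s\<bar> \<le> \<epsilon> * Bq * \<bar>s - s0\<bar>"
        using lipschitz_onD[of "\<epsilon> * Bq" ?J \<theta> s s0] \<open>_-lipschitz_on ?J \<theta>\<close> \<open>\<theta> s0 = 0\<close> s r by (simp add: dist_real_def)
      also have "\<dots> \<le> \<epsilon> * Bq * r"
        using s \<epsilon> Bq by (intro mult_left_mono) (auto simp: abs_le_iff)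
      finally show ?thesis .
    qed
    let ?F = "\<lambda>s. \<eta> s * \<theta> s" and ?F' = "\<lambda>s. \<eta> s * \<theta>' s + \<eta>' s * \<theta> s"
    have F: "C1_loop ?F ?F'" by (rule C1_loop_mult[OF \<eta> \<theta>])
    have bound: "\<bar>?F s\<bar> \<le> e \<and> \<bar>?F' s\<bar> \<le> e" for s
    proof (cases "d s < \<rho>")
      case True
      then obtain n :: int where n: "s + 2 * pi * of_int n \<in> ?J" using near[of s] by (auto simp: d_def)
      define t where "t = s + 2 * pi * of_int n"
      have eq: "?F t = ?F s" "?F' t = ?F' s"
        unfolding t_def by (rule periodic_shift_int, use F in \<open>simp add: C1_loop_def\<close>,
            rule periodic_shift_int[of ?F'], rule C1_loop_derivative_periodic[OF F])
      have t: "t \<in> ?J" using n by (simp add: t_def)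
      have eB: "0 \<le> \<epsilon> * Bq" using \<epsilon> Bq by simp
      have 1: "\<bar>\<eta> t * \<theta> t\<bar> \<le> B1 * (\<epsilon> * Bq * r)" "\<bar>\<eta> t * \<theta>' t\<bar> \<le> B1 * (\<epsilon> * Bq)" "\<bar>\<eta>' t * \<theta> t\<bar> \<le> B2 * (\<epsilon> * Bq * r)"
        unfolding abs_mult using B1 B2 \<theta>J[OF t] \<theta>'J[OF t] by (auto intro!: mult_mono)
      have 2: "(B1 + B2 * r + B1 * r) * (\<epsilon> * Bq) = B1 * (\<epsilon> * Bq) + B2 * (\<epsilon> * Bq * r) + B1 * (\<epsilon> * Bq * r)"
        by (simp add: algebra_simps)
      have 3: "0 \<le> B1 * (\<epsilon> * Bq)" "0 \<le> B2 * (\<epsilon> * Bq * r)" "0 \<le> B1 * (\<epsilon> * Bq * r)"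
        using B1 B2 eB r by auto
      have "\<bar>?F t\<bar> \<le> e" using 1 2 3 Ce by linarith
      moreover have "\<bar>?F' t\<bar> \<le> e" using 1 2 3 Ce abs_triangle_ineq[of "\<eta> t * \<theta>' t" "\<eta>' t * \<theta> t"] by linarith
      ultimately show ?thesis using eq by simp
    next
      case False
      then show ?thesis using off[of s] e by simp
    qed
    have "lip_small e ?F"
      using bound F by (intro lip_small_if_derivative_bound[where f' = ?F']) (auto simp: C1_loop_def)
    moreover have "approximable y (\<lambda>s. \<eta> s * Q (q s))"
    proof (rule approximable_mult[OF y \<eta>approx])
      have "approximable y q" unfolding q_def by (rule approximable_linear[OF y])
      then show "approximable y (\<lambda>s. Q (q s))" by (rule approximable_polynomial[OF y Q])
    qed
    ultimately show "\<exists>h. approximable y h \<and> lip_small e (\<lambda>s. h s - \<eta> s * f s)"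
      by (intro exI[of _ "\<lambda>s. \<eta> s * Q (q s)"]) (auto simp: \<theta>_def algebra_simps)
  qed
  moreover have "0 < \<eta> s0" using \<rho> by (simp add: \<eta>_def \<beta>_def d_def)
  moreover have "0 \<le> \<eta> s" for s by (simp add: \<eta>_def \<beta>_def)
  ultimately show ?thesis using \<eta> that by metis
qed

lemma approximable_sum:
  assumes "finite T" "\<And>t. t \<in> T \<Longrightarrow> approximable y (f t)" shows "approximable y (\<lambda>s. \<Sum>t\<in>T. f t s)"
  using assms by (induction T rule: finite_induct) (auto intro: approximable_const approximable_add)

lemma C1_loop_sum:
  fixes f f' :: "'i \<Rightarrow> real \<Rightarrow> real"
  assumes "\<And>t. t \<in> T \<Longrightarrow> C1_loop (f t) (f' t)"
  shows "C1_loop (\<lambda>s. \<Sum>t\<in>T. f t s) (\<lambda>s. \<Sum>t\<in>T. f' t s)"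
  using assms by (auto simp: C1_loop_def intro!: has_vector_derivative_sum continuous_intros)

text \<open>A partition of unity: finitely many of the bumps have a positive sum \<open>X\<close>, and \<open>f\<close> is the sum of the
bumps multiplied by the \<open>C\<^sup>1\<close> loop \<open>f / X\<close>.\<close>

theorem C1_loop_approximable:
  assumes y: "C1_loop y y'" and nz: "\<And>s. y' s \<noteq> 0" and inj: "no_self_intersections y"
    and f: "C1_loop f f'"
  shows "approximable y f"
proof -
  obtain m where m: "0 < m" "bilipschitz_loop m y" using immersed_loop_bilipschitz[OF y nz inj] .
  have "\<exists>\<eta> \<eta>'. C1_loop \<eta> \<eta>' \<and> (\<forall>s. 0 \<le> \<eta> s) \<and> 0 < \<eta> t \<and>
      (\<forall>f f'. C1_loop f f' \<longrightarrow> approximable y (\<lambda>s. \<eta> s * f s))" for t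
    using approximable_localized[OF y m nz[of t]] by metis
  then obtain \<eta> \<eta>' where \<eta>: "\<And>t. C1_loop (\<eta> t) (\<eta>' t)" "\<And>t s. 0 \<le> \<eta> t s" "\<And>t. 0 < \<eta> t t"
    "\<And>t f f'. C1_loop f f' \<Longrightarrow> approximable y (\<lambda>s. \<eta> t s * f s)" by metis
  obtain T where T: "T \<subseteq> {0..2 * pi}" "finite T" "{0..2 * pi} \<subseteq> (\<Union>t\<in>T. {s. 0 < \<eta> t s})"
  proof (rule compactE_image[of "{0..2 * pi}" "{0..2 * pi}" "\<lambda>t. {s. 0 < \<eta> t s}"])
    show "open {s. 0 < \<eta> t s}" for t
      by (intro open_Collect_less continuous_intros C1_loop_continuous[OF \<eta>(1)])
  qed (use \<eta>(3) in auto)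
  define X where "X s = (\<Sum>t\<in>T. \<eta> t s)" for s
  define X' where "X' s = (\<Sum>t\<in>T. \<eta>' t s)" for s
  have X: "C1_loop X X'" unfolding X_def X'_def by (rule C1_loop_sum[OF \<eta>(1)])
  have Xpos: "0 < X s" for s
  proof -
    obtain n :: int where n: "\<bar>pi - (s + 2 * pi * of_int n)\<bar> \<le> pi" by (rule ex_period_near)
    define r where "r = s + 2 * pi * of_int n"
    have "r \<in> {0..2 * pi}" using n unfolding r_def atLeastAtMost_iff by linarith
    then obtain t where "t \<in> T" "0 < \<eta> t r" using T(3) by auto
    then have "0 < X r" unfolding X_def using \<eta>(2) T(2) by (intro sum_pos2) auto
    moreover have "X r = X s" unfolding r_def
      by (rule periodic_shift_int) (use X in \<open>simp add: C1_loop_def\<close>)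
    ultimately show ?thesis by simp
  qed
  have inv: "C1_loop (\<lambda>s. inverse (X s)) (\<lambda>s. X' s * - (inverse (X s) ^ Suc (Suc 0)))"
  proof (rule C1_loop_compose[OF X, where g' = "\<lambda>x. - (inverse x ^ Suc (Suc 0))"])
    show "(inverse has_real_derivative - (inverse (X s) ^ Suc (Suc 0))) (at (X s))" for s
      using Xpos[of s] by (intro DERIV_inverse) simp
    show "continuous_on (range X) (\<lambda>x. - (inverse x ^ Suc (Suc 0)))"
      using Xpos by (intro continuous_intros) (auto simp: less_imp_neq[symmetric])
  qed
  have "approximable y (\<lambda>s. \<Sum>t\<in>T. \<eta> t s * (f s * inverse (X s)))"
    using C1_loop_mult[OF f inv] by (intro approximable_sum[OF T(2)] \<eta>(4))
  moreover have "(\<Sum>t\<in>T. \<eta> t s * (f s * inverse (X s))) = f s" for s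
    unfolding sum_distrib_right[symmetric] using Xpos[of s] by (simp add: X_def[symmetric])
  ultimately show ?thesis by simp
qed

inductive kernel_sum :: "(real^3 \<Rightarrow> real) \<Rightarrow> bool" where
  kernel_sum_base: "kernel_sum (\<lambda>u. a * exp (- (norm (u - v))\<^sup>2))"
| kernel_sum_add: "kernel_sum E \<Longrightarrow> kernel_sum F \<Longrightarrow> kernel_sum (\<lambda>u. E u + F u)"

lemma kernel_sum_of_exp_sum:
  assumes "exp_sum E" shows "kernel_sum (\<lambda>u. exp (- (norm u)\<^sup>2) * E u)"
  using assms
proof induction
  case (exp_sum_base a v)
  have "exp (- (norm u)\<^sup>2) * (a * exp (v \<bullet> u)) =
      (a * exp ((norm ((1/2) *\<^sub>R v))\<^sup>2)) * exp (- (norm (u - (1/2) *\<^sub>R v))\<^sup>2)" for u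
  proof -
    have "v \<bullet> u - (norm u)\<^sup>2 = (norm ((1/2) *\<^sub>R v))\<^sup>2 - (norm (u - (1/2) *\<^sub>R v))\<^sup>2"
      unfolding power2_norm_eq_inner by (simp add: inner_diff_left inner_diff_right inner_commute)
    then have "exp (- (norm u)\<^sup>2) * exp (v \<bullet> u) =
        exp ((norm ((1/2) *\<^sub>R v))\<^sup>2) * exp (- (norm (u - (1/2) *\<^sub>R v))\<^sup>2)"
      unfolding exp_add[symmetric] by simp
    then show ?thesis by (simp only: mult.left_commute[of _ a] mult.assoc)
  qed
  then show ?case using kernel_sum_base[of "a * exp ((norm ((1/2) *\<^sub>R v))\<^sup>2)" "(1/2) *\<^sub>R v"] by presburger
next
  case (exp_sum_add E F)
  then show ?case using kernel_sum_add by (fastforce simp: distrib_left)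
qed

text \<open>Multiply \<open>f\<close> by \<open>exp (\<bar>y\<bar>\<^sup>2)\<close>, approximate by an exponential sum, and multiply back.\<close>

theorem kernel_sums_dense:
  assumes y: "C1_loop y y'" and nz: "\<And>s. y' s \<noteq> 0" and inj: "no_self_intersections y"
    and f: "C1_loop f f'" and e: "0 < e"
  obtains h where "kernel_sum h" "e-lipschitz_on UNIV (\<lambda>s. h (y s) - f s)"
proof -
  define d where "d s = (norm (y s - 0))\<^sup>2" for s
  define d' where "d' s = 2 * ((y s - 0) \<bullet> y' s)" for s
  have d: "C1_loop d d'" unfolding d_def d'_def by (rule C1_loop_dist_square[OF y])
  have w: "C1_loop (\<lambda>s. exp (d s)) (\<lambda>s. d' s * exp (d s))"
    by (rule C1_loop_compose[OF d]) (auto intro!: DERIV_exp continuous_intros)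
  have w': "C1_loop (\<lambda>s. exp (- d s)) (\<lambda>s. d' s * - exp (- d s))"
    by (rule C1_loop_compose[OF d, where g = "\<lambda>x. exp (- x)" and g' = "\<lambda>x. - exp (- x)"])
       (auto intro!: derivative_eq_intros continuous_intros)
  obtain B where B: "lip_small B (\<lambda>s. exp (- d s))" using C1_loop_lip_small[OF w'] .
  have B0: "0 < B" using lip_smallD(2)[OF B, of 0] exp_gt_zero[of "- d 0"] by linarith
  have "approximable y (\<lambda>s. exp (d s) * f s)"
    by (rule C1_loop_approximable[OF y nz inj C1_loop_mult[OF w f]])
  then obtain E where E: "exp_sum E" "lip_small (e / (2 * B)) (\<lambda>s. E (y s) - exp (d s) * f s)"
    using e B0 unfolding approximable_def by (metis divide_pos_pos mult_pos_pos zero_less_numeral)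
  have "lip_small (2 * B * (e / (2 * B))) (\<lambda>s. exp (- d s) * (E (y s) - exp (d s) * f s))"
    by (rule lip_small_mult[OF B E(2)])
  moreover have "exp (- d s) * (E (y s) - exp (d s) * f s) = exp (- (norm (y s))\<^sup>2) * E (y s) - f s" for s
    by (simp add: d_def algebra_simps exp_minus)
  ultimately have "lip_small e (\<lambda>s. exp (- (norm (y s))\<^sup>2) * E (y s) - f s)" using B0 by simp
  then have "e-lipschitz_on UNIV (\<lambda>s. exp (- (norm (y s))\<^sup>2) * E (y s) - f s)"
    by (simp add: lip_small_def)
  then show ?thesis by (rule that[OF kernel_sum_of_exp_sum[OF E(1)]])
qed

lemma kernel_sum_finite_sum:
  assumes "kernel_sum h"
  obtains F a where "finite F" "h = (\<lambda>u. \<Sum>v\<in>F. a v * exp (- (norm (u - v))\<^sup>2))"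
proof -
  have "\<exists>F a. finite F \<and> h = (\<lambda>u. \<Sum>v\<in>F. a v * exp (- (norm (u - v))\<^sup>2))"
    using assms
  proof induction
    case (kernel_sum_base a v)
    show ?case by (rule exI[of _ "{v}"], rule exI[of _ "\<lambda>_. a"]) simp
  next
    case (kernel_sum_add E1 E2)
    from kernel_sum_add.IH(1) obtain F a where 1: "finite F" "E1 = (\<lambda>u. \<Sum>v\<in>F. a v * exp (- (norm (u - v))\<^sup>2))"
      by (elim exE conjE) (rule that)
    from kernel_sum_add.IH(2) obtain G b where 2: "finite G" "E2 = (\<lambda>u. \<Sum>v\<in>G. b v * exp (- (norm (u - v))\<^sup>2))"
      by (elim exE conjE) (rule that)
    have "E1 u + E2 u = (\<Sum>v\<in>F \<union> G. ((if v \<in> F then a v else 0) + (if v \<in> G then b v else 0)) * exp (- (norm (u - v))\<^sup>2))" for u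
    proof -
      have "E1 u = (\<Sum>v\<in>F \<union> G. (if v \<in> F then a v else 0) * exp (- (norm (u - v))\<^sup>2))"
        unfolding 1(2) using 1(1) 2(1) by (intro sum.mono_neutral_cong_left) auto
      moreover have "E2 u = (\<Sum>v\<in>F \<union> G. (if v \<in> G then b v else 0) * exp (- (norm (u - v))\<^sup>2))"
        unfolding 2(2) using 1(1) 2(1) by (intro sum.mono_neutral_cong_left) auto
      ultimately show ?thesis by (simp add: sum.distrib[symmetric] distrib_right)
    qed
    then have "(\<lambda>u. E1 u + E2 u) = (\<lambda>u. \<Sum>v\<in>F \<union> G. ((if v \<in> F then a v else 0) + (if v \<in> G then b v else 0)) * exp (- (norm (u - v))\<^sup>2))"
      by (rule ext)
    then show ?case
      by (intro exI[of _ "F \<union> G"] exI[of _ "\<lambda>v. (if v \<in> F then a v else 0) + (if v \<in> G then b v else 0)"] conjI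
          finite_UnI 1(1) 2(1))
  qed
  then show ?thesis by (elim exE conjE) (rule that)
qed

section \<open>Laws are determined by characteristic functions\<close>

text \<open>Uniqueness of characteristic functions for the finite measures with densities \<open>Y\<close> and \<open>Y'\<close>: normalize
them to probability measures and apply the theorem of Levy on the real line.\<close>

lemma integral_indicator_eq_by_char:
  fixes X Y :: "_ \<Rightarrow> real"
  assumes "prob_space M" "prob_space N"
    and [measurable]: "X \<in> borel_measurable M" "Y \<in> borel_measurable M" "X' \<in> borel_measurable N" "Y' \<in> borel_measurable N"
    and Y: "\<And>\<omega>. 0 \<le> Y \<omega>" "\<And>\<omega>. Y \<omega> \<le> K" and Y': "\<And>\<omega>. 0 \<le> Y' \<omega>" "\<And>\<omega>. Y' \<omega> \<le> K"
    and eq: "\<And>t. (\<integral>\<omega>. complex_of_real (Y \<omega>) * iexp (t * X \<omega>) \<partial>M) = (\<integral>\<omega>. complex_of_real (Y' \<omega>) * iexp (t * X' \<omega>) \<partial>N)"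
    and A: "A \<in> sets borel"
  shows "(\<integral>\<omega>. Y \<omega> * indicator A (X \<omega>) \<partial>M) = (\<integral>\<omega>. Y' \<omega> * indicator A (X' \<omega>) \<partial>N)"
proof -
  interpret M: prob_space M by fact
  interpret N: prob_space N by fact
  have [measurable]: "A \<in> sets borel" by (rule A)
  have int: "integrable M Y" "integrable N Y'"
    using Y Y' by (auto intro!: M.integrable_const_bound[of _ K] N.integrable_const_bound[of _ K])
  have intA: "integrable M (\<lambda>\<omega>. Y \<omega> * indicator A (X \<omega>))" "integrable N (\<lambda>\<omega>. Y' \<omega> * indicator A (X' \<omega>))"
    using Y Y' order_trans[OF Y(1) Y(2)] by (auto intro!: M.integrable_const_bound[of _ K] N.integrable_const_bound[of _ K] simp: indicator_def)
  define c where "c = (\<integral>\<omega>. Y \<omega> \<partial>M)"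
  have "complex_of_real (\<integral>\<omega>. Y \<omega> \<partial>M) = complex_of_real (\<integral>\<omega>. Y' \<omega> \<partial>N)"
    using eq[of 0] by (simp add: integral_complex_of_real)
  then have c': "c = (\<integral>\<omega>. Y' \<omega> \<partial>N)" by (simp add: c_def)
  have c0: "0 \<le> c" unfolding c_def using Y by (intro integral_nonneg_AE) auto
  show ?thesis
  proof (cases "c = 0")
    case True
    have "(\<integral>\<omega>. Y \<omega> * indicator A (X \<omega>) \<partial>M) \<le> c"
      unfolding c_def by (intro integral_mono intA int) (auto simp: indicator_def Y)
    moreover have "(\<integral>\<omega>. Y' \<omega> * indicator A (X' \<omega>) \<partial>N) \<le> c"
      unfolding c' by (intro integral_mono intA int) (auto simp: indicator_def Y')
    moreover have "0 \<le> (\<integral>\<omega>. Y \<omega> * indicator A (X \<omega>) \<partial>M)" "0 \<le> (\<integral>\<omega>. Y' \<omega> * indicator A (X' \<omega>) \<partial>N)"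
      by (auto intro!: integral_nonneg_AE simp: Y Y')
    ultimately show ?thesis using True by linarith
  next
    case False
    then have c: "0 < c" using c0 by simp
    have law: "real_distribution (distr (density P (\<lambda>\<omega>. ennreal (V \<omega> / c))) borel W)
       \<and> (\<forall>t. char (distr (density P (\<lambda>\<omega>. ennreal (V \<omega> / c))) borel W) t = (\<integral>\<omega>. complex_of_real (V \<omega>) * iexp (t * W \<omega>) \<partial>P) / c)
       \<and> measure (distr (density P (\<lambda>\<omega>. ennreal (V \<omega> / c))) borel W) A = (\<integral>\<omega>. V \<omega> * indicator A (W \<omega>) \<partial>P) / c"
      if [measurable]: "V \<in> borel_measurable P" "W \<in> borel_measurable P" and V: "\<And>\<omega>. 0 \<le> V \<omega>" "integrable P V" "(\<integral>\<omega>. V \<omega> \<partial>P) = c"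
        and V2: "integrable P (\<lambda>\<omega>. V \<omega> * indicator A (W \<omega>))"
      for P :: "'z measure" and V W
    proof (intro conjI allI)
      let ?D = "density P (\<lambda>\<omega>. ennreal (V \<omega> / c))"
      have "emeasure ?D (space ?D) = (\<integral>\<^sup>+\<omega>. ennreal (V \<omega> / c) \<partial>P)"
        by (simp add: emeasure_density cong: nn_integral_cong)
      also have "\<dots> = ennreal (\<integral>\<omega>. V \<omega> / c \<partial>P)"
        using V c by (intro nn_integral_eq_integral) auto
      also have "\<dots> = 1" using V c by simp
      finally have D: "prob_space ?D" by (rule prob_spaceI)
      then have "prob_space (distr ?D borel W)" by (rule prob_space.prob_space_distr) simp
      then show "real_distribution (distr ?D borel W)"
        by (auto simp: real_distribution_def real_distribution_axioms_def)
      fix t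
      have "char (distr ?D borel W) t = (\<integral>\<omega>. iexp (t * W \<omega>) \<partial>?D)"
        unfolding char_def by (rule integral_distr) auto
      also have "\<dots> = (\<integral>\<omega>. (V \<omega> / c) *\<^sub>R iexp (t * W \<omega>) \<partial>P)"
        using V c by (intro integral_density) auto
      also have "\<dots> = (\<integral>\<omega>. (complex_of_real (V \<omega>) * iexp (t * W \<omega>)) / c \<partial>P)"
        by (simp add: scaleR_conv_of_real)
      finally show "char (distr ?D borel W) t = (\<integral>\<omega>. complex_of_real (V \<omega>) * iexp (t * W \<omega>) \<partial>P) / c" by simp
      have "measure (distr ?D borel W) A = (\<integral>x. indicator A x \<partial>distr ?D borel W)"
        by simp
      also have "\<dots> = (\<integral>\<omega>. indicator A (W \<omega>) \<partial>?D)" by (rule integral_distr) auto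
      also have "\<dots> = (\<integral>\<omega>. (V \<omega> / c) *\<^sub>R indicator A (W \<omega>) \<partial>P)"
        using V c by (intro integral_density) auto
      finally show "measure (distr ?D borel W) A = (\<integral>\<omega>. V \<omega> * indicator A (W \<omega>) \<partial>P) / c"
        by simp
    qed
    note L1 = law[of Y M X, OF _ _ Y(1) int(1) c_def[symmetric] intA(1)]
    note L2 = law[of Y' N X', OF _ _ Y'(1) int(2) c'[symmetric] intA(2)]
    have "distr (density M (\<lambda>\<omega>. ennreal (Y \<omega> / c))) borel X = distr (density N (\<lambda>\<omega>. ennreal (Y' \<omega> / c))) borel X'"
      using L1 L2 eq by (intro Levy_uniqueness) auto
    then show ?thesis using L1 L2 c by simp
  qed
qed

lemma lincomb_extend:
  fixes a t :: real
  assumes "finite F"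
  shows "\<exists>c'. \<forall>x :: 'i \<Rightarrow> real. a * (\<Sum>i\<in>F. c i * x i) + t * x j = (\<Sum>i\<in>insert j F. c' i * x i)"
proof (intro exI allI)
  fix x :: "'i \<Rightarrow> real"
  let ?c' = "\<lambda>i. (if i \<in> F then a * c i else 0) + (if i = j then t else 0)"
  have "(\<Sum>i\<in>insert j F. ?c' i * x i) = (\<Sum>i\<in>insert j F. (if i \<in> F then a * c i else 0) * x i) + (\<Sum>i\<in>insert j F. (if i = j then t else 0) * x i)"
    by (simp only: distrib_right sum.distrib)
  also have "(\<Sum>i\<in>insert j F. (if i \<in> F then a * c i else 0) * x i) = (\<Sum>i\<in>F. a * c i * x i)"
    using assms by (intro sum.mono_neutral_cong_right) auto
  also have "(\<Sum>i\<in>insert j F. (if i = j then t else 0) * x i) = (\<Sum>i\<in>{j}. t * x i)"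
    using assms by (intro sum.mono_neutral_cong_right) auto
  finally show "a * (\<Sum>i\<in>F. c i * x i) + t * x j = (\<Sum>i\<in>insert j F. ?c' i * x i)"
    by (simp add: sum_distrib_left mult.assoc)
qed

definition same_char :: "'a measure \<Rightarrow> ('i \<Rightarrow> 'a \<Rightarrow> real) \<Rightarrow> 'b measure \<Rightarrow> ('i \<Rightarrow> 'b \<Rightarrow> real) \<Rightarrow> bool" where
  "same_char M X N X' \<longleftrightarrow> (\<forall>F c. finite F \<longrightarrow>
     (\<integral>\<omega>. iexp (\<Sum>i\<in>F. c i * X i \<omega>) \<partial>M) = (\<integral>\<omega>. iexp (\<Sum>i\<in>F. c i * X' i \<omega>) \<partial>N))"

lemma iexp_cos: "iexp s + iexp (- s) = 2 * complex_of_real (cos s)"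
  by (simp add: cos_exp_eq cos_of_real[symmetric] field_simps del: cos_of_real)

lemma iexp_sin: "iexp s - iexp (- s) = 2 * \<i> * complex_of_real (sin s)"
  by (simp add: sin_exp_eq sin_of_real[symmetric] field_simps del: sin_of_real)

lemma iexp_add: "iexp (a + b) = iexp a * iexp b"
  by (simp add: exp_add distrib_left)

text \<open>A nonnegative trigonometric weight turns into exponentials that are known from the induction hypothesis
of \<open>same_char_cylinder\<close>; the coefficients \<open>0\<close>, \<open>1\<close> and \<open>-1\<close> of \<open>s\<close> are kept visible to match its form.\<close>

lemma cos_as_iexp: "complex_of_real (w * (1 + cos s)) * iexp x =
  complex_of_real w * iexp (0 * s + x) +
  (complex_of_real w * iexp (1 * s + x) / 2 + complex_of_real w * iexp ((-1) * s + x) / 2)"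
proof -
  have "W * (1 + (E + F) / 2) * X = W * X + (W * (E * X) / 2 + W * (F * X) / 2)" for E F W X :: complex
    by (simp add: field_simps)
  from this[of "complex_of_real w" "iexp s" "iexp (- s)" "iexp x"]
  have "complex_of_real w * (1 + complex_of_real (cos s)) * iexp x =
    complex_of_real w * iexp x + (complex_of_real w * (iexp s * iexp x) / 2 + complex_of_real w * (iexp (- s) * iexp x) / 2)"
    unfolding iexp_cos by simp
  then show ?thesis unfolding iexp_add[symmetric] by simp
qed

lemma sin_as_iexp: "complex_of_real (w * (1 + sin s)) * iexp x =
  complex_of_real w * iexp (0 * s + x) +
  (complex_of_real w * iexp (1 * s + x) / (2 * \<i>) + complex_of_real w * iexp ((-1) * s + x) / (- (2 * \<i>)))"
proof -
  have "W * (1 + (E - F) / (2 * \<i>)) * X = W * X + (W * (E * X) / (2 * \<i>) + W * (F * X) / (- (2 * \<i>)))" for E F W X :: complex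
    by (simp add: field_simps)
  from this[of "complex_of_real w" "iexp s" "iexp (- s)" "iexp x"]
  have "complex_of_real w * (1 + complex_of_real (sin s)) * iexp x =
    complex_of_real w * iexp x + (complex_of_real w * (iexp s * iexp x) / (2 * \<i>) + complex_of_real w * (iexp (- s) * iexp x) / (- (2 * \<i>)))"
    unfolding iexp_sin by simp
  then show ?thesis unfolding iexp_add[symmetric] by simp
qed

lemma one_plus_cos_nonneg: "0 \<le> 1 + cos (s :: real)"
  using cos_ge_minus_one[of s] by linarith

lemma one_plus_sin_nonneg: "0 \<le> 1 + sin (s :: real)"
  using sin_ge_minus_one[of s] by linarith

lemma integral_sum3:
  fixes f g h :: "'a \<Rightarrow> complex"
  assumes "integrable M f" "integrable M g" "integrable M h"
  shows "(\<integral>\<omega>. f \<omega> + (g \<omega> / a + h \<omega> / b) \<partial>M) = (\<integral>\<omega>. f \<omega> \<partial>M) + ((\<integral>\<omega>. g \<omega> \<partial>M) / a + (\<integral>\<omega>. h \<omega> \<partial>M) / b)"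
  using assms by simp

text \<open>Characteristic functions on a space of several dimensions are traded for indicators one coordinate at
a time. The uniqueness theorem on the line needs nonnegative weights, so
the exponential of the remaining coordinates is recovered from the weights \<open>1\<close>, \<open>1 + cos\<close> and \<open>1 + sin\<close>.\<close>

lemma same_char_cylinder:
  assumes M: "prob_space M" and N: "prob_space N"
    and X[measurable]: "\<And>i. X i \<in> borel_measurable M" and X'[measurable]: "\<And>i. X' i \<in> borel_measurable N"
    and same: "same_char M X N X'"
    and A: "\<And>i. A i \<in> sets borel" and J: "finite J"
  shows "finite F \<Longrightarrow> (\<integral>\<omega>. complex_of_real (\<Prod>j\<in>J. indicator (A j) (X j \<omega>)) * iexp (\<Sum>i\<in>F. c i * X i \<omega>) \<partial>M) =
    (\<integral>\<omega>. complex_of_real (\<Prod>j\<in>J. indicator (A j) (X' j \<omega>)) * iexp (\<Sum>i\<in>F. c i * X' i \<omega>) \<partial>N)"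
  using J
proof (induction J arbitrary: F c rule: finite_induct)
  case empty
  then show ?case using same unfolding same_char_def by simp
next
  case (insert j J)
  interpret M: prob_space M by fact
  interpret N: prob_space N by fact
  note [measurable] = A
  define W where "W \<omega> = (\<Prod>j\<in>J. indicator (A j) (X j \<omega>) :: real)" for \<omega>
  define W' where "W' \<omega> = (\<Prod>j\<in>J. indicator (A j) (X' j \<omega>) :: real)" for \<omega>
  define S where "S \<omega> = (\<Sum>i\<in>F. c i * X i \<omega>)" for \<omega>
  define S' where "S' \<omega> = (\<Sum>i\<in>F. c i * X' i \<omega>)" for \<omega>
  have [measurable]: "W \<in> borel_measurable M" "W' \<in> borel_measurable N" "S \<in> borel_measurable M" "S' \<in> borel_measurable N"
    unfolding W_def W'_def S_def S'_def by measurable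
  have W01: "0 \<le> W \<omega>" "W \<omega> \<le> 1" "0 \<le> W' \<omega>'" "W' \<omega>' \<le> 1" for \<omega> \<omega>'
    unfolding W_def W'_def by (auto intro!: prod_nonneg prod_le_1)
  have IH: "(\<integral>\<omega>. complex_of_real (W \<omega>) * iexp (a * S \<omega> + t * X j \<omega>) \<partial>M) = (\<integral>\<omega>. complex_of_real (W' \<omega>) * iexp (a * S' \<omega> + t * X' j \<omega>) \<partial>N)" for a t
  proof -
    obtain c' where c': "\<And>x. a * (\<Sum>i\<in>F. c i * x i) + t * x j = (\<Sum>i\<in>insert j F. c' i * x i)"
      using lincomb_extend[OF insert.prems, of a c t j] by blast
    show ?thesis
      unfolding W_def W'_def S_def S'_def c'[of "\<lambda>i. X i \<omega>" for \<omega>] c'[of "\<lambda>i. X' i \<omega>" for \<omega>]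
      by (rule insert.IH) (use insert.prems in simp)
  qed
  have intM: "integrable M (\<lambda>\<omega>. complex_of_real (W \<omega>) * iexp (a * S \<omega> + t * X j \<omega>))" for a t
    using W01 by (intro M.integrable_const_bound[of _ 1]) (auto simp: norm_mult)
  have intN: "integrable N (\<lambda>\<omega>. complex_of_real (W' \<omega>) * iexp (a * S' \<omega> + t * X' j \<omega>))" for a t
    using W01 by (intro N.integrable_const_bound[of _ 1]) (auto simp: norm_mult)
  have e0: "(\<integral>\<omega>. W \<omega> * indicator (A j) (X j \<omega>) \<partial>M) = (\<integral>\<omega>. W' \<omega> * indicator (A j) (X' j \<omega>) \<partial>N)"
    by (rule integral_indicator_eq_by_char[OF M N, where K = 1]) (use W01 IH[of 0] A in auto)
  have e1: "(\<integral>\<omega>. (W \<omega> * (1 + cos (S \<omega>))) * indicator (A j) (X j \<omega>) \<partial>M) = (\<integral>\<omega>. (W' \<omega> * (1 + cos (S' \<omega>))) * indicator (A j) (X' j \<omega>) \<partial>N)"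
  proof (rule integral_indicator_eq_by_char[OF M N, where K = 2])
    show "(\<integral>\<omega>. complex_of_real (W \<omega> * (1 + cos (S \<omega>))) * iexp (t * X j \<omega>) \<partial>M) =
        (\<integral>\<omega>. complex_of_real (W' \<omega> * (1 + cos (S' \<omega>))) * iexp (t * X' j \<omega>) \<partial>N)" for t
      unfolding cos_as_iexp integral_sum3[OF intM intM intM] integral_sum3[OF intN intN intN] IH ..
    show "0 \<le> W \<omega> * (1 + cos (S \<omega>))" "0 \<le> W' \<omega>' * (1 + cos (S' \<omega>'))" for \<omega> \<omega>'
      using W01(1,2)[of \<omega>] W01(3,4)[of \<omega>'] one_plus_cos_nonneg by simp_all
    show "W \<omega> * (1 + cos (S \<omega>)) \<le> 2" "W' \<omega>' * (1 + cos (S' \<omega>')) \<le> 2" for \<omega> \<omega>'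
      using mult_mono[of "W \<omega>" 1 "1 + cos (S \<omega>)" 2] mult_mono[of "W' \<omega>'" 1 "1 + cos (S' \<omega>')" 2] W01(1,2)[of \<omega>] W01(3,4)[of \<omega>']
        one_plus_cos_nonneg by simp_all
  qed (use A in auto)
  have e2: "(\<integral>\<omega>. (W \<omega> * (1 + sin (S \<omega>))) * indicator (A j) (X j \<omega>) \<partial>M) = (\<integral>\<omega>. (W' \<omega> * (1 + sin (S' \<omega>))) * indicator (A j) (X' j \<omega>) \<partial>N)"
  proof (rule integral_indicator_eq_by_char[OF M N, where K = 2])
    show "(\<integral>\<omega>. complex_of_real (W \<omega> * (1 + sin (S \<omega>))) * iexp (t * X j \<omega>) \<partial>M) =
        (\<integral>\<omega>. complex_of_real (W' \<omega> * (1 + sin (S' \<omega>))) * iexp (t * X' j \<omega>) \<partial>N)" for t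
      unfolding sin_as_iexp integral_sum3[OF intM intM intM] integral_sum3[OF intN intN intN] IH ..
    show "0 \<le> W \<omega> * (1 + sin (S \<omega>))" "0 \<le> W' \<omega>' * (1 + sin (S' \<omega>'))" for \<omega> \<omega>'
      using W01(1,2)[of \<omega>] W01(3,4)[of \<omega>'] one_plus_sin_nonneg by simp_all
    show "W \<omega> * (1 + sin (S \<omega>)) \<le> 2" "W' \<omega>' * (1 + sin (S' \<omega>')) \<le> 2" for \<omega> \<omega>'
      using mult_mono[of "W \<omega>" 1 "1 + sin (S \<omega>)" 2] mult_mono[of "W' \<omega>'" 1 "1 + sin (S' \<omega>')" 2] W01(1,2)[of \<omega>] W01(3,4)[of \<omega>']
        one_plus_sin_nonneg by simp_all
  qed (use A in auto)
  define V where "V \<omega> = W \<omega> * indicator (A j) (X j \<omega>)" for \<omega>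
  define V' where "V' \<omega> = W' \<omega> * indicator (A j) (X' j \<omega>)" for \<omega>
  have [measurable]: "V \<in> borel_measurable M" "V' \<in> borel_measurable N" unfolding V_def V'_def by measurable
  have V01: "\<bar>V \<omega>\<bar> \<le> 1" "\<bar>V' \<omega>'\<bar> \<le> 1" for \<omega> \<omega>' using W01 by (auto simp: V_def V'_def indicator_def)
  have bM: "integrable M (\<lambda>\<omega>. V \<omega> * f (S \<omega>))" and bN: "integrable N (\<lambda>\<omega>. V' \<omega> * f (S' \<omega>))"
    if [measurable]: "f \<in> borel_measurable borel" and "\<And>x. \<bar>f x\<bar> \<le> 1" for f :: "real \<Rightarrow> real"
    using V01 that(2) by (auto intro!: M.integrable_const_bound[of _ 1] N.integrable_const_bound[of _ 1] simp: abs_mult mult_le_one)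
  have V0: "integrable M V" "integrable N V'"
    using V01 by (auto intro!: M.integrable_const_bound[of _ 1] N.integrable_const_bound[of _ 1])
  have E0: "(\<integral>\<omega>. V \<omega> \<partial>M) = (\<integral>\<omega>. V' \<omega> \<partial>N)" using e0 unfolding V_def V'_def .
  have E1: "(\<integral>\<omega>. V \<omega> * cos (S \<omega>) \<partial>M) = (\<integral>\<omega>. V' \<omega> * cos (S' \<omega>) \<partial>N)"
  proof -
    have "(\<integral>\<omega>. V \<omega> + V \<omega> * cos (S \<omega>) \<partial>M) = (\<integral>\<omega>. V' \<omega> + V' \<omega> * cos (S' \<omega>) \<partial>N)"
      using e1 unfolding V_def V'_def by (simp add: algebra_simps)
    then show ?thesis using V0 bM[of cos] bN[of cos] E0 by simp
  qed
  have E2: "(\<integral>\<omega>. V \<omega> * sin (S \<omega>) \<partial>M) = (\<integral>\<omega>. V' \<omega> * sin (S' \<omega>) \<partial>N)"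
  proof -
    have "(\<integral>\<omega>. V \<omega> + V \<omega> * sin (S \<omega>) \<partial>M) = (\<integral>\<omega>. V' \<omega> + V' \<omega> * sin (S' \<omega>) \<partial>N)"
      using e2 unfolding V_def V'_def by (simp add: algebra_simps)
    then show ?thesis using V0 bM[of sin] bN[of sin] E0 by simp
  qed
  have split: "complex_of_real v * iexp s = complex_of_real (v * cos s) + \<i> * complex_of_real (v * sin s)" for v s
    by (simp add: exp_Euler cos_of_real sin_of_real algebra_simps)
  have "(\<integral>\<omega>. complex_of_real (V \<omega>) * iexp (S \<omega>) \<partial>M) = (\<integral>\<omega>. complex_of_real (V' \<omega>) * iexp (S' \<omega>) \<partial>N)"
    unfolding split using bM[of cos] bN[of cos] bM[of sin] bN[of sin] E1 E2
    by (simp add: integral_complex_of_real del: of_real_mult)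
  moreover have "V \<omega> = (\<Prod>j\<in>insert j J. indicator (A j) (X j \<omega>))" "V' \<omega>' = (\<Prod>j\<in>insert j J. indicator (A j) (X' j \<omega>'))" for \<omega> \<omega>'
    using insert.hyps by (simp_all add: V_def V'_def W_def W'_def mult.commute)
  ultimately show ?case unfolding S_def S'_def by simp
qed

text \<open>With no exponential left, \<open>same_char_cylinder\<close> compares the probabilities of finite-dimensional cylinders,
and these generate the product \<open>\<sigma>\<close>-algebra.\<close>

lemma same_char_same_law:
  assumes M: "prob_space M" and N: "prob_space N"
    and X[measurable]: "\<And>i. X i \<in> borel_measurable M" and X'[measurable]: "\<And>i. X' i \<in> borel_measurable N"
    and same: "same_char M X N X'"
  shows "distr M (Pi\<^sub>M UNIV (\<lambda>_. borel)) (\<lambda>\<omega> i. X i \<omega>) = distr N (Pi\<^sub>M UNIV (\<lambda>_. borel)) (\<lambda>\<omega> i. X' i \<omega>)"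
proof (rule measure_eqI_PiM_infinite)
  interpret M: prob_space M by fact
  interpret N: prob_space N by fact
  have mX[measurable]: "(\<lambda>\<omega> i. X i \<omega>) \<in> measurable M (Pi\<^sub>M UNIV (\<lambda>_. borel))"
    "(\<lambda>\<omega> i. X' i \<omega>) \<in> measurable N (Pi\<^sub>M UNIV (\<lambda>_. borel))"
    by (auto intro!: measurable_PiM_single' simp: X X')
  show "finite_measure (distr M (Pi\<^sub>M UNIV (\<lambda>_. borel)) (\<lambda>\<omega> i. X i \<omega>))"
    by (intro M.finite_measure_distr mX)
  fix A :: "'c \<Rightarrow> real set" and J :: "'c set"
  assume J: "finite J" "\<And>i. i \<in> J \<Longrightarrow> A i \<in> sets borel"
  define B where "B i = (if i \<in> J then A i else UNIV)" for i
  have B[measurable]: "B i \<in> sets borel" for i using J by (simp add: B_def)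
  have pe: "prod_emb UNIV (\<lambda>_. borel) J (Pi\<^sub>E J A) = {x. \<forall>j\<in>J. x j \<in> B j}"
    by (auto simp: prod_emb_def B_def restrict_def PiE_iff extensional_def)
  have s[measurable]: "{x. \<forall>j\<in>J. x j \<in> B j} \<in> sets (Pi\<^sub>M UNIV (\<lambda>_. borel))"
    using J unfolding pe[symmetric] by (intro sets_PiM_I) auto
  have val: "measure P {\<omega>\<in>space P. \<forall>j\<in>J. Z j \<omega> \<in> B j} = Re (\<integral>\<omega>. complex_of_real (\<Prod>j\<in>J. indicator (B j) (Z j \<omega>)) * iexp (\<Sum>i\<in>{}. 0 * Z i \<omega>) \<partial>P)"
    if P: "prob_space P" and Z[measurable]: "\<And>i. Z i \<in> borel_measurable P" for P :: "'z measure" and Z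
  proof -
    have [measurable]: "{\<omega>\<in>space P. \<forall>j\<in>J. Z j \<omega> \<in> B j} \<in> sets P" using J(1) by measurable
    have "measure P {\<omega>\<in>space P. \<forall>j\<in>J. Z j \<omega> \<in> B j} = (\<integral>\<omega>. indicator {\<omega>\<in>space P. \<forall>j\<in>J. Z j \<omega> \<in> B j} \<omega> \<partial>P)" by simp
    also have "\<dots> = (\<integral>\<omega>. (\<Prod>j\<in>J. indicator (B j) (Z j \<omega>)) \<partial>P)"
    proof (rule Bochner_Integration.integral_cong[OF refl])
      fix \<omega> assume \<omega>: "\<omega> \<in> space P"
      show "indicator {\<omega>\<in>space P. \<forall>j\<in>J. Z j \<omega> \<in> B j} \<omega> = (\<Prod>j\<in>J. indicator (B j) (Z j \<omega>) :: real)"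
      proof (cases "\<forall>j\<in>J. Z j \<omega> \<in> B j")
        case False
        then show ?thesis using J(1) by (auto simp: indicator_def intro!: prod_zero[symmetric])
      qed (use \<omega> in simp)
    qed
    finally show ?thesis by (simp add: integral_complex_of_real del: of_real_prod)
  qed
  have "measure M {\<omega>\<in>space M. \<forall>j\<in>J. X j \<omega> \<in> B j} = measure N {\<omega>\<in>space N. \<forall>j\<in>J. X' j \<omega> \<in> B j}"
    unfolding val[OF M X] val[OF N X'] using same_char_cylinder[OF M N X X' same, of B J "{}" "\<lambda>_. 0"] J(1) by simp
  moreover have "emeasure (distr M (Pi\<^sub>M UNIV (\<lambda>_. borel)) (\<lambda>\<omega> i. X i \<omega>)) {x. \<forall>j\<in>J. x j \<in> B j} = emeasure M {\<omega>\<in>space M. \<forall>j\<in>J. X j \<omega> \<in> B j}"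
    "emeasure (distr N (Pi\<^sub>M UNIV (\<lambda>_. borel)) (\<lambda>\<omega> i. X' i \<omega>)) {x. \<forall>j\<in>J. x j \<in> B j} = emeasure N {\<omega>\<in>space N. \<forall>j\<in>J. X' j \<omega> \<in> B j}"
    by (subst emeasure_distr; auto simp: vimage_def Int_def conj_commute)+
  ultimately show "emeasure (distr M (Pi\<^sub>M UNIV (\<lambda>_. borel)) (\<lambda>\<omega> i. X i \<omega>)) (prod_emb UNIV (\<lambda>_. borel) J (Pi\<^sub>E J A)) =
    emeasure (distr N (Pi\<^sub>M UNIV (\<lambda>_. borel)) (\<lambda>\<omega> i. X' i \<omega>)) (prod_emb UNIV (\<lambda>_. borel) J (Pi\<^sub>E J A))"
    unfolding pe by (simp add: M.emeasure_eq_measure N.emeasure_eq_measure)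
qed auto

section \<open>Separability of continuously differentiable fields in the Lipschitz seminorm\<close>

definition C1_field :: "('a::euclidean_space \<Rightarrow> real) \<Rightarrow> ('a \<Rightarrow> 'a) \<Rightarrow> bool" where
  "C1_field F F' \<longleftrightarrow> (\<forall>u. (F has_derivative (\<lambda>h. F' u \<bullet> h)) (at u)) \<and> continuous_on UNIV F'"

lemma C1_field_continuous: "C1_field F F' \<Longrightarrow> continuous_on S F"
  unfolding C1_field_def
  by (meson continuous_at_imp_continuous_on has_derivative_continuous)

lemma C1_field_bound:
  assumes F: "C1_field F F'" and S: "convex S" "u \<in> S" "v \<in> S"
    and B: "\<And>z. z \<in> S \<Longrightarrow> norm (F' z - q) \<le> e"
  shows "\<bar>F u - F v - q \<bullet> (u - v)\<bar> \<le> e * norm (u - v)"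
proof -
  have "norm ((F u - q \<bullet> u) - (F v - q \<bullet> v)) \<le> e * norm (u - v)"
  proof (rule differentiable_bound[OF S(1) _ _ S(2,3)])
    fix z assume z: "z \<in> S"
    have "(F has_derivative (\<lambda>h. F' z \<bullet> h)) (at z)" using F by (simp add: C1_field_def)
    then have "((\<lambda>u. F u - q \<bullet> u) has_derivative (\<lambda>h. F' z \<bullet> h - q \<bullet> h)) (at z)"
      by (intro has_derivative_diff has_derivative_inner_right has_derivative_ident)
    then have "((\<lambda>u. F u - q \<bullet> u) has_derivative (\<lambda>h. F' z \<bullet> h - q \<bullet> h)) (at z within S)"
      by (rule has_derivative_at_withinI)
    then show "((\<lambda>u. F u - q \<bullet> u) has_derivative (\<lambda>h. (F' z - q) \<bullet> h)) (at z within S)"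
      by (simp add: inner_diff_left)
    show "onorm (\<lambda>h. (F' z - q) \<bullet> h) \<le> e"
    proof (rule onorm_bound)
      show "0 \<le> e" using B[OF z] norm_ge_zero order_trans by blast
      fix h show "norm ((F' z - q) \<bullet> h) \<le> e * norm h"
        using Cauchy_Schwarz_ineq2[of "F' z - q" h] mult_right_mono[OF B[OF z] norm_ge_zero[of h]] by simp
    qed
  qed
  then show ?thesis by (simp add: inner_diff_right algebra_simps)
qed

lemma C1_field_lipschitz:
  assumes "C1_field F F'" "convex S" "\<And>z. z \<in> S \<Longrightarrow> norm (F' z) \<le> e" "0 \<le> e"
  shows "e-lipschitz_on S F"
proof (rule lipschitz_onI[OF _ assms(4)])
  fix u v assume "u \<in> S" "v \<in> S"
  then show "dist (F u) (F v) \<le> e * dist u v"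
    using C1_field_bound[OF assms(1,2), of u v 0 e] assms(3) by (simp add: dist_norm)
qed

lemma C1_field_translate:
  assumes "C1_field F F'" shows "C1_field (\<lambda>u. F (u + p)) (\<lambda>u. F' (u + p))"
  unfolding C1_field_def
proof (intro conjI allI)
  fix u
  have "((\<lambda>u. u + p) has_derivative (\<lambda>h. h)) (at u)" by (auto intro!: derivative_eq_intros)
  moreover have "(F has_derivative (\<lambda>h. F' (u + p) \<bullet> h)) (at (u + p))" using assms by (simp add: C1_field_def)
  ultimately show "((\<lambda>u. F (u + p)) has_derivative (\<lambda>h. F' (u + p) \<bullet> h)) (at u)" by (rule has_derivative_compose)
next
  show "continuous_on UNIV (\<lambda>u. F' (u + p))"
    by (rule continuous_on_compose2[of UNIV F']) (use assms in \<open>auto simp: C1_field_def intro!: continuous_intros\<close>)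
qed

text \<open>Divide the segment between two points into steps shorter than \<open>\<delta>\<close>.\<close>

lemma lipschitz_on_convex_if_local:
  fixes D :: "'a::real_normed_vector \<Rightarrow> real"
  assumes S: "convex S" and \<delta>: "0 < \<delta>" and e: "0 \<le> e"
    and loc: "\<And>u v. u \<in> S \<Longrightarrow> v \<in> S \<Longrightarrow> norm (u - v) < \<delta> \<Longrightarrow> \<bar>D u - D v\<bar> \<le> e * norm (u - v)"
  shows "e-lipschitz_on S D"
proof (rule lipschitz_onI[OF _ e])
  fix u v assume uv: "u \<in> S" "v \<in> S"
  obtain n :: nat where n: "norm (v - u) / \<delta> < real n" using reals_Archimedean2 by blast
  then have n0: "0 < n" using \<delta> by (cases n) (auto simp: divide_less_0_iff)
  define p where "p k = u + (real k / real n) *\<^sub>R (v - u)" for k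
  have pS: "p k \<in> S" if "k \<le> n" for k
  proof -
    have "p k = (1 - real k / real n) *\<^sub>R u + (real k / real n) *\<^sub>R v"
      by (simp add: p_def algebra_simps)
    then show ?thesis using convexD[OF S uv, of "1 - real k / real n" "real k / real n"] that n0 by simp
  qed
  have st: "norm (p (Suc k) - p k) = norm (v - u) / real n" for k
  proof -
    have "p (Suc k) - p k = (1 / real n) *\<^sub>R (v - u)"
      by (simp add: p_def scaleR_diff_left[symmetric] diff_divide_distrib[symmetric])
    then show ?thesis by simp
  qed
  have small: "norm (v - u) / real n < \<delta>" using n n0 \<delta> by (simp add: field_simps)
  have "D (p n) - D (p 0) = (\<Sum>k<n. D (p (Suc k)) - D (p k))"
    by (rule sum_lessThan_telescope[symmetric])
  then have "\<bar>D (p n) - D (p 0)\<bar> \<le> (\<Sum>k<n. \<bar>D (p (Suc k)) - D (p k)\<bar>)"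
    by (simp add: sum_abs)
  also have "\<dots> \<le> (\<Sum>k<n. e * (norm (v - u) / real n))"
  proof (rule sum_mono)
    fix k assume "k \<in> {..<n}"
    then show "\<bar>D (p (Suc k)) - D (p k)\<bar> \<le> e * (norm (v - u) / real n)"
      using loc[OF pS pS, of "Suc k" k] small unfolding st by simp
  qed
  also have "\<dots> = e * norm (v - u)" using n0 by simp
  finally show "dist (D u) (D v) \<le> e * dist u v"
    using n0 by (simp add: p_def dist_norm norm_minus_commute dist_real_def abs_minus_commute)
qed

text \<open>A Lipschitz inequality is a closed condition, so it can be checked on a countable dense set; this
is how such conditions become events.\<close>

lemma dense_lipschitz:
  fixes H :: "'a::real_normed_vector \<Rightarrow> real"
  assumes D: "\<And>X. open X \<Longrightarrow> X \<noteq> {} \<Longrightarrow> \<exists>d\<in>D. d \<in> X" and B: "open B" and H: "continuous_on UNIV H"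
    and le: "\<And>a b. a \<in> D \<inter> B \<Longrightarrow> b \<in> D \<inter> B \<Longrightarrow> \<bar>H a - H b\<bar> \<le> e * norm (a - b)"
    and u: "u \<in> B" and v: "v \<in> B"
  shows "\<bar>H u - H v\<bar> \<le> e * norm (u - v)"
proof -
  let ?P = "{p. \<bar>H (fst p) - H (snd p)\<bar> \<le> e * norm (fst p - snd p)}"
  have "continuous_on UNIV (\<lambda>p. H (fst p))" "continuous_on UNIV (\<lambda>p. H (snd p))"
    by (rule continuous_on_compose2[OF H]; simp add: continuous_on_fst continuous_on_snd)+
  then have "closed ?P"
    by (intro closed_Collect_le continuous_on_rabs continuous_on_diff continuous_on_mult continuous_on_norm
        continuous_on_fst continuous_on_snd continuous_on_const continuous_on_id)
  moreover have "(u, v) \<in> closure ((D \<inter> B) \<times> (D \<inter> B))"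
  proof -
    have "B \<subseteq> closure (D \<inter> B)"
    proof
      fix x assume x: "x \<in> B"
      show "x \<in> closure (D \<inter> B)"
        unfolding closure_approachable
      proof (intro allI impI)
        fix d :: real assume "0 < d"
        then have "x \<in> B \<inter> ball x d" using x by simp
        then have "open (B \<inter> ball x d)" "B \<inter> ball x d \<noteq> {}" using B by auto
        then show "\<exists>y\<in>D \<inter> B. dist y x < d" using D[of "B \<inter> ball x d"] by (auto simp: dist_commute)
      qed
    qed
    then show ?thesis using u v by (auto simp: closure_Times)
  qed
  moreover have "(D \<inter> B) \<times> (D \<inter> B) \<subseteq> ?P" using le by auto
  ultimately have "(u, v) \<in> ?P" using closure_minimal by blast
  then show ?thesis by simp
qed

text \<open>A cell prescribes, on each of finitely many small balls covering \<open>cball 0 R\<close>, an affine increment up to a Lipschitz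
error \<open>e / 2\<close>. The slopes range over a countable dense set, so there are countably many cells; a \<open>C\<^sup>1\<close> field
lies in one of them because its gradient is uniformly continuous, and two fields in the same
cell differ by a function that is locally, hence globally, \<open>e\<close>-Lipschitz.\<close>

theorem C1_fields_separable:
  fixes R e :: real
  assumes e: "0 < e" and R: "0 \<le> R"
  obtains V :: "nat \<Rightarrow> ('a::euclidean_space \<Rightarrow> real) set" where
    "\<And>n. V n \<in> sets (Pi\<^sub>M UNIV (\<lambda>_. borel))"
    "\<And>F F'. C1_field F F' \<Longrightarrow> \<exists>n. F \<in> V n"
    "\<And>n F G. F \<in> V n \<Longrightarrow> G \<in> V n \<Longrightarrow> continuous_on UNIV F \<Longrightarrow> continuous_on UNIV G \<Longrightarrow>
       e-lipschitz_on (cball 0 R) (\<lambda>u. F u - G u) \<and> \<bar>F 0 - G 0\<bar> \<le> e"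
proof -
  obtain D :: "'a set" where D: "countable D" "\<And>X. open X \<Longrightarrow> X \<noteq> {} \<Longrightarrow> \<exists>d\<in>D. d \<in> X"
    by (rule countable_dense_setE) (erule that, blast)
  define r where "r n = 1 / real (Suc n)" for n
  have r: "0 < r n" "r n \<le> 1" for n by (simp_all add: r_def)
  have "\<exists>K. finite K \<and> K \<subseteq> cball 0 R \<and> cball (0::'a) R \<subseteq> (\<Union>x\<in>K. ball x (r n))" for n
    by (rule seq_compact_imp_totally_bounded[rule_format]) (simp_all add: compact_imp_seq_compact r)
  then obtain K where K: "\<And>n. finite (K n)" "\<And>n. K n \<subseteq> cball 0 R" "\<And>n. cball (0::'a) R \<subseteq> (\<Union>x\<in>K n. ball x (r n))"
    by metis
  define I where "I = (SIGMA n:UNIV. (Pi\<^sub>E (K n) (\<lambda>_. D)) \<times> (\<rat> :: real set))"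
  have cI: "countable I" unfolding I_def
    by (intro countable_SIGMA countable_PiE D(1) K(1)) (simp_all add: countable_PiE K(1) D(1) countable_rat)
  define W where "W i = {F :: 'a \<Rightarrow> real. \<bar>F 0 - snd (snd i)\<bar> \<le> e / 2 \<and>
     (\<forall>k\<in>K (fst i). \<forall>u\<in>D \<inter> ball k (2 * r (fst i)). \<forall>v\<in>D \<inter> ball k (2 * r (fst i)).
        \<bar>F u - F v - fst (snd i) k \<bullet> (u - v)\<bar> \<le> e / 2 * norm (u - v))}" for i
  have meas: "W i \<in> sets (Pi\<^sub>M UNIV (\<lambda>_. borel))" for i
  proof -
    have "{F \<in> space (Pi\<^sub>M UNIV (\<lambda>_. borel)). \<bar>F 0 - snd (snd i)\<bar> \<le> e / 2 \<and>
     (\<forall>k\<in>K (fst i). \<forall>u\<in>D \<inter> ball k (2 * r (fst i)). \<forall>v\<in>D \<inter> ball k (2 * r (fst i)).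
        \<bar>F u - F v - fst (snd i) k \<bullet> (u - v)\<bar> \<le> e / 2 * norm (u - v))} \<in> sets (Pi\<^sub>M UNIV (\<lambda>_. borel))"
      using D(1) K(1) by (intro sets.sets_Collect_conj sets.sets_Collect_countable_Ball countable_Int1 countable_finite) auto
    then show ?thesis by (simp add: W_def space_PiM)
  qed
  have cover: "\<exists>i\<in>I. F \<in> W i" if F: "C1_field F F'" for F F'
  proof -
    have "uniformly_continuous_on (cball 0 (R + 3)) F'"
      using F by (intro compact_uniformly_continuous) (auto simp: C1_field_def intro: continuous_on_subset)
    then obtain d where d: "0 < d" "\<And>u v. u \<in> cball 0 (R + 3) \<Longrightarrow> v \<in> cball 0 (R + 3) \<Longrightarrow> dist v u < d \<Longrightarrow> dist (F' v) (F' u) < e / 4"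
      unfolding uniformly_continuous_on_def using e by (metis zero_less_divide_iff zero_less_numeral)
    obtain n where n: "r n < d / 2"
      using reals_Archimedean[of "d / 2"] d(1) unfolding r_def by (auto simp: inverse_eq_divide)
    have "\<exists>q\<in>D. q \<in> ball (F' k) (e / 4)" for k
      by (rule D(2)) (use e in auto)
    then obtain q where q: "\<And>k. q k \<in> D" "\<And>k. dist (F' k) (q k) < e / 4" by (metis mem_ball)
    have "\<exists>x\<in>\<rat>. F 0 - e / 2 < x \<and> x < F 0" by (rule Rats_dense_in_real) (use e in simp)
    then obtain x where x: "x \<in> \<rat>" "\<bar>F 0 - x\<bar> \<le> e / 2" by auto
    define i where "i = (n, restrict q (K n), x)"
    have "i \<in> I" unfolding I_def i_def using q(1) x(1) by auto
    moreover have "F \<in> W i"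
      unfolding W_def
    proof (rule CollectI, intro conjI ballI)
      show "\<bar>F 0 - snd (snd i)\<bar> \<le> e / 2" using x(2) by (simp add: i_def)
      fix k u v assume k': "k \<in> K (fst i)" and u: "u \<in> D \<inter> ball k (2 * r (fst i))" and v: "v \<in> D \<inter> ball k (2 * r (fst i))"
      have k: "k \<in> K n" and i: "fst i = n" "fst (snd i) k = q k" using k' by (simp_all add: i_def)
      show "\<bar>F u - F v - fst (snd i) k \<bullet> (u - v)\<bar> \<le> e / 2 * norm (u - v)"
        unfolding i(2)
      proof -
        have "\<bar>F u - F v - q k \<bullet> (u - v)\<bar> \<le> e / 2 * norm (u - v)"
        proof (rule C1_field_bound[OF F convex_ball[of k "2 * r n"]])
          fix z assume "z \<in> ball k (2 * r n)"
          then have z: "dist k z < 2 * r n" by simp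
          have nk: "norm k \<le> R" using subsetD[OF K(2) k] by simp
          have "norm z \<le> norm k + dist k z"
            using norm_triangle_ineq2[of z k] by (simp add: dist_norm norm_minus_commute)
          then have "z \<in> cball 0 (R + 3)" using z r(2)[of n] nk by simp
          moreover have "k \<in> cball 0 (R + 3)" using nk by simp
          ultimately have "dist (F' z) (F' k) < e / 4"
            using d(2)[of k z] z n by (simp add: dist_commute)
          moreover have "norm (F' z - q k) \<le> dist (F' z) (F' k) + dist (F' k) (q k)"
            unfolding dist_norm[symmetric] by (rule dist_triangle)
          ultimately show "norm (F' z - q k) \<le> e / 2" using q(2)[of k] by simp
        qed (use u v i in auto)
        then show "\<bar>F u - F v - q k \<bullet> (u - v)\<bar> \<le> e / 2 * norm (u - v)" .
      qed
    qed
    ultimately show ?thesis by blast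
  qed
  have close: "e-lipschitz_on (cball 0 R) (\<lambda>u. F u - G u) \<and> \<bar>F 0 - G 0\<bar> \<le> e"
    if FG: "F \<in> W i" "G \<in> W i" and cF: "continuous_on UNIV F" and cG: "continuous_on UNIV G" for i F G
  proof
    have "\<bar>F 0 - snd (snd i)\<bar> \<le> e / 2" "\<bar>G 0 - snd (snd i)\<bar> \<le> e / 2" using FG by (auto simp: W_def)
    then show "\<bar>F 0 - G 0\<bar> \<le> e" by linarith
    let ?H = "\<lambda>u. F u - G u"
    have cH: "continuous_on S ?H" for S
      by (intro continuous_on_diff continuous_on_subset[OF cF] continuous_on_subset[OF cG]) auto
    show "e-lipschitz_on (cball 0 R) ?H"
    proof (rule lipschitz_on_convex_if_local[OF convex_cball r(1)[of "fst i"]])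
      fix u v :: 'a assume u: "u \<in> cball 0 R" and v: "v \<in> cball 0 R" and uv: "norm (u - v) < r (fst i)"
      obtain k where k: "k \<in> K (fst i)" "dist k u < r (fst i)" using K(3)[of "fst i"] u by auto
      define B where "B = ball k (2 * r (fst i))"
      have uB: "u \<in> B" using k(2) r(1)[of "fst i"] by (simp add: B_def)
      have vB: "v \<in> B" using k(2) uv dist_triangle[of k v u] by (simp add: B_def dist_norm)
      have dense: "\<bar>?H a - ?H b\<bar> \<le> e * norm (a - b)" if "a \<in> D \<inter> B" "b \<in> D \<inter> B" for a b
      proof -
        have "\<bar>F a - F b - fst (snd i) k \<bullet> (a - b)\<bar> \<le> e / 2 * norm (a - b)"
          "\<bar>G a - G b - fst (snd i) k \<bullet> (a - b)\<bar> \<le> e / 2 * norm (a - b)"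
          using FG k(1) that unfolding W_def B_def by blast+
        then show ?thesis by linarith
      qed
      show "\<bar>?H u - ?H v\<bar> \<le> e * norm (u - v)"
        by (rule dense_lipschitz[OF D(2) _ cH dense uB vB]) (simp_all add: B_def)
    qed (use e in simp)
  qed
  have "I \<noteq> {}" using cover[of "\<lambda>_. 0" "\<lambda>_. 0"] by (auto simp: C1_field_def)
  then have rg: "range (from_nat_into I) = I" using cI by (simp add: range_from_nat_into)
  show ?thesis
  proof (rule that[of "\<lambda>n. W (from_nat_into I n)"])
    fix F :: "'a \<Rightarrow> real" and F' assume "C1_field F F'"
    from cover[OF this] obtain i where i: "i \<in> I" "F \<in> W i" by blast
    then obtain n where "i = from_nat_into I n" using rg by auto
    then show "\<exists>n. F \<in> W (from_nat_into I n)" using i by blast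
  next
    fix n and F G :: "'a \<Rightarrow> real" assume "F \<in> W (from_nat_into I n)" "G \<in> W (from_nat_into I n)" "continuous_on UNIV F" "continuous_on UNIV G"
    then show "e-lipschitz_on (cball 0 R) (\<lambda>u. F u - G u) \<and> \<bar>F 0 - G 0\<bar> \<le> e" by (rule close)
  qed (rule meas)
qed

section \<open>The support of a Gaussian field\<close>

lemma centered_gaussian_facts:
  assumes M: "prob_space M" and X: "centered_gaussian M X"
  shows "X \<in> borel_measurable M" "integrable M (\<lambda>\<omega>. (X \<omega>)\<^sup>2)"
    "distr M borel X = distr std_normal_distribution borel (\<lambda>z. sqrt (\<integral>\<omega>. (X \<omega>)\<^sup>2 \<partial>M) * z)"
    "(\<integral>\<omega>. iexp (t * X \<omega>) \<partial>M) = complex_of_real (exp (- (t\<^sup>2 * (\<integral>\<omega>. (X \<omega>)\<^sup>2 \<partial>M)) / 2))"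
proof -
  show mX[measurable]: "X \<in> borel_measurable M" using X by (simp add: centered_gaussian_def)
  obtain \<sigma> where \<sigma>: "0 \<le> \<sigma>" and law: "distr M borel X = distr std_normal_distribution borel (\<lambda>z. \<sigma> * z)"
    using X by (auto simp: centered_gaussian_def)
  have m[measurable]: "(\<lambda>z. \<sigma> * z) \<in> borel_measurable std_normal_distribution" by simp
  have mom: "integrable std_normal_distribution (\<lambda>x. x\<^sup>2)" "(\<integral>x. x\<^sup>2 \<partial>std_normal_distribution) = 1"
    using std_normal_distribution_even_moments[of 1] by simp_all
  have "integrable (distr std_normal_distribution borel (\<lambda>z. \<sigma> * z)) (\<lambda>x. x\<^sup>2)"
    by (subst integrable_distr_eq) (use mom in \<open>simp_all add: power_mult_distrib\<close>)
  then have "integrable (distr M borel X) (\<lambda>x. x\<^sup>2)" by (simp add: law)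
  then show "integrable M (\<lambda>\<omega>. (X \<omega>)\<^sup>2)" by (subst (asm) integrable_distr_eq) simp_all
  have "(\<integral>\<omega>. (X \<omega>)\<^sup>2 \<partial>M) = (\<integral>x. x\<^sup>2 \<partial>distr M borel X)" by (subst integral_distr) simp_all
  also have "\<dots> = (\<integral>z. (\<sigma> * z)\<^sup>2 \<partial>std_normal_distribution)" unfolding law by (subst integral_distr) simp_all
  also have "\<dots> = \<sigma>\<^sup>2" using mom by (simp add: power_mult_distrib)
  finally have s: "(\<integral>\<omega>. (X \<omega>)\<^sup>2 \<partial>M) = \<sigma>\<^sup>2" .
  then show "distr M borel X = distr std_normal_distribution borel (\<lambda>z. sqrt (\<integral>\<omega>. (X \<omega>)\<^sup>2 \<partial>M) * z)"
    using \<sigma> law by simp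
  have "(\<integral>\<omega>. iexp (t * X \<omega>) \<partial>M) = (\<integral>x. iexp (t * x) \<partial>distr M borel X)"
    by (subst integral_distr) simp_all
  also have "\<dots> = (\<integral>z. iexp (t * (\<sigma> * z)) \<partial>std_normal_distribution)" unfolding law by (subst integral_distr) simp_all
  also have "\<dots> = char std_normal_distribution (t * \<sigma>)" by (simp add: char_def mult.assoc)
  also have "\<dots> = complex_of_real (exp (- ((t * \<sigma>)\<^sup>2) / 2))" by (simp only: char_std_normal_distribution)
  finally show "(\<integral>\<omega>. iexp (t * X \<omega>) \<partial>M) = complex_of_real (exp (- (t\<^sup>2 * (\<integral>\<omega>. (X \<omega>)\<^sup>2 \<partial>M)) / 2))"
    by (simp only: s power_mult_distrib)
qed

lemma centered_gaussian_processD: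
  assumes "centered_gaussian_process M X"
  shows "finite F \<Longrightarrow> centered_gaussian M (\<lambda>\<omega>. \<Sum>i\<in>F. c i * X i \<omega>)" "centered_gaussian M (X i)"
proof -
  show *: "finite F \<Longrightarrow> centered_gaussian M (\<lambda>\<omega>. \<Sum>i\<in>F. c i * X i \<omega>)" for F c
    using assms by (simp add: centered_gaussian_process_def)
  show "centered_gaussian M (X i)" using *[of "{i}" "\<lambda>_. 1"] by simp
qed

lemma integrable_mult_of_squares:
  fixes f g :: "'w \<Rightarrow> real"
  assumes [measurable]: "f \<in> borel_measurable M" "g \<in> borel_measurable M"
    and "integrable M (\<lambda>\<omega>. (f \<omega>)\<^sup>2)" "integrable M (\<lambda>\<omega>. (g \<omega>)\<^sup>2)"
  shows "integrable M (\<lambda>\<omega>. f \<omega> * g \<omega>)"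
proof (rule Bochner_Integration.integrable_bound)
  show "integrable M (\<lambda>\<omega>. (f \<omega>)\<^sup>2 + (g \<omega>)\<^sup>2)" using assms(3,4) by (rule Bochner_Integration.integrable_add)
  have "norm (f \<omega> * g \<omega>) \<le> norm ((f \<omega>)\<^sup>2 + (g \<omega>)\<^sup>2)" for \<omega>
  proof -
    have "2 * (\<bar>f \<omega>\<bar> * \<bar>g \<omega>\<bar>) \<le> \<bar>f \<omega>\<bar>\<^sup>2 + \<bar>g \<omega>\<bar>\<^sup>2"
      using sum_squares_bound[of "\<bar>f \<omega>\<bar>" "\<bar>g \<omega>\<bar>"] by simp
    moreover have "0 \<le> \<bar>f \<omega>\<bar> * \<bar>g \<omega>\<bar>" by simp
    ultimately have "\<bar>f \<omega>\<bar> * \<bar>g \<omega>\<bar> \<le> (f \<omega>)\<^sup>2 + (g \<omega>)\<^sup>2" unfolding power2_abs by linarith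
    then show ?thesis by (simp add: abs_mult)
  qed
  then show "AE \<omega> in M. norm (f \<omega> * g \<omega>) \<le> norm ((f \<omega>)\<^sup>2 + (g \<omega>)\<^sup>2)" by simp
qed simp

lemma integral_pair_prod:
  fixes f :: "'a \<Rightarrow> complex" and g :: "'b \<Rightarrow> complex"
  assumes "prob_space M" "prob_space N" and [measurable]: "f \<in> borel_measurable M" "g \<in> borel_measurable N"
    and "\<And>x. norm (f x) \<le> 1" "\<And>x. norm (g x) \<le> 1"
  shows "(\<integral>p. f (fst p) * g (snd p) \<partial>(M \<Otimes>\<^sub>M N)) = (\<integral>x. f x \<partial>M) * (\<integral>x. g x \<partial>N)"
proof -
  interpret M: prob_space M by fact
  interpret N: prob_space N by fact
  interpret P: pair_prob_space M N ..
  have "integrable (M \<Otimes>\<^sub>M N) (\<lambda>p. f (fst p) * g (snd p))"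
  proof (rule P.P.integrable_const_bound[of _ 1])
    show "AE p in M \<Otimes>\<^sub>M N. norm (f (fst p) * g (snd p)) \<le> 1"
      using assms(5,6) by (simp add: norm_mult mult_le_one)
  qed simp
  from P.integral_fst'[OF this] show ?thesis by simp
qed

text \<open>Let \<open>h u = E (X u) Z\<close> and \<open>s = E Z\<^sup>2\<close>. The process \<open>X u - (Z / s) h u\<close> is independent of \<open>Z\<close>, so \<open>X\<close> has the law
of this remainder plus \<open>(\<zeta> / sqrt s) h\<close> with an independent standard normal \<open>\<zeta>\<close>. The remainder is
replaced by the normalized difference of two independent copies, which has the same law and is small as soon as
the two copies are close to each other. The argument \<open>p\<close> consists of the two copies of \<open>\<omega>\<close> and of \<open>\<zeta>\<close>.
For \<open>s = 0\<close> the divisions by zero leave the difference of the copies, which is correct since then \<open>h = 0\<close>.\<close>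

definition gaussian_shift :: "'w measure \<Rightarrow> ('i \<Rightarrow> 'w \<Rightarrow> real) \<Rightarrow> ('w \<Rightarrow> real) \<Rightarrow> 'i \<Rightarrow> 'w \<times> 'w \<times> real \<Rightarrow> real" where
  "gaussian_shift M X Z u p = (let h = (\<integral>\<omega>. X u \<omega> * Z \<omega> \<partial>M); s = (\<integral>\<omega>. (Z \<omega>)\<^sup>2 \<partial>M) in
     ((X u (fst p) - Z (fst p) / s * h) - (X u (fst (snd p)) - Z (fst (snd p)) / s * h)) / sqrt 2 + snd (snd p) / sqrt s * h)"

text \<open>With \<open>S = \<Sum> c\<^sub>i X\<^sub>i\<close> and \<open>H = E S Z\<close>, the variance of the remainder of \<open>S\<close> is \<open>E S\<^sup>2 - H\<^sup>2 / s\<close>; each of the two copies contributes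
one half of it, and the term with \<open>\<zeta>\<close> contributes the missing \<open>H\<^sup>2 / s\<close>.\<close>

lemma gaussian_shift_same_char:
  fixes X :: "'i \<Rightarrow> 'w \<Rightarrow> real"
  assumes M: "prob_space M" and X: "centered_gaussian_process M X" and V: "finite V"
    and Z: "Z = (\<lambda>\<omega>. \<Sum>v\<in>V. a v * X v \<omega>)"
  shows "same_char M X (M \<Otimes>\<^sub>M (M \<Otimes>\<^sub>M std_normal_distribution)) (gaussian_shift M X Z)"
  unfolding same_char_def
proof (intro allI impI)
  fix F :: "'i set" and c :: "'i \<Rightarrow> real" assume F: "finite F"
  interpret M: prob_space M by fact
  have S1: "prob_space std_normal_distribution" using real_dist_normal_dist by (simp add: real_distribution_def)
  then interpret S: prob_space std_normal_distribution .
  interpret Q: pair_prob_space M std_normal_distribution ..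
  note facts = centered_gaussian_facts[OF M]
  note XG = centered_gaussian_processD[OF X]
  have mX[measurable]: "X u \<in> borel_measurable M" for u by (rule facts(1)[OF XG(2)])
  have X2: "integrable M (\<lambda>\<omega>. (X u \<omega>)\<^sup>2)" for u by (rule facts(2)[OF XG(2)])
  have ZG: "centered_gaussian M Z" unfolding Z by (rule XG(1)[OF V])
  have mZ[measurable]: "Z \<in> borel_measurable M" by (rule facts(1)[OF ZG])
  have Z2: "integrable M (\<lambda>\<omega>. (Z \<omega>)\<^sup>2)" by (rule facts(2)[OF ZG])
  have XZ: "integrable M (\<lambda>\<omega>. X u \<omega> * Z \<omega>)" for u by (rule integrable_mult_of_squares[OF mX mZ X2 Z2])
  define h where "h u = (\<integral>\<omega>. X u \<omega> * Z \<omega> \<partial>M)" for u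
  define s where "s = (\<integral>\<omega>. (Z \<omega>)\<^sup>2 \<partial>M)"
  have s0: "0 \<le> s" unfolding s_def by simp
  define S where "S \<omega> = (\<Sum>i\<in>F. c i * X i \<omega>)" for \<omega>
  define H where "H = (\<Sum>i\<in>F. c i * h i)"
  define k where "k = H / s"
  define L where "L \<omega> = S \<omega> - k * Z \<omega>" for \<omega>
  have SG: "centered_gaussian M S" unfolding S_def by (rule XG(1)[OF F])
  have mS[measurable]: "S \<in> borel_measurable M" by (rule facts(1)[OF SG])
  have S2: "integrable M (\<lambda>\<omega>. (S \<omega>)\<^sup>2)" by (rule facts(2)[OF SG])
  have SZ: "integrable M (\<lambda>\<omega>. S \<omega> * Z \<omega>)" by (rule integrable_mult_of_squares[OF mS mZ S2 Z2])
  have HS: "(\<integral>\<omega>. S \<omega> * Z \<omega> \<partial>M) = H"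
  proof -
    have "(\<integral>\<omega>. S \<omega> * Z \<omega> \<partial>M) = (\<integral>\<omega>. (\<Sum>i\<in>F. c i * (X i \<omega> * Z \<omega>)) \<partial>M)"
      by (simp add: S_def sum_distrib_right mult.assoc)
    also have "\<dots> = H" unfolding H_def h_def using XZ by simp
    finally show ?thesis .
  qed
  have "L = (\<lambda>\<omega>. \<Sum>i\<in>F \<union> V. ((if i \<in> F then c i else 0) - k * (if i \<in> V then a i else 0)) * X i \<omega>)"
  proof
    fix \<omega>
    have "S \<omega> = (\<Sum>i\<in>F \<union> V. (if i \<in> F then c i else 0) * X i \<omega>)"
      unfolding S_def using F V by (intro sum.mono_neutral_cong_left) auto
    moreover have "Z \<omega> = (\<Sum>i\<in>F \<union> V. (if i \<in> V then a i else 0) * X i \<omega>)"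
      unfolding Z using F V by (intro sum.mono_neutral_cong_left) auto
    ultimately show "L \<omega> = (\<Sum>i\<in>F \<union> V. ((if i \<in> F then c i else 0) - k * (if i \<in> V then a i else 0)) * X i \<omega>)"
      unfolding L_def by (simp only: left_diff_distrib sum_subtractf sum_distrib_left mult.assoc)
  qed
  then have LG: "centered_gaussian M L" using F V by (simp only:) (rule XG(1), simp)
  have mL[measurable]: "L \<in> borel_measurable M" by (rule facts(1)[OF LG])
  have L2: "(\<integral>\<omega>. (L \<omega>)\<^sup>2 \<partial>M) = (\<integral>\<omega>. (S \<omega>)\<^sup>2 \<partial>M) - H\<^sup>2 / s"
  proof -
    have "(\<integral>\<omega>. (L \<omega>)\<^sup>2 \<partial>M) = (\<integral>\<omega>. (S \<omega>)\<^sup>2 - 2 * k * (S \<omega> * Z \<omega>) + k\<^sup>2 * (Z \<omega>)\<^sup>2 \<partial>M)"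
      by (simp add: L_def power2_eq_square algebra_simps)
    also have "\<dots> = (\<integral>\<omega>. (S \<omega>)\<^sup>2 \<partial>M) - 2 * k * H + k\<^sup>2 * s"
      using S2 SZ Z2 by (simp add: HS s_def)
    also have "\<dots> = (\<integral>\<omega>. (S \<omega>)\<^sup>2 \<partial>M) - H\<^sup>2 / s"
      by (cases "s = 0") (simp_all add: k_def power2_eq_square field_simps)
    finally show ?thesis .
  qed
  define r where "r = 1 / sqrt (2::real)"
  have r: "x / sqrt 2 = r * x" "r\<^sup>2 = 1 / 2" for x by (simp_all add: r_def power_divide)
  have sum: "(\<Sum>i\<in>F. c i * gaussian_shift M X Z i p) = r * L (fst p) + (- r * L (fst (snd p)) + (H / sqrt s) * snd (snd p))" for p
  proof -
    have "(\<Sum>i\<in>F. c i * gaussian_shift M X Z i p) = (\<Sum>i\<in>F. r * (c i * X i (fst p)) - r * Z (fst p) / s * (c i * h i)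
        - (r * (c i * X i (fst (snd p))) - r * Z (fst (snd p)) / s * (c i * h i)) + snd (snd p) / sqrt s * (c i * h i))"
      unfolding gaussian_shift_def Let_def h_def[symmetric] s_def[symmetric] r(1)
      by (intro sum.cong refl) (simp add: algebra_simps)
    also have "\<dots> = r * S (fst p) - r * Z (fst p) / s * H - (r * S (fst (snd p)) - r * Z (fst (snd p)) / s * H) + snd (snd p) / sqrt s * H"
      unfolding S_def H_def by (simp only: sum.distrib sum_subtractf sum_distrib_left[symmetric])
    finally show ?thesis by (simp add: L_def k_def algebra_simps)
  qed
  have "(\<integral>p. iexp (\<Sum>i\<in>F. c i * gaussian_shift M X Z i p) \<partial>(M \<Otimes>\<^sub>M (M \<Otimes>\<^sub>M std_normal_distribution))) =
    (\<integral>p. iexp (r * L (fst p)) * (iexp (- r * L (fst (snd p))) * iexp ((H / sqrt s) * snd (snd p))) \<partial>(M \<Otimes>\<^sub>M (M \<Otimes>\<^sub>M std_normal_distribution)))"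
    unfolding sum iexp_add ..
  also have "\<dots> = (\<integral>\<omega>. iexp (r * L \<omega>) \<partial>M) * (\<integral>q. iexp (- r * L (fst q)) * iexp ((H / sqrt s) * snd q) \<partial>(M \<Otimes>\<^sub>M std_normal_distribution))"
    by (rule integral_pair_prod[OF M Q.P.prob_space_axioms, of "\<lambda>\<omega>. iexp (r * L \<omega>)" "\<lambda>q. iexp (- r * L (fst q)) * iexp ((H / sqrt s) * snd q)"])
       (simp_all add: norm_mult)
  also have "(\<integral>q. iexp (- r * L (fst q)) * iexp ((H / sqrt s) * snd q) \<partial>(M \<Otimes>\<^sub>M std_normal_distribution)) =
     (\<integral>\<omega>. iexp (- r * L \<omega>) \<partial>M) * (\<integral>z. iexp ((H / sqrt s) * z) \<partial>std_normal_distribution)"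
    by (rule integral_pair_prod[OF M S1, of "\<lambda>\<omega>. iexp (- r * L \<omega>)" "\<lambda>z. iexp ((H / sqrt s) * z)"]) simp_all
  also have "(\<integral>z. iexp ((H / sqrt s) * z) \<partial>std_normal_distribution) = complex_of_real (exp (- ((H / sqrt s)\<^sup>2) / 2))"
    using char_std_normal_distribution unfolding char_def fun_eq_iff by blast
  also have "(\<integral>\<omega>. iexp (r * L \<omega>) \<partial>M) * ((\<integral>\<omega>. iexp (- r * L \<omega>) \<partial>M) * complex_of_real (exp (- ((H / sqrt s)\<^sup>2) / 2))) =
      complex_of_real (exp (- (\<integral>\<omega>. (S \<omega>)\<^sup>2 \<partial>M) / 2))"
    unfolding facts(4)[OF LG] of_real_mult[symmetric] exp_add[symmetric] L2
    using s0 by (simp add: r(2) power_divide power2_minus field_simps)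
  also have "\<dots> = (\<integral>\<omega>. iexp (1 * S \<omega>) \<partial>M)" unfolding facts(4)[OF SG] by simp
  finally show "(\<integral>\<omega>. iexp (\<Sum>i\<in>F. c i * X i \<omega>) \<partial>M) = (\<integral>p. iexp (\<Sum>i\<in>F. c i * gaussian_shift M X Z i p) \<partial>(M \<Otimes>\<^sub>M (M \<Otimes>\<^sub>M std_normal_distribution)))"
    unfolding S_def by simp
qed

text \<open>The condition \<open>\<bar>(F - h) u - (F - h) v\<bar> \<le> e \<bar>u - v\<bar>\<close> is imposed on a countable set \<open>D\<close> only, so that these sets are
measurable in the product \<open>\<sigma>\<close>-algebra.\<close>

definition lip_near :: "'a::real_normed_vector set \<Rightarrow> real \<Rightarrow> real \<Rightarrow> ('a \<Rightarrow> real) \<Rightarrow> ('a \<Rightarrow> real) set" where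
  "lip_near D R e h = {F. \<forall>u\<in>D \<inter> ball 0 R. \<forall>v\<in>D \<inter> ball 0 R. \<bar>(F u - h u) - (F v - h v)\<bar> \<le> e * norm (u - v)}"

lemma sets_lip_near:
  assumes "countable D" shows "lip_near D R e h \<in> sets (Pi\<^sub>M UNIV (\<lambda>_. borel))"
proof -
  have "{F \<in> space (Pi\<^sub>M UNIV (\<lambda>_. borel)). \<forall>u\<in>D \<inter> ball 0 R. \<forall>v\<in>D \<inter> ball 0 R. \<bar>(F u - h u) - (F v - h v)\<bar> \<le> e * norm (u - v)}
      \<in> sets (Pi\<^sub>M UNIV (\<lambda>_. borel))"
    using assms by (intro sets.sets_Collect_countable_All' countable_Int1) auto
  then show ?thesis by (simp add: lip_near_def space_PiM)
qed

lemma lip_near_lipschitz: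
  assumes "F \<in> lip_near D R e h" "\<And>X. open X \<Longrightarrow> X \<noteq> {} \<Longrightarrow> \<exists>d\<in>D. d \<in> X"
    and F: "continuous_on UNIV F" and h: "continuous_on UNIV h" and e: "0 \<le> e"
  shows "e-lipschitz_on (ball 0 R) (\<lambda>u. F u - h u)"
proof (rule lipschitz_onI[OF _ e])
  fix u v :: 'a assume uv: "u \<in> ball 0 R" "v \<in> ball 0 R"
  have "\<bar>(F u - h u) - (F v - h v)\<bar> \<le> e * norm (u - v)"
    by (rule dense_lipschitz[where H = "\<lambda>u. F u - h u", OF assms(2) open_ball continuous_on_diff[OF F h] _ uv])
       (use assms(1) in \<open>auto simp: lip_near_def\<close>)
  then show "dist (F u - h u) (F v - h v) \<le> e * dist u v" by (simp add: dist_norm dist_real_def)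
qed

lemma std_normal_interval_pos:
  assumes "a < b" shows "0 < measure std_normal_distribution {a<..<b}"
proof -
  interpret S: prob_space std_normal_distribution using real_dist_normal_dist by (simp add: real_distribution_def)
  have "emeasure std_normal_distribution {a<..<b} \<noteq> 0"
  proof
    assume "emeasure std_normal_distribution {a<..<b} = 0"
    then have "(\<integral>\<^sup>+x. ennreal (std_normal_density x) * indicator {a<..<b} x \<partial>lborel) = 0"
      by (subst (asm) emeasure_density) auto
    then have "AE x in lborel. ennreal (std_normal_density x) * indicator {a<..<b} x = 0"
      by (subst (asm) nn_integral_0_iff_AE) auto
    then have "AE x in lborel. x \<notin> {a<..<b}"
    proof eventually_elim
      fix x assume "ennreal (std_normal_density x) * indicator {a<..<b} x = 0"
      moreover have "0 < std_normal_density x" by (simp add: normal_density_pos)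
      ultimately show "x \<notin> {a<..<b}" by (auto simp: indicator_def split: if_splits)
    qed
    then have "{a<..<b} \<in> null_sets lborel" by (subst AE_iff_null_sets) auto
    then show False using assms by (simp add: null_sets_def)
  qed
  then show ?thesis by (simp add: S.emeasure_eq_measure zero_less_measure_iff)
qed

text \<open>Some cell of \<open>C1_fields_separable\<close> has positive probability. On the event that both copies in \<open>gaussian_shift\<close> lie
in that cell and that the standard normal variable is close to \<open>sqrt s\<close>, the shifted process is close to \<open>h\<close>; this event has
positive probability as a product of three independent events.\<close>

theorem gaussian_field_support:
  fixes X :: "'a::euclidean_space \<Rightarrow> 'w \<Rightarrow> real"
  assumes M: "prob_space M" and X: "centered_gaussian_process M X"
    and paths: "\<And>\<omega>. \<exists>F'. C1_field (\<lambda>u. X u \<omega>) F'"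
    and V: "finite V" and h: "\<And>u. h u = (\<Sum>v\<in>V. a v * (\<integral>\<omega>. X u \<omega> * X v \<omega> \<partial>M))"
    and L: "Lh-lipschitz_on UNIV h"
    and e: "0 < e" and D: "countable D"
  shows "0 < measure M {\<omega> \<in> space M. (\<lambda>u. X u \<omega>) \<in> lip_near D R e h}"
proof -
  interpret M: prob_space M by fact
  have S1: "prob_space std_normal_distribution" using real_dist_normal_dist by (simp add: real_distribution_def)
  then interpret S: prob_space std_normal_distribution .
  interpret Q: pair_prob_space M std_normal_distribution ..
  interpret T: pair_prob_space M "M \<Otimes>\<^sub>M std_normal_distribution" ..
  note facts = centered_gaussian_facts[OF M]
  note XG = centered_gaussian_processD[OF X]
  have mX[measurable]: "X u \<in> borel_measurable M" for u by (rule facts(1)[OF XG(2)])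
  have X2: "integrable M (\<lambda>\<omega>. (X u \<omega>)\<^sup>2)" for u by (rule facts(2)[OF XG(2)])
  have XX: "integrable M (\<lambda>\<omega>. X u \<omega> * X v \<omega>)" for u v by (rule integrable_mult_of_squares[OF mX mX X2 X2])
  define Z where "Z = (\<lambda>\<omega>. \<Sum>v\<in>V. a v * X v \<omega>)"
  have ZG: "centered_gaussian M Z" unfolding Z_def by (rule XG(1)[OF V])
  have mZ[measurable]: "Z \<in> borel_measurable M" by (rule facts(1)[OF ZG])
  have Z2: "integrable M (\<lambda>\<omega>. (Z \<omega>)\<^sup>2)" by (rule facts(2)[OF ZG])
  have hZ: "h u = (\<integral>\<omega>. X u \<omega> * Z \<omega> \<partial>M)" for u
  proof -
    have "(\<integral>\<omega>. X u \<omega> * Z \<omega> \<partial>M) = (\<integral>\<omega>. (\<Sum>v\<in>V. a v * (X u \<omega> * X v \<omega>)) \<partial>M)"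
      by (simp add: Z_def sum_distrib_left mult.left_commute)
    also have "\<dots> = h u" unfolding h using XX by simp
    finally show ?thesis by simp
  qed
  define s where "s = (\<integral>\<omega>. (Z \<omega>)\<^sup>2 \<partial>M)"
  have s0: "0 \<le> s" unfolding s_def by simp
  have hs: "h u = 0" if "s = 0" for u
  proof -
    have "AE \<omega> in M. (Z \<omega>)\<^sup>2 = 0"
      using that Z2 unfolding s_def by (subst (asm) integral_nonneg_eq_0_iff_AE) auto
    then have "AE \<omega> in M. X u \<omega> * Z \<omega> = 0" by eventually_elim simp
    then have "(\<integral>\<omega>. X u \<omega> * Z \<omega> \<partial>M) = (\<integral>\<omega>. 0 \<partial>M)" by (intro integral_cong_AE) auto
    then show ?thesis by (simp add: hZ)
  qed
  have Lh: "0 \<le> Lh" using L by (rule lipschitz_on_nonneg)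
  define R' where "R' = \<bar>R\<bar> + (\<Sum>v\<in>V. norm v)"
  have R': "\<bar>R\<bar> \<le> R'" "0 \<le> R'" "\<And>v. v \<in> V \<Longrightarrow> norm v \<le> R'"
    unfolding R'_def using V by (auto intro!: sum_nonneg add_increasing member_le_sum)
  define A where "A = (\<Sum>v\<in>V. \<bar>a v\<bar>)"
  have A: "0 \<le> A" unfolding A_def by (simp add: sum_nonneg)
  define C where "C = 1 + A * (1 + R') / s * Lh"
  have C: "1 \<le> C" unfolding C_def using A R' s0 Lh by simp
  define d where "d = e / 2 / C"
  have d: "0 < d" "d * C = e / 2" using e C by (simp_all add: d_def)
  obtain W :: "nat \<Rightarrow> ('a \<Rightarrow> real) set" where W: "\<And>n. W n \<in> sets (Pi\<^sub>M UNIV (\<lambda>_. borel))"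
    "\<And>F F'. C1_field F F' \<Longrightarrow> \<exists>n. F \<in> W n"
    "\<And>n F G. F \<in> W n \<Longrightarrow> G \<in> W n \<Longrightarrow> continuous_on UNIV F \<Longrightarrow> continuous_on UNIV G \<Longrightarrow>
       d-lipschitz_on (cball 0 R') (\<lambda>u. F u - G u) \<and> \<bar>F 0 - G 0\<bar> \<le> d"
    using C1_fields_separable[OF d(1) R'(2)] by blast
  have mXX[measurable]: "(\<lambda>\<omega> u. X u \<omega>) \<in> measurable M (Pi\<^sub>M UNIV (\<lambda>_. borel))"
    by (auto intro!: measurable_PiM_single')
  define E where "E n = {\<omega> \<in> space M. (\<lambda>u. X u \<omega>) \<in> W n}" for n
  have mE[measurable]: "E n \<in> sets M" for n
    using measurable_sets[OF mXX W(1)[of n]] by (simp add: E_def vimage_def Int_def conj_commute)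
  have "\<exists>n. emeasure M (E n) \<noteq> 0"
  proof (rule ccontr)
    assume "\<not> ?thesis"
    then have "emeasure M (\<Union>n. E n) = 0" by (intro emeasure_UN_eq_0) auto
    moreover have ex: "\<exists>n. (\<lambda>u. X u \<omega>) \<in> W n" for \<omega>
      using paths[of \<omega>] by (elim exE) (rule W(2))
    have "(\<Union>n. E n) = space M" using ex by (auto simp: E_def)
    ultimately show False by (simp add: M.emeasure_space_1)
  qed
  then obtain n where n: "emeasure M (E n) \<noteq> 0" ..
  \<comment> \<open>the summand \<open>1\<close> only avoids division by zero\<close>
  define \<delta> where "\<delta> = e / (2 * (Lh + 1))"
  have \<delta>: "0 < \<delta>" "\<delta> * Lh \<le> e / 2" using e Lh by (simp_all add: \<delta>_def field_simps)
  \<comment> \<open>for \<open>s = 0\<close> any nonempty interval will do\<close>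
  define B where "B = {(1 - \<delta>) * sqrt s <..< (1 + \<delta>) * sqrt s + (if s = 0 then 1 else 0)}"
  have "0 < measure std_normal_distribution B" unfolding B_def
    by (rule std_normal_interval_pos) (use \<delta> s0 in \<open>auto simp: mult_less_cancel_right\<close>)
  then have B: "emeasure std_normal_distribution B \<noteq> 0" by (simp add: S.emeasure_eq_measure)
  have mB[measurable]: "B \<in> sets borel" by (simp add: B_def)
  let ?N = "M \<Otimes>\<^sub>M (M \<Otimes>\<^sub>M std_normal_distribution)"
  let ?Y = "gaussian_shift M X Z"
  have mY[measurable]: "?Y u \<in> borel_measurable ?N" for u
    unfolding gaussian_shift_def Let_def by measurable
  have mYY[measurable]: "(\<lambda>p u. ?Y u p) \<in> measurable ?N (Pi\<^sub>M UNIV (\<lambda>_. borel))"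
    by (auto intro!: measurable_PiM_single')
  have law: "distr M (Pi\<^sub>M UNIV (\<lambda>_. borel)) (\<lambda>\<omega> u. X u \<omega>) = distr ?N (Pi\<^sub>M UNIV (\<lambda>_. borel)) (\<lambda>p u. ?Y u p)"
    by (rule same_char_same_law[OF M T.P.prob_space_axioms mX mY gaussian_shift_same_char[OF M X V Z_def]])
  let ?G = "lip_near D R e h"
  have G: "?G \<in> sets (Pi\<^sub>M UNIV (\<lambda>_. borel))" by (rule sets_lip_near[OF D])
  have incl: "(\<lambda>u. ?Y u (\<omega>, \<omega>', z)) \<in> ?G" if w: "\<omega> \<in> E n" "\<omega>' \<in> E n" "z \<in> B" for \<omega> \<omega>' z
  proof -
    have c: "continuous_on UNIV (\<lambda>u. X u \<omega>)" for \<omega> using paths[of \<omega>] C1_field_continuous by blast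
    have lip: "d-lipschitz_on (cball 0 R') (\<lambda>u. X u \<omega> - X u \<omega>')" and zero: "\<bar>X 0 \<omega> - X 0 \<omega>'\<bar> \<le> d"
      using W(3)[of "\<lambda>u. X u \<omega>" n "\<lambda>u. X u \<omega>'"] w c by (auto simp: E_def)
    have ZZ: "\<bar>Z \<omega> - Z \<omega>'\<bar> \<le> A * (d * (1 + R'))"
    proof -
      have "\<bar>Z \<omega> - Z \<omega>'\<bar> = \<bar>\<Sum>v\<in>V. a v * (X v \<omega> - X v \<omega>')\<bar>"
        by (simp add: Z_def sum_subtractf right_diff_distrib)
      also have "\<dots> \<le> (\<Sum>v\<in>V. \<bar>a v\<bar> * (d * (1 + R')))"
      proof (rule order_trans[OF sum_abs], rule sum_mono)
        fix v assume v: "v \<in> V"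
        have "\<bar>(X v \<omega> - X v \<omega>') - (X 0 \<omega> - X 0 \<omega>')\<bar> \<le> d * norm v"
          using lipschitz_onD[OF lip, of v 0] R'(2) R'(3)[OF v] by (simp add: dist_real_def)
        also have "\<dots> \<le> d * R'" using R'(3)[OF v] d by (intro mult_left_mono) auto
        finally have "\<bar>X v \<omega> - X v \<omega>'\<bar> \<le> d * (1 + R')" using zero by (simp add: algebra_simps)
        then show "\<bar>a v * (X v \<omega> - X v \<omega>')\<bar> \<le> \<bar>a v\<bar> * (d * (1 + R'))"
          unfolding abs_mult by (intro mult_left_mono) auto
      qed
      also have "\<dots> = A * (d * (1 + R'))" by (simp add: A_def sum_distrib_right)
      finally show ?thesis .
    qed
    have zB: "\<bar>(z / sqrt s - 1) * (h u - h v)\<bar> \<le> \<delta> * (Lh * norm (u - v))" for u v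
    proof (cases "s = 0")
      case False
      then have "0 < sqrt s" using s0 by simp
      then have "\<bar>z / sqrt s - 1\<bar> \<le> \<delta>" using w(3) False by (simp add: B_def abs_le_iff field_simps)
      moreover have "\<bar>h u - h v\<bar> \<le> Lh * norm (u - v)"
        using lipschitz_onD[OF L, of u v] by (simp add: dist_norm)
      ultimately show ?thesis unfolding abs_mult using \<delta> by (intro mult_mono) auto
    qed (use hs \<delta> Lh in simp)
    have sq: "\<bar>x / sqrt 2\<bar> \<le> \<bar>x\<bar>" for x :: real
    proof -
      have "\<bar>x\<bar> * 1 \<le> \<bar>x\<bar> * sqrt 2" by (rule mult_left_mono) auto
      then show ?thesis by (simp add: abs_divide divide_le_eq)
    qed
    show ?thesis unfolding lip_near_def
    proof (rule CollectI, intro ballI)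
      fix u v assume u: "u \<in> D \<inter> ball 0 R" and v: "v \<in> D \<inter> ball 0 R"
      have "norm u < R" "norm v < R" using u v by auto
      then have uvR: "u \<in> cball 0 R'" "v \<in> cball 0 R'" using R'(1) abs_ge_self[of R] by simp_all
      define a1 where "a1 = (X u \<omega> - X u \<omega>') - (X v \<omega> - X v \<omega>')"
      define a2 where "a2 = (Z \<omega> - Z \<omega>') / s * (h u - h v)"
      define a3 where "a3 = (z / sqrt s - 1) * (h u - h v)"
      have "(?Y u (\<omega>, \<omega>', z) - h u) - (?Y v (\<omega>, \<omega>', z) - h v) = (a1 - a2) / sqrt 2 + a3"
        unfolding gaussian_shift_def Let_def hZ[symmetric] s_def[symmetric] a1_def a2_def a3_def
        by (simp add: algebra_simps add_divide_distrib diff_divide_distrib)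
      moreover have "\<bar>(a1 - a2) / sqrt 2 + a3\<bar> \<le> \<bar>a1\<bar> + \<bar>a2\<bar> + \<bar>a3\<bar>"
        using sq[of "a1 - a2"] abs_triangle_ineq[of "(a1 - a2) / sqrt 2" a3] abs_triangle_ineq4[of a1 a2] by linarith
      moreover have "\<bar>a1\<bar> \<le> d * norm (u - v)"
        unfolding a1_def using lipschitz_onD[OF lip uvR] by (simp add: dist_norm dist_real_def)
      moreover have "\<bar>a2\<bar> \<le> A * (d * (1 + R')) / s * (Lh * norm (u - v))"
      proof -
        have "\<bar>(Z \<omega> - Z \<omega>') / s\<bar> \<le> A * (d * (1 + R')) / s"
          using divide_right_mono[OF ZZ s0] s0 by (simp add: abs_divide)
        moreover have "\<bar>h u - h v\<bar> \<le> Lh * norm (u - v)"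
          using lipschitz_onD[OF L, of u v] by (simp add: dist_norm)
        ultimately show ?thesis unfolding a2_def abs_mult using s0 A d(1) R'(2) by (intro mult_mono) auto
      qed
      moreover have "\<bar>a3\<bar> \<le> \<delta> * (Lh * norm (u - v))" unfolding a3_def by (rule zB)
      moreover have "d * norm (u - v) + A * (d * (1 + R')) / s * (Lh * norm (u - v)) + \<delta> * (Lh * norm (u - v)) \<le> e * norm (u - v)"
      proof -
        have "d * norm (u - v) + A * (d * (1 + R')) / s * (Lh * norm (u - v)) + \<delta> * (Lh * norm (u - v)) = (d * C + \<delta> * Lh) * norm (u - v)"
          by (simp add: C_def algebra_simps)
        also have "\<dots> \<le> e * norm (u - v)" using d(2) \<delta>(2) by (intro mult_right_mono) auto
        finally show ?thesis .
      qed
      ultimately show "\<bar>(?Y u (\<omega>, \<omega>', z) - h u) - (?Y v (\<omega>, \<omega>', z) - h v)\<bar> \<le> e * norm (u - v)" by linarith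
    qed
  qed
  have EB: "emeasure ?N (E n \<times> (E n \<times> B)) = emeasure M (E n) * (emeasure M (E n) * emeasure std_normal_distribution B)"
    by (simp add: Q.P.emeasure_pair_measure_Times S.emeasure_pair_measure_Times)
  then have "emeasure ?N (E n \<times> (E n \<times> B)) \<noteq> 0" using n B by simp
  moreover have "emeasure ?N (E n \<times> (E n \<times> B)) \<le> emeasure ?N ((\<lambda>p u. ?Y u p) -` ?G \<inter> space ?N)"
  proof (rule emeasure_mono)
    show "E n \<times> (E n \<times> B) \<subseteq> (\<lambda>p u. ?Y u p) -` ?G \<inter> space ?N"
      using incl sets.sets_into_space[OF mE[of n]] by (auto simp: space_pair_measure)
    show "(\<lambda>p u. ?Y u p) -` ?G \<inter> space ?N \<in> sets ?N" by (rule measurable_sets[OF mYY G])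
  qed
  moreover have "emeasure ?N ((\<lambda>p u. ?Y u p) -` ?G \<inter> space ?N) = emeasure M ((\<lambda>\<omega> u. X u \<omega>) -` ?G \<inter> space M)"
    using arg_cong[OF law, of "\<lambda>P. emeasure P ?G"] by (simp add: emeasure_distr[OF mXX G] emeasure_distr[OF mYY G])
  moreover have "(\<lambda>\<omega> u. X u \<omega>) -` ?G \<inter> space M = {\<omega> \<in> space M. (\<lambda>u. X u \<omega>) \<in> ?G}" by auto
  ultimately have "emeasure M {\<omega> \<in> space M. (\<lambda>u. X u \<omega>) \<in> ?G} \<noteq> 0" by auto
  then show ?thesis by (simp add: M.emeasure_eq_measure zero_less_measure_iff)
qed

section \<open>Kernel sums are flat at infinity\<close>

lemma gaussian_gradient_bounds:
  fixes r :: real assumes "0 \<le> r"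
  shows "2 * r * exp (- r\<^sup>2) \<le> 2" "0 < r \<Longrightarrow> 2 * r * exp (- r\<^sup>2) \<le> 2 / r"
proof -
  have le: "r\<^sup>2 * exp (- r\<^sup>2) \<le> 1"
  proof -
    have "r\<^sup>2 \<le> exp (r\<^sup>2)" using exp_ge_add_one_self[of "r\<^sup>2"] by linarith
    then show ?thesis by (simp add: exp_minus divide_inverse[symmetric])
  qed
  show b: "2 * r * exp (- r\<^sup>2) \<le> 2 / r" if "0 < r"
    using le that by (simp add: field_simps power2_eq_square)
  show "2 * r * exp (- r\<^sup>2) \<le> 2"
  proof (cases "r \<le> 1")
    case True
    have "r * exp (- r\<^sup>2) \<le> 1 * 1" using assms True by (intro mult_mono) auto
    then show ?thesis by simp
  next
    case False
    then have "2 / r \<le> 2" by (simp add: divide_le_eq)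
    then show ?thesis using b False by linarith
  qed
qed

text \<open>The gradient of a kernel has norm \<open>2 r exp (- r\<^sup>2)\<close> at distance \<open>r\<close> from its centre.\<close>

lemma kernel_sum_gradient:
  assumes "kernel_sum h"
  shows "\<exists>h'. C1_field h h' \<and> (\<exists>B\<ge>0. \<forall>u. norm (h' u) \<le> B) \<and> (\<forall>e>0. \<exists>\<rho>. \<forall>u. \<rho> \<le> norm u \<longrightarrow> norm (h' u) \<le> e)"
  using assms
proof induction
  case (kernel_sum_base a v)
  define h' where "h' u = (- 2 * a * exp (- (norm (u - v))\<^sup>2)) *\<^sub>R (u - v)" for u
  have "((\<lambda>u. a * exp (- (norm (u - v))\<^sup>2)) has_derivative (\<lambda>k. h' u \<bullet> k)) (at u)" for u
  proof -
    have 1: "((\<lambda>u. u - v) has_derivative (\<lambda>k. k)) (at u)" by (auto intro!: derivative_eq_intros)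
    have "((\<lambda>u. (u - v) \<bullet> (u - v)) has_derivative (\<lambda>k. 2 * ((u - v) \<bullet> k))) (at u)"
      using has_derivative_inner[OF 1 1] by (rule has_derivative_eq_rhs) (auto simp: fun_eq_iff inner_commute)
    then have "((\<lambda>u. - ((u - v) \<bullet> (u - v))) has_derivative (\<lambda>k. - (2 * ((u - v) \<bullet> k)))) (at u)"
      by (rule has_derivative_minus)
    from has_derivative_exp[OF this]
    have "((\<lambda>u. a * exp (- ((u - v) \<bullet> (u - v)))) has_derivative (\<lambda>k. a * (exp (- ((u - v) \<bullet> (u - v))) * - (2 * ((u - v) \<bullet> k))))) (at u)"
      by (intro has_derivative_mult_right) (simp add: mult.commute)
    then show ?thesis unfolding power2_norm_eq_inner
      by (rule has_derivative_eq_rhs) (auto simp: fun_eq_iff h'_def power2_norm_eq_inner)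
  qed
  moreover have "continuous_on UNIV h'" unfolding h'_def by (intro continuous_intros)
  ultimately have C1: "C1_field (\<lambda>u. a * exp (- (norm (u - v))\<^sup>2)) h'" by (simp add: C1_field_def)
  have nh: "norm (h' u) = \<bar>a\<bar> * (2 * norm (u - v) * exp (- (norm (u - v))\<^sup>2))" for u
    by (simp add: h'_def abs_mult)
  have "norm (h' u) \<le> \<bar>a\<bar> * 2" for u
    unfolding nh by (intro mult_left_mono gaussian_gradient_bounds) auto
  then have bd: "\<exists>B\<ge>0. \<forall>u. norm (h' u) \<le> B" by (intro exI[of _ "\<bar>a\<bar> * 2"]) auto
  have "\<exists>\<rho>. \<forall>u. \<rho> \<le> norm u \<longrightarrow> norm (h' u) \<le> e" if e: "0 < e" for e
  proof (rule exI[of _ "norm v + 1 + 2 * \<bar>a\<bar> / e"], intro allI impI)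
    fix u :: "real^3" assume "norm v + 1 + 2 * \<bar>a\<bar> / e \<le> norm u"
    then have r: "1 + 2 * \<bar>a\<bar> / e \<le> norm (u - v)" using norm_triangle_ineq2[of u v] by linarith
    have p: "0 \<le> 2 * \<bar>a\<bar> / e" using e by simp
    have pos: "0 < norm (u - v)" using r p by linarith
    have "norm (h' u) \<le> \<bar>a\<bar> * (2 / norm (u - v))"
      unfolding nh by (intro mult_left_mono gaussian_gradient_bounds(2)) (use pos in auto)
    also have "\<dots> \<le> e"
    proof -
      have "2 * \<bar>a\<bar> / e \<le> norm (u - v)" using r by linarith
      then show ?thesis using e pos by (simp add: field_simps)
    qed
    finally show "norm (h' u) \<le> e" .
  qed
  then show ?case using C1 bd by blast
next
  case (kernel_sum_add E F)
  obtain E' B where E: "C1_field E E'" "0 \<le> B" "\<And>u. norm (E' u) \<le> B"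
    "\<And>e. 0 < e \<Longrightarrow> \<exists>\<rho>. \<forall>u. \<rho> \<le> norm u \<longrightarrow> norm (E' u) \<le> e" using kernel_sum_add.IH(1) by blast
  obtain F' C where F: "C1_field F F'" "0 \<le> C" "\<And>u. norm (F' u) \<le> C"
    "\<And>e. 0 < e \<Longrightarrow> \<exists>\<rho>. \<forall>u. \<rho> \<le> norm u \<longrightarrow> norm (F' u) \<le> e" using kernel_sum_add.IH(2) by blast
  have "C1_field (\<lambda>u. E u + F u) (\<lambda>u. E' u + F' u)"
    using E(1) F(1) unfolding C1_field_def inner_add_left
    by (auto intro: has_derivative_add continuous_on_add)
  moreover have "norm (E' u + F' u) \<le> B + C" for u
    using norm_triangle_ineq[of "E' u" "F' u"] E(3)[of u] F(3)[of u] by linarith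
  then have "\<exists>B\<ge>0. \<forall>u. norm (E' u + F' u) \<le> B" using E(2) F(2) by (intro exI[of _ "B + C"]) auto
  moreover have "\<exists>\<rho>. \<forall>u. \<rho> \<le> norm u \<longrightarrow> norm (E' u + F' u) \<le> e" if e: "0 < e" for e
  proof -
    obtain \<rho>1 \<rho>2 where \<rho>: "\<forall>u. \<rho>1 \<le> norm u \<longrightarrow> norm (E' u) \<le> e / 2" "\<forall>u. \<rho>2 \<le> norm u \<longrightarrow> norm (F' u) \<le> e / 2"
      using E(4)[of "e / 2"] F(4)[of "e / 2"] e by auto
    have "\<forall>u. max \<rho>1 \<rho>2 \<le> norm u \<longrightarrow> norm (E' u + F' u) \<le> e"
    proof (intro allI impI)
      fix u :: "real^3" assume "max \<rho>1 \<rho>2 \<le> norm u"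
      then have "norm (E' u) \<le> e / 2" "norm (F' u) \<le> e / 2" using \<rho> by auto
      then show "norm (E' u + F' u) \<le> e" using norm_triangle_ineq[of "E' u" "F' u"] by linarith
    qed
    then show ?thesis by blast
  qed
  ultimately show ?case by blast
qed

lemma kernel_sum_translate:
  assumes "kernel_sum h" shows "kernel_sum (\<lambda>u. h (u - p))"
  using assms
proof induction
  case (kernel_sum_base a v)
  have "(\<lambda>u. a * exp (- (norm (u - p - v))\<^sup>2)) = (\<lambda>u. a * exp (- (norm (u - (p + v)))\<^sup>2))"
    by (simp add: diff_diff_add)
  then show ?case using kernel_sum.kernel_sum_base[of a "p + v"] by simp
next
  case (kernel_sum_add E F)
  show ?case by (rule kernel_sum.kernel_sum_add[OF kernel_sum_add.IH])
qed

lemma kernel_sum_lipschitz: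
  assumes "kernel_sum h" obtains L where "L-lipschitz_on UNIV h"
proof -
  obtain h' B where "C1_field h h'" "0 \<le> B" "\<And>u. norm (h' u) \<le> B" using kernel_sum_gradient[OF assms] by blast
  then have "B-lipschitz_on UNIV h" by (intro C1_field_lipschitz) auto
  then show ?thesis by (rule that)
qed

lemma kernel_sum_flat_at_infinity:
  assumes "kernel_sum h" "0 < e"
  obtains \<rho> where "\<And>p. \<rho> \<le> norm p \<Longrightarrow> e-lipschitz_on (cball p R) h"
proof -
  obtain h' \<rho> where h: "C1_field h h'" "\<And>u. \<rho> \<le> norm u \<Longrightarrow> norm (h' u) \<le> e"
    using kernel_sum_gradient[OF assms(1)] assms(2) by metis
  show ?thesis
  proof (rule that[of "\<rho> + R"])
    fix p :: "real^3" assume p: "\<rho> + R \<le> norm p"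
    show "e-lipschitz_on (cball p R) h"
    proof (rule C1_field_lipschitz[OF h(1) convex_cball])
      fix z assume "z \<in> cball p R"
      then have "norm (p - z) \<le> R" by (simp add: dist_norm)
      then show "norm (h' z) \<le> e" using p norm_triangle_ineq2[of p "p - z"] by (intro h(2)) simp
    qed (use assms(2) in simp)
  qed
qed

text \<open>The gradient is uniformly continuous on bounded sets.\<close>

lemma kernel_sum_shift_continuous:
  assumes "kernel_sum h" "0 < e"
  obtains r where "0 < r" "\<And>q. norm q \<le> r \<Longrightarrow> e-lipschitz_on (cball 0 R) (\<lambda>u. h (u + q) - h u)"
proof -
  obtain h' where h: "C1_field h h'" using kernel_sum_gradient[OF assms(1)] by blast
  then have c: "continuous_on UNIV h'" by (simp add: C1_field_def)
  have "uniformly_continuous_on (cball 0 (R + 1)) h'"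
    by (intro compact_uniformly_continuous continuous_on_subset[OF c]) auto
  then obtain d where d: "0 < d" "\<And>u v. u \<in> cball 0 (R + 1) \<Longrightarrow> v \<in> cball 0 (R + 1) \<Longrightarrow> dist v u < d \<Longrightarrow> dist (h' v) (h' u) < e"
    using assms(2) unfolding uniformly_continuous_on_def by metis
  show ?thesis
  proof (rule that[of "min 1 (d / 2)"])
    fix q :: "real^3" assume q: "norm q \<le> min 1 (d / 2)"
    have D: "C1_field (\<lambda>u. h (u + q) - h u) (\<lambda>u. h' (u + q) - h' u)"
      using h C1_field_translate[OF h, of q] unfolding C1_field_def inner_diff_left
      by (auto intro: has_derivative_diff continuous_on_diff)
    show "e-lipschitz_on (cball 0 R) (\<lambda>u. h (u + q) - h u)"
    proof (rule C1_field_lipschitz[OF D convex_cball])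
      fix z :: "real^3" assume z: "z \<in> cball 0 R"
      have "z + q \<in> cball 0 (R + 1)" unfolding mem_cball_0 using z q norm_triangle_ineq[of z q] by simp
      moreover have "z \<in> cball 0 (R + 1)" using z by simp
      moreover have "dist (z + q) z < d" using q d(1) by (simp add: dist_norm)
      ultimately have "dist (h' (z + q)) (h' z) < e" by (intro d(2))
      then show "norm (h' (z + q) - h' z) \<le> e" by (simp add: dist_norm)
    qed (use assms(2) in simp)
  qed (use d(1) in simp)
qed

section \<open>Smooth fields along loops\<close>

lemma C1_loop_nth: "C1_loop c c' \<Longrightarrow> C1_loop (\<lambda>s. c s $ i) (\<lambda>s. c' s $ i)"
  unfolding C1_loop_def
  by (auto intro: bounded_linear.has_vector_derivative[OF bounded_linear_vec_nth] continuous_on_component)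

lemma C1_loop_vec:
  fixes c :: "real \<Rightarrow> real^3"
  assumes "\<And>i. C1_loop (\<lambda>s. c s $ i) (\<lambda>s. c' s $ i)" shows "C1_loop c c'"
  unfolding C1_loop_def
proof (intro conjI allI)
  have "continuous_on UNIV (\<lambda>s. \<chi> i. c' s $ i)"
    using assms by (intro continuous_on_vec_lambda) (auto simp: C1_loop_def)
  then show "continuous_on UNIV c'" by simp
  show "c (s + 2 * pi) = c s" for s using assms by (simp add: C1_loop_def vec_eq_iff)
  show "(c has_vector_derivative c' s) (at s)" for s
    unfolding has_vector_derivative_def has_derivative_componentwise_within[of c]
  proof
    fix b :: "real^3" assume "b \<in> Basis"
    then obtain i where b: "b = axis i 1" by (auto simp: Basis_vec_def)
    have "((\<lambda>s. c s $ i) has_derivative (\<lambda>x. x *\<^sub>R (c' s $ i))) (at s)"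
      using assms[of i] by (simp add: C1_loop_def has_vector_derivative_def)
    then show "((\<lambda>x. c x \<bullet> b) has_derivative (\<lambda>x. (x *\<^sub>R c' s) \<bullet> b)) (at s)"
      unfolding b by (simp add: inner_axis)
  qed
qed

lemma C1_loop_lipschitz:
  fixes c :: "real \<Rightarrow> real^3"
  assumes "C1_loop c c'" obtains L where "L-lipschitz_on UNIV c"
proof -
  have "\<exists>B. B-lipschitz_on UNIV (\<lambda>s. c s $ i)" for i
    using C1_loop_lip_small[OF C1_loop_nth[OF assms, of i]] by (auto simp: lip_small_def)
  then obtain B where B: "\<And>i. (B i)-lipschitz_on UNIV (\<lambda>s. c s $ i)" by metis
  have "(Max (range B))-lipschitz_on UNIV (\<lambda>s. c s $ i)" for i
    by (rule lipschitz_on_le[OF B[of i]]) simp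
  from lipschitz_on_vec[OF this] show ?thesis by (rule that)
qed

lemma C1_loop_field:
  assumes F: "C1_field F F'" and y: "C1_loop y y'"
  shows "C1_loop (\<lambda>s. F (y s + p)) (\<lambda>s. F' (y s + p) \<bullet> y' s)"
  unfolding C1_loop_def
proof (intro conjI allI)
  have c: "continuous_on UNIV F'" using F by (simp add: C1_field_def)
  have "continuous_on UNIV (\<lambda>s. F' (y s + p))"
    by (rule continuous_on_compose2[OF c]) (auto intro!: continuous_intros C1_loop_continuous[OF y])
  then show "continuous_on UNIV (\<lambda>s. F' (y s + p) \<bullet> y' s)"
    using y by (intro continuous_on_inner) (auto simp: C1_loop_def)
  show "F (y (s + 2 * pi) + p) = F (y s + p)" for s using y by (simp add: C1_loop_def)
  fix s
  have "((\<lambda>s. y s + p) has_derivative (\<lambda>h. h *\<^sub>R y' s)) (at s)"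
    using y by (auto simp: C1_loop_def has_vector_derivative_def intro!: derivative_eq_intros)
  moreover have "(F has_derivative (\<lambda>h. F' (y s + p) \<bullet> h)) (at (y s + p))"
    using F by (simp add: C1_field_def)
  ultimately have "((\<lambda>s. F (y s + p)) has_derivative (\<lambda>h. F' (y s + p) \<bullet> (h *\<^sub>R y' s))) (at s)"
    by (rule has_derivative_compose)
  then show "((\<lambda>s. F (y s + p)) has_vector_derivative F' (y s + p) \<bullet> y' s) (at s)"
    by (simp add: has_vector_derivative_def)
qed

definition C2_field :: "(real^3 \<Rightarrow> real) \<Rightarrow> bool" where
  "C2_field F \<longleftrightarrow> (\<exists>F'. C1_field F F' \<and> (\<forall>j. \<exists>G. C1_field (\<lambda>u. F' u $ j) G))"

text \<open>The chain rule, applied to each coordinate of the field and once more to each coordinate of its gradient.\<close>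

lemma C2_field_loop:
  assumes F: "\<And>i. C2_field (\<lambda>u. F u $ i)" and y: "C1_loop y y'" and y': "C1_loop y' y''"
  shows "\<exists>c' c''. C1_loop (\<lambda>s. F (y s + p) :: real^3) c' \<and> C1_loop c' c''"
proof -
  have "\<exists>d d'. C1_loop (\<lambda>s. F (y s + p) $ i) d \<and> C1_loop d d'" for i
  proof -
    obtain F' where F': "C1_field (\<lambda>u. F u $ i) F'" "\<And>j. \<exists>G. C1_field (\<lambda>u. F' u $ j) G"
      using F[of i] unfolding C2_field_def by blast
    from F'(2) obtain G where G: "\<And>j. C1_field (\<lambda>u. F' u $ j) (G j)" by metis
    have "C1_loop (\<lambda>s. \<Sum>j\<in>UNIV. F' (y s + p) $ j * y' s $ j)
        (\<lambda>s. \<Sum>j\<in>UNIV. F' (y s + p) $ j * y'' s $ j + (G j (y s + p) \<bullet> y' s) * y' s $ j)"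
      by (intro C1_loop_sum C1_loop_mult C1_loop_field[OF G y] C1_loop_nth[OF y'])
    then have "C1_loop (\<lambda>s. F' (y s + p) \<bullet> y' s)
        (\<lambda>s. \<Sum>j\<in>UNIV. F' (y s + p) $ j * y'' s $ j + (G j (y s + p) \<bullet> y' s) * y' s $ j)"
      by (simp add: inner_vec_def)
    with C1_loop_field[OF F'(1) y, of p] show ?thesis by blast
  qed
  then obtain d d' where d: "\<And>i. C1_loop (\<lambda>s. F (y s + p) $ i) (d i)" "\<And>i. C1_loop (d i) (d' i)" by metis
  have "C1_loop (\<lambda>s. F (y s + p)) (\<lambda>s. \<chi> i. d i s)" by (rule C1_loop_vec) (simp add: d)
  moreover have "C1_loop (\<lambda>s. \<chi> i. d i s) (\<lambda>s. \<chi> i. d' i s)" by (rule C1_loop_vec) (simp add: d)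
  ultimately show ?thesis by blast
qed

lemma linear_coordinates:
  fixes f :: "real^3 \<Rightarrow> real^3"
  assumes "linear f" shows "f h $ i = (\<chi> j. f (axis j 1) $ i) \<bullet> h"
proof -
  have "f h = f (\<Sum>j\<in>UNIV. h $ j *\<^sub>R axis j 1)"
    using basis_expansion[of h] by (simp add: scalar_mult_eq_scaleR)
  also have "\<dots> = (\<Sum>j\<in>UNIV. h $ j *\<^sub>R f (axis j 1))"
    by (simp add: linear_sum[OF assms] linear_scale[OF assms])
  finally show ?thesis by (simp add: inner_vec_def mult.commute)
qed

lemma C_k_1_field:
  fixes F :: "real^3 \<Rightarrow> real^3"
  assumes "C_k (Suc 0) F"
  shows "C1_field (\<lambda>u. F u $ i) (\<lambda>u. \<chi> j. frechet_derivative F (at u) (axis j 1) $ i)"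
  unfolding C1_field_def
proof (intro conjI allI)
  fix u
  have D: "(F has_derivative frechet_derivative F (at u)) (at u)"
    by (rule frechet_derivative_works[THEN iffD1]) (use assms in \<open>simp add: differentiable_on_def\<close>)
  have "((\<lambda>u. F u $ i) has_derivative (\<lambda>h. frechet_derivative F (at u) h $ i)) (at u)"
    by (rule bounded_linear.has_derivative[OF bounded_linear_vec_nth D])
  then show "((\<lambda>u. F u $ i) has_derivative (\<lambda>h. (\<chi> j. frechet_derivative F (at u) (axis j 1) $ i) \<bullet> h)) (at u)"
    by (rule has_derivative_eq_rhs) (rule ext, rule linear_coordinates[OF has_derivative_linear[OF D]])
next
  show "continuous_on UNIV (\<lambda>u. \<chi> j. frechet_derivative F (at u) (axis j 1) $ i)"
    using assms by (intro continuous_on_vec_lambda continuous_on_component) simp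
qed

lemma C_k_2_imp_C_k_1:
  assumes "C_k (Suc (Suc 0)) f"
  shows "C_k (Suc 0) f" "C_k (Suc 0) (\<lambda>x. frechet_derivative f (at x) v)"
proof -
  note C2 = assms[THEN iffD1[OF C_k.simps(2)]]
  note C = conjunct1[OF C2] conjunct2[OF C2, rule_format]
  show "C_k (Suc 0) (\<lambda>x. frechet_derivative f (at x) v)" by (rule C(2))
  have "continuous_on UNIV (\<lambda>x. frechet_derivative f (at x) v)" for v
    using conjunct1[OF C(2)[of v, THEN iffD1[OF C_k.simps(2)]]] by (rule differentiable_imp_continuous_on)
  then show "C_k (Suc 0) f" using C(1) by simp
qed

lemma smooth_C2_field:
  fixes F :: "real^3 \<Rightarrow> real^3"
  assumes "smooth F" shows "C2_field (\<lambda>u. F u $ i)"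
proof -
  have C2: "C_k (Suc (Suc 0)) F" using assms unfolding smooth_def by (rule spec)
  show ?thesis unfolding C2_field_def
  proof (intro exI conjI allI)
    show "C1_field (\<lambda>u. F u $ i) (\<lambda>u. \<chi> j. frechet_derivative F (at u) (axis j 1) $ i)"
      by (rule C_k_1_field[OF C_k_2_imp_C_k_1(1)[OF C2]])
    fix j
    show "C1_field (\<lambda>u. (\<chi> j. frechet_derivative F (at u) (axis j 1) $ i) $ j)
        (\<lambda>u. \<chi> k. frechet_derivative (\<lambda>x. frechet_derivative F (at x) (axis j 1)) (at u) (axis k 1) $ i)"
      using C_k_1_field[OF C_k_2_imp_C_k_1(2)[OF C2, of "axis j 1"], of i] by simp
  qed
qed

text \<open>Next to a stationary point the derivative is at most \<open>L\<close> times the mesh, so the grid interval that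
contains the point sees an increment of second order in the mesh.\<close>

lemma stationary_point_small_increment:
  fixes c :: "real \<Rightarrow> real^3"
  assumes c: "C1_loop c c'" and L: "L-lipschitz_on UNIV c'" and zero: "c' s0 = 0" and N: "0 < N"
  shows "\<exists>k<N. norm (c (2 * pi * real (Suc k) / real N) - c (2 * pi * real k / real N)) \<le> L * (2 * pi / real N)\<^sup>2"
proof -
  define h where "h = 2 * pi / real N"
  have h: "0 < h" using N by (simp add: h_def)
  define i where "i = \<lfloor>s0 / (2 * pi)\<rfloor>"
  define s where "s = s0 + 2 * pi * of_int (- i)"
  have "of_int i \<le> s0 / (2 * pi)" "s0 / (2 * pi) < of_int i + 1" unfolding i_def by linarith+
  then have s: "0 \<le> s" "s < 2 * pi" by (simp_all add: s_def field_simps)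
  have s': "c' s = 0" unfolding s_def periodic_shift_int[of c', OF C1_loop_derivative_periodic[OF c]] by (rule zero)
  define k where "k = nat \<lfloor>s / h\<rfloor>"
  have "real k \<le> s / h" "s / h < real k + 1" unfolding k_def using s h by (simp_all add: of_nat_nat)
  then have k: "real k * h \<le> s" "s \<le> (real k + 1) * h" using h by (simp_all add: field_simps)
  have "real k * h < 2 * pi" using k s by linarith
  then have "real k < real N" using N by (simp add: h_def field_simps)
  then have kN: "k < N" by simp
  have "norm (c ((real k + 1) * h) - c (real k * h) - ((real k + 1) * h - real k * h) *\<^sub>R c' s)
      \<le> norm ((real k + 1) * h - real k * h) * (L * h)"
  proof (rule vector_differentiable_bound_linearization[where S = "{real k * h..(real k + 1) * h}"])
    show "(c has_vector_derivative c' x) (at x within {real k * h..(real k + 1) * h})" for x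
      by (rule has_vector_derivative_at_within) (use c in \<open>simp add: C1_loop_def\<close>)
    show "closed_segment (real k * h) ((real k + 1) * h) \<subseteq> {real k * h..(real k + 1) * h}"
      using h by (simp add: closed_segment_eq_real_ivl)
    show "s \<in> {real k * h..(real k + 1) * h}" using k by simp
    fix x assume x: "x \<in> {real k * h..(real k + 1) * h}"
    have "norm (c' x - c' s) \<le> L * \<bar>x - s\<bar>"
      using lipschitz_onD[OF L, of x s] by (simp add: dist_norm)
    also have "\<dots> \<le> L * h"
      using x k lipschitz_on_nonneg[OF L] by (intro mult_left_mono) (auto simp: abs_le_iff algebra_simps)
    finally show "norm (c' x - c' s) \<le> L * h" .
  qed
  moreover have "(real k + 1) * h - real k * h = h" by (simp add: algebra_simps)
  ultimately have le: "norm (c ((real k + 1) * h) - c (real k * h)) \<le> h * (L * h)" using s' h by simp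
  have eqs: "2 * pi * real (Suc k) / real N = (real k + 1) * h" "2 * pi * real k / real N = real k * h"
    by (simp_all add: h_def)
  have "h * (L * h) = L * h\<^sup>2" by (simp add: power2_eq_square)
  with le have "norm (c (2 * pi * real (Suc k) / real N) - c (2 * pi * real k / real N)) \<le> L * (2 * pi / real N)\<^sup>2"
    unfolding eqs h_def[symmetric] by simp
  then show ?thesis using kN by (intro exI conjI)
qed

section \<open>The field along a randomly shifted loop\<close>

lemma std_normal_small_ball:
  assumes "0 \<le> c" shows "measure std_normal_distribution {-c..c} \<le> c"
proof -
  interpret S: prob_space std_normal_distribution using real_dist_normal_dist by (simp add: real_distribution_def)
  have d: "std_normal_density x \<le> 1 / 2" for x :: real
  proof -
    have "2 \<le> sqrt (2 * pi)" by (rule real_le_rsqrt) (use pi_ge_two in simp)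
    then have "1 / sqrt (2 * pi) \<le> 1 / 2" by (intro divide_left_mono) auto
    moreover have "1 / sqrt (2 * pi) * exp (- x\<^sup>2 / 2) \<le> 1 / sqrt (2 * pi) * 1"
      by (intro mult_left_mono) auto
    moreover have "std_normal_density x = 1 / sqrt (2 * pi) * exp (- x\<^sup>2 / 2)" by (simp add: normal_density_def)
    ultimately show ?thesis by linarith
  qed
  have "emeasure std_normal_distribution {-c..c} = (\<integral>\<^sup>+x. ennreal (std_normal_density x) * indicator {-c..c} x \<partial>lborel)"
    by (simp add: emeasure_density)
  also have "\<dots> \<le> (\<integral>\<^sup>+x. ennreal (1/2) * indicator {-c..c} x \<partial>lborel)"
    by (intro nn_integral_mono mult_right_mono ennreal_leI d) auto
  also have "\<dots> = ennreal (1/2) * emeasure lborel {-c..c}" by (intro nn_integral_cmult_indicator) simp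
  also have "\<dots> = ennreal (1/2) * ennreal (2 * c)" using assms by simp
  also have "\<dots> = ennreal (1/2 * (2 * c))" by (rule ennreal_mult[symmetric]) (use assms in auto)
  also have "\<dots> = ennreal c" by simp
  finally show ?thesis using assms by (simp add: S.emeasure_eq_measure)
qed

lemma gaussian_small_ball:
  assumes M: "prob_space M" and X: "centered_gaussian M X" and \<rho>: "0 < \<rho>" "\<rho>\<^sup>2 \<le> (\<integral>\<omega>. (X \<omega>)\<^sup>2 \<partial>M)" and \<delta>: "0 \<le> \<delta>"
  shows "measure M {\<omega> \<in> space M. \<bar>X \<omega>\<bar> \<le> \<delta>} \<le> \<delta> / \<rho>"
proof -
  define s where "s = sqrt (\<integral>\<omega>. (X \<omega>)\<^sup>2 \<partial>M)"
  have s: "\<rho> \<le> s" unfolding s_def by (rule real_le_rsqrt[OF \<rho>(2)])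
  have s0: "0 < s" using s \<rho>(1) by simp
  note [measurable] = centered_gaussian_facts(1)[OF M X]
  have law: "distr M borel X = distr std_normal_distribution borel (\<lambda>z. s * z)"
    unfolding s_def by (rule centered_gaussian_facts(3)[OF M X])
  have "measure M {\<omega> \<in> space M. \<bar>X \<omega>\<bar> \<le> \<delta>} = measure (distr M borel X) {-\<delta>..\<delta>}"
    by (subst measure_distr) (auto intro!: arg_cong[where f = "measure M"])
  also have "\<dots> = measure std_normal_distribution {-(\<delta> / s)..\<delta> / s}"
    unfolding law using s0 by (subst measure_distr) (auto intro!: arg_cong[where f = "measure std_normal_distribution"] simp: field_simps)
  also have "\<dots> \<le> \<delta> / s" by (rule std_normal_small_ball) (use \<delta> s0 in simp)
  also have "\<dots> \<le> \<delta> / \<rho>" using \<delta> s \<rho>(1) by (intro divide_left_mono) auto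
  finally show ?thesis .
qed

text \<open>The field is evaluated at a random point by rounding the point to the lattice with mesh \<open>1 / (n + 1)\<close>:
on each of countably many events the argument is then deterministic.\<close>

definition lattice_index :: "nat \<Rightarrow> real^3 \<Rightarrow> int^3" where
  "lattice_index n x = (\<chi> i. \<lfloor>real (Suc n) * x $ i\<rfloor>)"

definition lattice_point :: "nat \<Rightarrow> int^3 \<Rightarrow> real^3" where
  "lattice_point n k = (\<chi> i. of_int (k $ i) / real (Suc n))"

lemma lattice_point_tendsto: "(\<lambda>n. lattice_point n (lattice_index n x)) \<longlonglongrightarrow> x"
proof (rule vec_tendstoI)
  fix i
  show "(\<lambda>n. lattice_point n (lattice_index n x) $ i) \<longlonglongrightarrow> x $ i"
  proof (rule LIM_zero_cancel, rule Lim_null_comparison[OF always_eventually], intro allI)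
    show "(\<lambda>n. 1 / real (Suc n)) \<longlonglongrightarrow> 0" by (rule lim_1_over_n[THEN LIMSEQ_Suc])
    fix n
    have "\<bar>of_int \<lfloor>real (Suc n) * x $ i\<rfloor> - real (Suc n) * x $ i\<bar> \<le> 1" by linarith
    then have "\<bar>of_int \<lfloor>real (Suc n) * x $ i\<rfloor> - real (Suc n) * x $ i\<bar> / real (Suc n) \<le> 1 / real (Suc n)"
      by (intro divide_right_mono) auto
    moreover have "lattice_point n (lattice_index n x) $ i - x $ i = (of_int \<lfloor>real (Suc n) * x $ i\<rfloor> - real (Suc n) * x $ i) / real (Suc n)"
      by (simp add: lattice_point_def lattice_index_def diff_divide_distrib del: of_nat_Suc)
    ultimately show "norm (lattice_point n (lattice_index n x) $ i - x $ i) \<le> 1 / real (Suc n)" by (simp add: abs_divide del: of_nat_Suc)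
  qed
qed

lemma measurable_vec_nth_borel[measurable (raw)]:
  fixes f :: "'a \<Rightarrow> real^'n"
  assumes "f \<in> borel_measurable M" shows "(\<lambda>x. f x $ i) \<in> borel_measurable M"
  by (rule borel_measurable_continuous_on[OF _ assms, of "\<lambda>v. v $ i"]) (intro continuous_intros)

lemma borel_measurable_vecI:
  fixes f :: "'w \<Rightarrow> real^3"
  assumes "\<And>i. (\<lambda>\<omega>. f \<omega> $ i) \<in> borel_measurable M" shows "f \<in> borel_measurable M"
proof (subst borel_measurable_euclidean_space, intro ballI)
  fix b :: "real^3" assume "b \<in> Basis"
  then obtain i where b: "b = axis i 1" by (auto simp: Basis_vec_def)
  show "(\<lambda>\<omega>. f \<omega> \<bullet> b) \<in> borel_measurable M" unfolding b inner_axis using assms by simp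
qed

lemma measurable_lattice_index[measurable]: "lattice_index n \<in> measurable borel (count_space UNIV)"
proof (rule measurable_count_space_eq2_countable[THEN iffD2], intro conjI ballI)
  fix k :: "int^3"
  have "lattice_index n -` {k} \<inter> space borel = (\<Inter>i\<in>UNIV. {x \<in> space borel. \<lfloor>real (Suc n) * x $ i\<rfloor> = k $ i})"
    by (auto simp: lattice_index_def vec_eq_iff)
  also have "\<dots> \<in> sets borel" by (intro sets.finite_INT) auto
  finally show "lattice_index n -` {k} \<inter> space borel \<in> sets borel" .
qed auto

text \<open>A Gaussian field with smooth paths and an independent random shift. The parameter \<open>W\<close> is the value of the
Wiener process at time \<open>1\<close>, or \<open>0\<close> for the loop at time \<open>0\<close>. Smoothness holds for every \<open>\<omega>\<close>, as can be achieved by a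
modification (\<open>random_shift_modification\<close>).\<close>

locale random_shift = prob_space M for M :: "'w measure" +
  fixes \<xi> :: "real^3 \<Rightarrow> 'w \<Rightarrow> real^3" and W :: "'w \<Rightarrow> real^3"
  assumes coord: "\<And>i. centered_gaussian_process M (\<lambda>u \<omega>. \<xi> u \<omega> $ i)"
    and cov: "\<And>i u v. (\<integral>\<omega>. \<xi> u \<omega> $ i * \<xi> v \<omega> $ i \<partial>M) = exp (- (norm (u - v))\<^sup>2)"
    and indep_coord: "\<And>A. (\<And>i. A i \<in> sets (Pi\<^sub>M UNIV (\<lambda>_. borel))) \<Longrightarrow>
      prob {\<omega> \<in> space M. \<forall>i. (\<lambda>u. \<xi> u \<omega> $ i) \<in> A i} = (\<Prod>i\<in>UNIV. prob {\<omega> \<in> space M. (\<lambda>u. \<xi> u \<omega> $ i) \<in> A i})"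
    and paths: "\<And>\<omega>. smooth (\<lambda>u. \<xi> u \<omega>)"
    and W[measurable]: "W \<in> borel_measurable M"
    and indep: "\<And>B T. B \<in> sets borel \<Longrightarrow> T \<in> sets (Pi\<^sub>M UNIV (\<lambda>_. borel)) \<Longrightarrow>
      prob ({\<omega> \<in> space M. W \<omega> \<in> B} \<inter> {\<omega> \<in> space M. (\<lambda>u. \<xi> u \<omega>) \<in> T}) =
      prob {\<omega> \<in> space M. W \<omega> \<in> B} * prob {\<omega> \<in> space M. (\<lambda>u. \<xi> u \<omega>) \<in> T}"
begin

lemma meas_coord[measurable]: "(\<lambda>\<omega>. \<xi> u \<omega> $ i) \<in> borel_measurable M"
  by (rule centered_gaussian_facts(1)[OF prob_space_axioms centered_gaussian_processD(2)[OF coord]])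

lemma meas_field[measurable]: "\<xi> u \<in> borel_measurable M"
  by (rule borel_measurable_vecI[OF meas_coord])

lemma coord_C2: "C2_field (\<lambda>u. \<xi> u \<omega> $ i)"
  by (rule smooth_C2_field[OF paths])

lemma coord_C1: "\<exists>F'. C1_field (\<lambda>u. \<xi> u \<omega> $ i) F'"
  using coord_C2[of \<omega> i] unfolding C2_field_def by blast

lemma coord_continuous: "continuous_on S (\<lambda>u. \<xi> u \<omega> $ i)"
  using coord_C1[of \<omega> i] C1_field_continuous by blast

lemma field_continuous: "continuous_on S (\<lambda>u. \<xi> u \<omega>)"
proof -
  have "continuous_on S (\<lambda>u. \<chi> i. \<xi> u \<omega> $ i)" by (intro continuous_on_vec_lambda coord_continuous)
  then show ?thesis by simp
qed

text \<open>Each coordinate of the increment is Gaussian with variance \<open>2 (1 - exp (- \<bar>a - b\<bar>\<^sup>2)) \<ge> \<rho>\<^sup>2\<close>, and the three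
coordinates are independent.\<close>

lemma increment_small_ball:
  assumes \<rho>: "0 < \<rho>" "\<rho> \<le> 1" "\<rho> \<le> norm (a - b)" and \<delta>: "0 \<le> \<delta>"
  shows "prob {\<omega> \<in> space M. \<forall>i. \<bar>\<xi> a \<omega> $ i - \<xi> b \<omega> $ i\<bar> \<le> \<delta>} \<le> (\<delta> / \<rho>) ^ 3"
proof -
  have ab: "a \<noteq> b" using \<rho> by auto
  have one: "prob {\<omega> \<in> space M. \<bar>\<xi> a \<omega> $ i - \<xi> b \<omega> $ i\<bar> \<le> \<delta>} \<le> \<delta> / \<rho>" for i
  proof (rule gaussian_small_ball[OF prob_space_axioms _ \<rho>(1) _ \<delta>])
    have "centered_gaussian M (\<lambda>\<omega>. \<Sum>u\<in>{a, b}. (if u = a then 1 else - 1) * \<xi> u \<omega> $ i)"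
      by (rule centered_gaussian_processD(1)[OF coord]) simp
    then show "centered_gaussian M (\<lambda>\<omega>. \<xi> a \<omega> $ i - \<xi> b \<omega> $ i)" using ab by simp
    have sq: "integrable M (\<lambda>\<omega>. (\<xi> u \<omega> $ i)\<^sup>2)" for u
      by (rule centered_gaussian_facts(2)[OF prob_space_axioms centered_gaussian_processD(2)[OF coord]])
    have pr: "integrable M (\<lambda>\<omega>. \<xi> u \<omega> $ i * \<xi> v \<omega> $ i)" for u v
      by (rule integrable_mult_of_squares[OF meas_coord meas_coord sq sq])
    have "(\<integral>\<omega>. (\<xi> a \<omega> $ i - \<xi> b \<omega> $ i)\<^sup>2 \<partial>M) =
       (\<integral>\<omega>. \<xi> a \<omega> $ i * \<xi> a \<omega> $ i - 2 * (\<xi> a \<omega> $ i * \<xi> b \<omega> $ i) + \<xi> b \<omega> $ i * \<xi> b \<omega> $ i \<partial>M)"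
      by (simp add: power2_eq_square algebra_simps)
    also have "\<dots> = 2 - 2 * exp (- (norm (a - b))\<^sup>2)" using pr by (simp add: cov)
    finally have var: "(\<integral>\<omega>. (\<xi> a \<omega> $ i - \<xi> b \<omega> $ i)\<^sup>2 \<partial>M) = 2 - 2 * exp (- (norm (a - b))\<^sup>2)" .
    have "exp (- (norm (a - b))\<^sup>2) \<le> exp (- \<rho>\<^sup>2)" using \<rho> by (simp add: power_mono)
    also have "\<dots> \<le> 1 / (1 + \<rho>\<^sup>2)"
      unfolding exp_minus inverse_eq_divide using exp_ge_add_one_self[of "\<rho>\<^sup>2"]
      by (intro divide_left_mono) (auto intro!: mult_pos_pos add_pos_nonneg)
    also have "\<dots> \<le> 1 - \<rho>\<^sup>2 / 2"
    proof -
      have "\<rho>\<^sup>2 \<le> 1" using \<rho> by (simp add: power_le_one)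
      then have "0 \<le> \<rho>\<^sup>2 * (1 - \<rho>\<^sup>2)" by simp
      then have "1 \<le> (1 - \<rho>\<^sup>2 / 2) * (1 + \<rho>\<^sup>2)" by (simp add: algebra_simps)
      then show ?thesis by (subst divide_le_eq) (simp add: add_pos_nonneg)
    qed
    finally show "\<rho>\<^sup>2 \<le> (\<integral>\<omega>. (\<xi> a \<omega> $ i - \<xi> b \<omega> $ i)\<^sup>2 \<partial>M)" unfolding var by simp
  qed
  let ?A = "{F :: real^3 \<Rightarrow> real. \<bar>F a - F b\<bar> \<le> \<delta>}"
  have A: "?A \<in> sets (Pi\<^sub>M UNIV (\<lambda>_. borel))"
  proof -
    have "{F \<in> space (Pi\<^sub>M UNIV (\<lambda>_. borel)). \<bar>F a - F b\<bar> \<le> \<delta>} \<in> sets (Pi\<^sub>M UNIV (\<lambda>_. borel :: real measure))" by measurable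
    then show ?thesis by (simp add: space_PiM)
  qed
  have "prob {\<omega> \<in> space M. \<forall>i. \<bar>\<xi> a \<omega> $ i - \<xi> b \<omega> $ i\<bar> \<le> \<delta>} = (\<Prod>i\<in>(UNIV::3 set). prob {\<omega> \<in> space M. \<bar>\<xi> a \<omega> $ i - \<xi> b \<omega> $ i\<bar> \<le> \<delta>})"
    using indep_coord[of "\<lambda>_. ?A"] A by simp
  also have "\<dots> \<le> (\<Prod>i\<in>(UNIV::3 set). \<delta> / \<rho>)" by (intro prod_mono) (use one in auto)
  finally show ?thesis by simp
qed

lemma meas_lattice_shift[measurable]:
  "(\<lambda>\<omega>. \<xi> (a + lattice_point n (lattice_index n (W \<omega>))) \<omega>) \<in> borel_measurable M"
  by (rule measurable_compose_countable[where g = "\<lambda>\<omega>. lattice_index n (W \<omega>)" and f = "\<lambda>k \<omega>. \<xi> (a + lattice_point n k) \<omega>"]) measurable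

lemma lattice_shift_tendsto: "(\<lambda>n. \<xi> (a + lattice_point n (lattice_index n (W \<omega>))) \<omega>) \<longlonglongrightarrow> \<xi> (a + W \<omega>) \<omega>"
proof (rule isCont_tendsto_compose[where g = "\<lambda>u. \<xi> u \<omega>"])
  show "isCont (\<lambda>u. \<xi> u \<omega>) (a + W \<omega>)" using field_continuous[of UNIV \<omega>] by (simp add: continuous_on_eq_continuous_at)
  show "(\<lambda>n. a + lattice_point n (lattice_index n (W \<omega>))) \<longlonglongrightarrow> a + W \<omega>"
    by (intro tendsto_add tendsto_const lattice_point_tendsto)
qed

lemma meas_shift[measurable]: "(\<lambda>\<omega>. \<xi> (a + W \<omega>) \<omega>) \<in> borel_measurable M"
  by (rule borel_measurable_LIMSEQ_metric[OF meas_lattice_shift lattice_shift_tendsto])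

text \<open>Condition on the lattice point next to the shift: the bound for deterministic points applies to each of the
countably many events. Then let the mesh tend to zero; passing from \<open>\<delta>\<close> to \<open>2 \<delta>\<close> leaves room for the limit.\<close>

lemma shifted_increment_small_ball:
  assumes \<rho>: "0 < \<rho>" "\<rho> \<le> 1" "\<rho> \<le> norm (a - b)" and \<delta>: "0 < \<delta>"
  shows "prob {\<omega> \<in> space M. \<forall>i. \<bar>\<xi> (a + W \<omega>) \<omega> $ i - \<xi> (b + W \<omega>) \<omega> $ i\<bar> \<le> \<delta>} \<le> (2 * \<delta> / \<rho>) ^ 3"
proof -
  define C where "C = (2 * \<delta> / \<rho>) ^ 3"
  have C0: "0 \<le> C" using \<delta> \<rho> by (simp add: C_def)
  define p where "p n \<omega> = lattice_point n (lattice_index n (W \<omega>))" for n \<omega>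
  have [measurable]: "(\<lambda>\<omega>. \<xi> (a + p n \<omega>) \<omega>) \<in> borel_measurable M" for a n unfolding p_def by measurable
  define E where "E n = {\<omega> \<in> space M. \<forall>i. \<bar>\<xi> (a + p n \<omega>) \<omega> $ i - \<xi> (b + p n \<omega>) \<omega> $ i\<bar> \<le> 2 * \<delta>}" for n
  have [measurable]: "E n \<in> sets M" for n unfolding E_def by measurable
  have En: "emeasure M (E n) \<le> ennreal C" for n
  proof -
    define T where "T k = {F :: real^3 \<Rightarrow> real^3. \<forall>i. \<bar>F (a + lattice_point n k) $ i - F (b + lattice_point n k) $ i\<bar> \<le> 2 * \<delta>}" for k
    have T: "T k \<in> sets (Pi\<^sub>M UNIV (\<lambda>_. borel))" for k
    proof -
      have "{F \<in> space (Pi\<^sub>M UNIV (\<lambda>_. borel)). \<forall>i. \<bar>F (a + lattice_point n k) $ i - F (b + lattice_point n k) $ i\<bar> \<le> 2 * \<delta>}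
         \<in> sets (Pi\<^sub>M UNIV (\<lambda>_. borel :: (real^3) measure))" by measurable
      then show ?thesis by (simp add: space_PiM T_def)
    qed
    define B where "B k = lattice_index n -` {k}" for k
    have B: "B k \<in> sets borel" for k
      using measurable_sets[OF measurable_lattice_index, of "{k}" n] by (simp add: B_def)
    define Q where "Q k = {\<omega> \<in> space M. W \<omega> \<in> B k}" for k
    have Q[measurable]: "Q k \<in> sets M" for k unfolding Q_def using B[of k] by measurable
    have disj: "disjoint_family_on Q UNIV" by (auto simp: disjoint_family_on_def Q_def B_def)
    define G where "G k = Q k \<inter> {\<omega> \<in> space M. (\<lambda>u. \<xi> u \<omega>) \<in> T k}" for k
    have mG: "G k \<in> sets M" for k unfolding G_def T_def by measurable
    have GC: "emeasure M (G k) \<le> ennreal C * emeasure M (Q k)" for k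
    proof -
      have "prob (G k) = prob (Q k) * prob {\<omega> \<in> space M. (\<lambda>u. \<xi> u \<omega>) \<in> T k}"
        unfolding G_def Q_def by (rule indep[OF B T])
      also have "\<dots> \<le> prob (Q k) * C"
      proof (rule mult_left_mono)
        show "prob {\<omega> \<in> space M. (\<lambda>u. \<xi> u \<omega>) \<in> T k} \<le> C"
          unfolding T_def C_def mem_Collect_eq by (rule increment_small_ball) (use \<rho> \<delta> in auto)
      qed simp
      finally show ?thesis using C0 by (simp add: emeasure_eq_measure ennreal_mult[symmetric] mult.commute)
    qed
    have "E n = (\<Union>k\<in>UNIV. G k)" by (auto simp: E_def G_def Q_def B_def T_def p_def)
    then have "emeasure M (E n) = (\<integral>\<^sup>+k. emeasure M (G k) \<partial>count_space UNIV)"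
      using disj mG by (simp only:) (rule emeasure_UN_countable, auto simp: disjoint_family_on_def G_def)
    also have "\<dots> \<le> (\<integral>\<^sup>+k. ennreal C * emeasure M (Q k) \<partial>count_space UNIV)"
      by (intro nn_integral_mono GC)
    also have "\<dots> = ennreal C * (\<integral>\<^sup>+k. emeasure M (Q k) \<partial>count_space UNIV)"
      by (rule nn_integral_cmult) simp
    also have "(\<integral>\<^sup>+k. emeasure M (Q k) \<partial>count_space UNIV) = emeasure M (\<Union>k\<in>UNIV. Q k)"
      by (rule emeasure_UN_countable[symmetric, OF Q _ disj]) simp
    also have "\<dots> \<le> 1" by (rule emeasure_le_1)
    finally show ?thesis by (simp add: mult_left_mono)
  qed
  define H where "H n = (\<Inter>k\<in>{n..}. E k)" for n
  have mH: "H n \<in> sets M" for n unfolding H_def by (intro sets.countable_INT) auto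
  have "{\<omega> \<in> space M. \<forall>i. \<bar>\<xi> (a + W \<omega>) \<omega> $ i - \<xi> (b + W \<omega>) \<omega> $ i\<bar> \<le> \<delta>} \<subseteq> (\<Union>n. H n)"
  proof
    fix \<omega> assume w: "\<omega> \<in> {\<omega> \<in> space M. \<forall>i. \<bar>\<xi> (a + W \<omega>) \<omega> $ i - \<xi> (b + W \<omega>) \<omega> $ i\<bar> \<le> \<delta>}"
    have "\<forall>\<^sub>F n in sequentially. \<bar>\<xi> (a + p n \<omega>) \<omega> $ i - \<xi> (b + p n \<omega>) \<omega> $ i\<bar> < 2 * \<delta>" for i
    proof (rule order_tendstoD(2))
      show "(\<lambda>n. \<bar>\<xi> (a + p n \<omega>) \<omega> $ i - \<xi> (b + p n \<omega>) \<omega> $ i\<bar>) \<longlonglongrightarrow> \<bar>\<xi> (a + W \<omega>) \<omega> $ i - \<xi> (b + W \<omega>) \<omega> $ i\<bar>"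
        unfolding p_def by (intro tendsto_rabs tendsto_diff tendsto_vec_nth lattice_shift_tendsto)
      have "\<bar>\<xi> (a + W \<omega>) \<omega> $ i - \<xi> (b + W \<omega>) \<omega> $ i\<bar> \<le> \<delta>" using w by simp
      then show "\<bar>\<xi> (a + W \<omega>) \<omega> $ i - \<xi> (b + W \<omega>) \<omega> $ i\<bar> < 2 * \<delta>" using \<delta> by linarith
    qed
    then have "\<forall>\<^sub>F n in sequentially. \<forall>i. \<bar>\<xi> (a + p n \<omega>) \<omega> $ i - \<xi> (b + p n \<omega>) \<omega> $ i\<bar> < 2 * \<delta>"
      by (rule eventually_all_finite)
    then obtain N where "\<And>n. N \<le> n \<Longrightarrow> \<forall>i. \<bar>\<xi> (a + p n \<omega>) \<omega> $ i - \<xi> (b + p n \<omega>) \<omega> $ i\<bar> < 2 * \<delta>"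
      unfolding eventually_sequentially by blast
    then have "\<omega> \<in> H N" using w by (auto simp: H_def E_def less_imp_le)
    then show "\<omega> \<in> (\<Union>n. H n)" by blast
  qed
  then have "emeasure M {\<omega> \<in> space M. \<forall>i. \<bar>\<xi> (a + W \<omega>) \<omega> $ i - \<xi> (b + W \<omega>) \<omega> $ i\<bar> \<le> \<delta>} \<le> emeasure M (\<Union>n. H n)"
    using mH by (intro emeasure_mono) auto
  also have "\<dots> = (SUP n. emeasure M (H n))"
    by (rule SUP_emeasure_incseq[symmetric]) (use mH in \<open>auto simp: incseq_def H_def\<close>)
  also have "\<dots> \<le> ennreal C"
  proof (rule SUP_least)
    fix n have "emeasure M (H n) \<le> emeasure M (E n)" by (rule emeasure_mono) (auto simp: H_def)
    then show "emeasure M (H n) \<le> ennreal C" using En[of n] order_trans by blast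
  qed
  finally show ?thesis using C0 by (simp add: emeasure_eq_measure C_def)
qed

end

context random_shift
begin

text \<open>On a grid with \<open>N\<close> intervals, a stationary point forces one increment to be of order \<open>N\<^sup>-\<^sup>2\<close> although its standard
deviation is of order \<open>N\<^sup>-\<^sup>1\<close>. In three independent coordinates this has probability of order \<open>N\<^sup>-\<^sup>3\<close>, and
the sum over the \<open>N\<close> intervals tends to zero.\<close>

lemma AE_immersed:
  assumes y: "C1_loop y y'" and y': "C1_loop y' y''" and m: "0 < m" "bilipschitz_loop m y"
  shows "AE \<omega> in M. \<forall>c'. C1_loop (\<lambda>s. \<xi> (y s + W \<omega>) \<omega>) c' \<longrightarrow> (\<forall>s. c' s \<noteq> 0)"
proof -
  define z where "z N k = y (2 * pi * real k / real N)" for N k :: nat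
  define inc where "inc N k \<omega> = \<xi> (z N (Suc k) + W \<omega>) \<omega> - \<xi> (z N k + W \<omega>) \<omega>" for N k \<omega>
  define \<delta> where "\<delta> n N = real (Suc n) * (2 * pi / real N)\<^sup>2" for n N :: nat
  define Bk where "Bk n N k = {\<omega> \<in> space M. \<forall>i. \<bar>inc N k \<omega> $ i\<bar> \<le> \<delta> n N}" for n N k
  define B where "B n N = (\<Union>k<N. Bk n N k)" for n N
  have mBk[measurable]: "Bk n N k \<in> sets M" for n N k unfolding Bk_def inc_def by measurable
  have mB[measurable]: "B n N \<in> sets M" for n N unfolding B_def by measurable
  define C where "C n = (4 * pi * real (Suc n) / m) ^ 3" for n
  obtain N0 :: nat where N0: "2 * pi * m < real N0" using reals_Archimedean2 by blast
  have bound: "prob (B n N) \<le> C n * (1 / real N)\<^sup>2" if N: "max N0 2 \<le> N" for n N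
  proof -
    have N2: "2 \<le> N" "N0 \<le> N" using N by auto
    have N1: "0 < real N" using N2 by simp
    define h where "h = 2 * pi / real N"
    have h: "0 < h" "h \<le> pi" using N2 N1 by (auto simp: h_def divide_le_eq mult.commute[of pi])
    have mh: "0 < m * h" "m * h \<le> 1"
    proof -
      show "0 < m * h" using m h by simp
      have "2 * pi * m \<le> real N" using N0 N2(2) by (meson less_imp_le of_nat_le_iff order_trans)
      then show "m * h \<le> 1" using N1 by (simp add: h_def divide_le_eq mult_ac)
    qed
    have "prob (Bk n N k) \<le> (2 * \<delta> n N / (m * h)) ^ 3" for k
    proof -
      have "m * \<bar>2 * pi * real (Suc k) / real N - 2 * pi * real k / real N\<bar> \<le> norm (z N (Suc k) - z N k)"
      proof -
        have "\<bar>2 * pi * real (Suc k) / real N - 2 * pi * real k / real N\<bar> \<le> pi"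
          using h by (simp add: h_def diff_divide_distrib[symmetric] right_diff_distrib[symmetric])
        then show ?thesis using m(2) unfolding bilipschitz_loop_def z_def by blast
      qed
      moreover have "2 * pi * real (Suc k) / real N - 2 * pi * real k / real N = h"
        by (simp add: h_def diff_divide_distrib[symmetric] right_diff_distrib[symmetric])
      ultimately have le: "m * h \<le> norm (z N (Suc k) - z N k)" using h by simp
      have "0 < \<delta> n N" using N1 by (simp add: \<delta>_def)
      from shifted_increment_small_ball[OF mh le this]
      show ?thesis by (simp add: Bk_def inc_def)
    qed
    then have "(\<Sum>k<N. prob (Bk n N k)) \<le> (\<Sum>k<N. (2 * \<delta> n N / (m * h)) ^ 3)" by (intro sum_mono)
    moreover have "prob (B n N) \<le> (\<Sum>k<N. prob (Bk n N k))"
      unfolding B_def by (rule finite_measure_subadditive_finite) auto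
    ultimately have "prob (B n N) \<le> real N * (2 * \<delta> n N / (m * h)) ^ 3" by simp
    also have "2 * \<delta> n N / (m * h) = 4 * pi * real (Suc n) / m * (1 / real N)"
      using N1 m by (simp add: \<delta>_def h_def power2_eq_square field_simps)
    also have "real N * (4 * pi * real (Suc n) / m * (1 / real N)) ^ 3 = C n * (1 / real N)\<^sup>2"
    proof -
      have "real N * (q * (1 / real N)) ^ 3 = q ^ 3 * (1 / real N)\<^sup>2" for q
        using N1 by (simp add: power_mult_distrib power2_eq_square power3_eq_cube)
      then show ?thesis by (simp only: C_def)
    qed
    finally show ?thesis .
  qed
  have "AE \<omega> in M. \<exists>N>0. \<omega> \<notin> B n N" for n
  proof -
    define I where "I = (\<Inter>N\<in>{max N0 2..}. B n N)"
    have mI: "I \<in> sets M" unfolding I_def by (intro sets.countable_INT) auto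
    have le: "prob I \<le> C n * (1 / real N)\<^sup>2" if "max N0 2 \<le> N" for N
      by (rule order_trans[OF finite_measure_mono bound[OF that]]) (use that in \<open>auto simp: I_def\<close>)
    have lim: "(\<lambda>N. C n * (1 / real N)\<^sup>2) \<longlonglongrightarrow> C n * 0\<^sup>2"
      by (intro tendsto_mult tendsto_const tendsto_power lim_1_over_n)
    have "prob I \<le> C n * 0\<^sup>2"
      by (rule LIMSEQ_le_const[OF lim]) (intro exI[of _ "max N0 2"] allI impI le)
    then have "I \<in> null_sets M" using mI by (auto simp: null_sets_def emeasure_eq_measure measure_nonneg antisym)
    then have "AE \<omega> in M. \<omega> \<notin> I" by (rule AE_not_in)
    then show ?thesis
    proof eventually_elim
      fix \<omega> assume "\<omega> \<notin> I"
      then obtain N where "max N0 2 \<le> N" "\<omega> \<notin> B n N" by (auto simp: I_def)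
      then show "\<exists>N>0. \<omega> \<notin> B n N" by (intro exI[of _ N]) auto
    qed
  qed
  then have "AE \<omega> in M. \<forall>n. \<exists>N>0. \<omega> \<notin> B n N" by (simp add: AE_all_countable)
  then show ?thesis
    using AE_space
  proof eventually_elim
    fix \<omega> assume w: "\<forall>n. \<exists>N>0. \<omega> \<notin> B n N" and sp: "\<omega> \<in> space M"
    let ?c = "\<lambda>s. \<xi> (y s + W \<omega>) \<omega>"
    obtain d d' where d: "C1_loop ?c d" "C1_loop d d'"
      using C2_field_loop[of "\<lambda>u. \<xi> u \<omega>", OF coord_C2 y y'] by blast
    obtain L where L: "L-lipschitz_on UNIV d" using C1_loop_lipschitz[OF d(2)] .
    obtain n :: nat where n: "L < real n" using reals_Archimedean2 by blast
    obtain N where N: "0 < N" "\<omega> \<notin> B n N" using w by blast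
    have nz: "d s \<noteq> 0" for s
    proof
      assume "d s = 0"
      from stationary_point_small_increment[OF d(1) L this N(1)]
      obtain k where k: "k < N" "norm (inc N k \<omega>) \<le> L * (2 * pi / real N)\<^sup>2"
        by (auto simp: inc_def z_def)
      have "L * (2 * pi / real N)\<^sup>2 \<le> \<delta> n N" unfolding \<delta>_def using n by (intro mult_right_mono) auto
      then have "\<bar>inc N k \<omega> $ i\<bar> \<le> \<delta> n N" for i
        using k(2) component_le_norm_cart[of "inc N k \<omega>" i] by linarith
      then have "\<omega> \<in> B n N" using sp k(1) by (auto simp: B_def Bk_def)
      then show False using N(2) by blast
    qed
    show "\<forall>c'. C1_loop ?c c' \<longrightarrow> (\<forall>s. c' s \<noteq> 0)"
    proof (intro allI impI)
      fix c' s assume "C1_loop ?c c'"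
      then have "c' s = d s"
        using d(1) unfolding C1_loop_def by (intro vector_derivative_unique_at[of ?c]) auto
      then show "c' s \<noteq> 0" using nz by simp
    qed
  qed
qed

text \<open>Call a cell of \<open>C1_fields_separable\<close> good if every continuous field in it maps the loop to a loop of type \<open>G\<close>. The event contains the countable union
of the good cells. If it occurs and the loop is immersed, then the loop is bi-Lipschitz, and by
stability every sufficiently small cell around the field is good. Hence the event and the union differ
only within the null event of \<open>AE_immersed\<close>.\<close>

lemma has_type_measurable:
  assumes y: "C1_loop y y'" and y': "C1_loop y' y''" and m: "0 < m" "bilipschitz_loop m y"
  shows "{\<omega> \<in> space M. has_type (\<lambda>s. \<xi> (y s + W \<omega>) \<omega>) G} \<in> sets (completion M)"
proof -
  have yper: "y (s + 2 * pi) = y s" for s using y by (simp add: C1_loop_def)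
  obtain R where R: "0 \<le> R" "\<And>s. norm (y s) \<le> R"
    using periodic_bounded[of y, OF C1_loop_continuous[OF y] yper] by blast
  obtain L where L: "L-lipschitz_on UNIV y" using C1_loop_lipschitz[OF y] .
  have L0: "0 \<le> L" using L by (rule lipschitz_on_nonneg)
  define cells where "cells k V \<longleftrightarrow> (\<forall>n :: nat. V n \<in> sets (Pi\<^sub>M UNIV (\<lambda>_. borel))) \<and>
    (\<forall>F F'. C1_field F F' \<longrightarrow> (\<exists>n. F \<in> V n)) \<and>
    (\<forall>n F G. F \<in> V n \<longrightarrow> G \<in> V n \<longrightarrow> continuous_on UNIV F \<longrightarrow> continuous_on UNIV G \<longrightarrow>
       (1 / real (Suc k))-lipschitz_on (cball 0 R) (\<lambda>u. F u - G u))"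
    for k and V :: "nat \<Rightarrow> (real^3 \<Rightarrow> real) set"
  have "\<exists>V. cells k V" for k
  proof -
    have pos: "0 < 1 / real (Suc k)" by simp
    show ?thesis
    proof (rule C1_fields_separable[OF pos R(1)])
      fix V :: "nat \<Rightarrow> (real^3 \<Rightarrow> real) set" assume V: "\<And>n. V n \<in> sets (Pi\<^sub>M UNIV (\<lambda>_. borel))"
        "\<And>F F'. C1_field F F' \<Longrightarrow> \<exists>n. F \<in> V n"
        "\<And>n F G. F \<in> V n \<Longrightarrow> G \<in> V n \<Longrightarrow> continuous_on UNIV F \<Longrightarrow> continuous_on UNIV G \<Longrightarrow>
          (1 / real (Suc k))-lipschitz_on (cball 0 R) (\<lambda>u. F u - G u) \<and> \<bar>F 0 - G 0\<bar> \<le> 1 / real (Suc k)"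
    have "cells k V"
      unfolding cells_def
    proof (intro conjI allI impI)
      fix n F G assume "F \<in> V n" "G \<in> V n" "continuous_on UNIV F" "continuous_on UNIV G"
      from conjunct1[OF V(3)[OF this]] show "(1 / real (Suc k))-lipschitz_on (cball 0 R) (\<lambda>u. F u - G u)" .
    qed (fact V(1), fact V(2))
      then show "\<exists>V. cells k V" by (rule exI[of "cells k" V])
    qed
  qed
  then have "\<forall>k. \<exists>V. cells k V" by (rule allI)
  from choice[OF this] obtain V where V: "\<forall>k. cells k (V k)" by (elim exE)
  have cV: "cells k (V k)" for k by (rule spec[OF V])
  note V = cV[unfolded cells_def, THEN conjunct1, rule_format]
    cV[unfolded cells_def, THEN conjunct2, THEN conjunct1, rule_format]
    cV[unfolded cells_def, THEN conjunct2, THEN conjunct2, rule_format]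
  let ?F = "\<lambda>\<omega> u. \<xi> (u + W \<omega>) \<omega>"
  have Fm: "(\<lambda>\<omega> u. ?F \<omega> u $ i) \<in> measurable M (Pi\<^sub>M UNIV (\<lambda>_. borel))" for i
    by (auto intro!: measurable_PiM_single')
  define S where "S k n = {\<omega> \<in> space M. \<forall>i. (\<lambda>u. ?F \<omega> u $ i) \<in> V k (n i)}" for k and n :: "3 \<Rightarrow> nat"
  have S: "S k n \<in> sets M" for k n
  proof -
    have "S k n = (\<Inter>i\<in>UNIV. (\<lambda>\<omega> u. ?F \<omega> u $ i) -` V k (n i) \<inter> space M)" by (auto simp: S_def)
    also have "\<dots> \<in> sets M" by (intro sets.finite_INT measurable_sets[OF Fm V(1)]) auto
    finally show ?thesis .
  qed
  define good where "good = {(k, n :: 3 \<Rightarrow> nat). \<forall>F :: real^3 \<Rightarrow> real^3. continuous_on UNIV F \<longrightarrow> (\<forall>i. (\<lambda>u. F u $ i) \<in> V k (n i)) \<longrightarrow> has_type (\<lambda>s. F (y s)) G}"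
  define E where "E = {\<omega> \<in> space M. has_type (\<lambda>s. ?F \<omega> (y s)) G}"
  \<comment> \<open>the union of the good cells, pulled back to the probability space\<close>
  define E0 where "E0 = (\<Union>(k, n)\<in>good. S k n)"
  have mE0: "E0 \<in> sets M" unfolding E0_def using S by (intro sets.countable_UN') auto
  have Fc: "continuous_on UNIV (?F \<omega>)" for \<omega>
    by (rule continuous_on_compose2[OF field_continuous[of UNIV]]) (auto intro: continuous_intros)
  have sub: "E0 \<subseteq> E"
  proof
    fix \<omega> assume "\<omega> \<in> E0"
    then obtain k n where kn: "(k, n) \<in> good" "\<omega> \<in> S k n" by (auto simp: E0_def)
    have "has_type (\<lambda>s. ?F \<omega> (y s)) G" using kn Fc[of \<omega>] unfolding good_def S_def by blast
    then show "\<omega> \<in> E" using kn(2) by (simp add: E_def S_def)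
  qed
  obtain N where N: "N \<in> null_sets M" "{\<omega> \<in> space M. \<not> (\<forall>c'. C1_loop (\<lambda>s. ?F \<omega> (y s)) c' \<longrightarrow> (\<forall>s. c' s \<noteq> 0))} \<subseteq> N"
    using AE_immersed[OF y y' m] by (auto elim!: AE_E)
  have diff: "E - E0 \<subseteq> N"
  proof
    fix \<omega> assume w: "\<omega> \<in> E - E0"
    show "\<omega> \<in> N"
    proof (rule ccontr)
      assume "\<omega> \<notin> N"
      then have imm: "\<And>c' s. C1_loop (\<lambda>s. ?F \<omega> (y s)) c' \<Longrightarrow> c' s \<noteq> 0" using N(2) w by (auto simp: E_def)
      obtain d d' where d: "C1_loop (\<lambda>s. ?F \<omega> (y s)) d"
        using C2_field_loop[of "\<lambda>u. \<xi> u \<omega>", OF coord_C2 y y', of "W \<omega>"] by blast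
      have ht: "has_type (\<lambda>s. ?F \<omega> (y s)) G" using w by (simp add: E_def)
      obtain m' where m': "0 < m'" "bilipschitz_loop m' (\<lambda>s. ?F \<omega> (y s))"
        using immersed_loop_bilipschitz[OF d imm[OF d]] ht by (auto simp: has_type_def)
      obtain k :: nat where k: "12 * L / m' < real k" using reals_Archimedean2 by blast
      have small: "4 * (3 * (1 / real (Suc k) * L)) < m'"
      proof -
        have "12 * L < real k * m'" using k m'(1) by (simp add: divide_less_eq)
        also have "\<dots> < real (Suc k) * m'" using m'(1) by simp
        finally show ?thesis by (simp add: divide_less_eq mult.commute)
      qed
      have "\<exists>n. (\<lambda>u. ?F \<omega> u $ i) \<in> V k n" for i
      proof -
        obtain F' where "C1_field (\<lambda>u. \<xi> u \<omega> $ i) F'" using coord_C1 by blast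
        then have "C1_field (\<lambda>u. ?F \<omega> u $ i) (\<lambda>u. F' (u + W \<omega>))" by (rule C1_field_translate)
        then show ?thesis by (rule V(2))
      qed
      then obtain n where n: "\<And>i. (\<lambda>u. ?F \<omega> u $ i) \<in> V k (n i)" by metis
      have "(k, n) \<in> good"
        unfolding good_def
      proof (clarify)
        fix F :: "real^3 \<Rightarrow> real^3" assume F: "continuous_on UNIV F" "\<forall>i. (\<lambda>u. F u $ i) \<in> V k (n i)"
        have "(1 / real (Suc k) * L)-lipschitz_on UNIV (\<lambda>s. (F (y s) - ?F \<omega> (y s)) $ i)" for i
        proof (rule lipschitz_onI)
          fix s s' :: real
          have lip: "(1 / real (Suc k))-lipschitz_on (cball 0 R) (\<lambda>u. F u $ i - ?F \<omega> u $ i)"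
            using F(2) n by (intro V(3)[of _ k "n i"] continuous_on_component F(1) Fc) auto
          have "dist (F (y s) $ i - ?F \<omega> (y s) $ i) (F (y s') $ i - ?F \<omega> (y s') $ i) \<le> 1 / real (Suc k) * dist (y s) (y s')"
            using R(2) by (intro lipschitz_onD[OF lip]) auto
          also have "\<dots> \<le> 1 / real (Suc k) * (L * dist s s')"
            using lipschitz_onD[OF L, of s s'] by (intro mult_left_mono) auto
          finally show "dist ((F (y s) - ?F \<omega> (y s)) $ i) ((F (y s') - ?F \<omega> (y s')) $ i) \<le> 1 / real (Suc k) * L * dist s s'"
            by (simp add: mult.assoc)
        qed (use L0 in simp)
        then have close: "(3 * (1 / real (Suc k) * L))-lipschitz_on UNIV (\<lambda>s. F (y s) - ?F \<omega> (y s))"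
          by (rule lipschitz_on_vec)
        show "has_type (\<lambda>s. F (y s)) G"
          by (rule has_type_stable[OF m'(2,1) _ close small]) (use ht yper in \<open>auto simp: has_type_def\<close>)
      qed
      then have "\<omega> \<in> E0" using n w by (auto simp: E0_def S_def E_def)
      then show False using w by blast
    qed
  qed
  have "E \<in> sets (completion M)"
    by (rule sets_completionI[of E E0 "E - E0" N]) (use mE0 N diff sub in auto)
  then show ?thesis unfolding E_def .
qed

end

section \<open>Two loops at once\<close>

lemma lipschitz_on_compose_loop:
  assumes "e-lipschitz_on S f" "L-lipschitz_on UNIV y" "\<And>s. y s \<in> S"
  shows "(e * L)-lipschitz_on UNIV (\<lambda>s. f (y s))"
  by (rule lipschitz_on_compose2[OF assms(2)]) (rule lipschitz_on_subset[OF assms(1)], use assms(3) in auto)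

text \<open>Choose kernel sums \<open>h1\<close> and \<open>h2\<close> that approximate \<open>g\<close> along \<open>y\<close> and \<open>k\<close> along \<open>z\<close>, and take \<open>h1 + h2 (\<cdot> - p)\<close>.
For \<open>p\<close> far away, \<open>h2 (\<cdot> - p)\<close> is flat near \<open>y\<close> and \<open>h1\<close> is flat near \<open>z + q\<close>. The shift \<open>q\<close> may vary in a ball around \<open>p\<close>, because
\<open>h2\<close> is uniformly \<open>C\<^sup>1\<close>.\<close>

lemma two_loop_target:
  assumes y: "C1_loop y y'" "\<And>s. y' s \<noteq> 0" "no_self_intersections y"
    and z: "C1_loop z z'" "\<And>s. z' s \<noteq> 0" "no_self_intersections z"
    and g: "C1_loop g g'" and k: "C1_loop k k'" and e: "0 < e"
  obtains h :: "3 \<Rightarrow> real^3 \<Rightarrow> real" and p r R d where "\<And>i. kernel_sum (h i)" "0 < r" "0 < d"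
    "\<And>F q. (\<And>i. d-lipschitz_on (ball 0 R) (\<lambda>u. F u $ i - h i u)) \<Longrightarrow> norm (q - p) < r \<Longrightarrow>
      e-lipschitz_on UNIV (\<lambda>s. F (y s) - g s) \<and> e-lipschitz_on UNIV (\<lambda>s. F (z s + q) - k s)"
proof -
  define \<kappa> where "\<kappa> = e / 3"
  have \<kappa>: "0 < \<kappa> / 4" using e by (simp add: \<kappa>_def)
  have per: "y (s + 2 * pi) = y s" "z (s + 2 * pi) = z s" for s using y z by (simp_all add: C1_loop_def)
  obtain By where By: "0 \<le> By" "\<And>s. norm (y s) \<le> By"
    using periodic_bounded[of y, OF C1_loop_continuous[OF y(1)] per(1)] by blast
  obtain Bz where Bz: "0 \<le> Bz" "\<And>s. norm (z s) \<le> Bz"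
    using periodic_bounded[of z, OF C1_loop_continuous[OF z(1)] per(2)] by blast
  define B where "B = max By Bz"
  have B: "0 \<le> B" "norm (y s) \<le> B" "norm (z s) \<le> B" for s
    using By Bz by (auto simp: B_def le_max_iff_disj)
  obtain Ly where Ly: "Ly-lipschitz_on UNIV y" using C1_loop_lipschitz[OF y(1)] .
  obtain Lz where Lz: "Lz-lipschitz_on UNIV z" using C1_loop_lipschitz[OF z(1)] .
  define L where "L = 1 + max Ly Lz"
  have L: "0 < L" using lipschitz_on_nonneg[OF Ly] by (simp add: L_def add_pos_nonneg le_max_iff_disj)
  have Ly: "L-lipschitz_on UNIV y" by (rule lipschitz_on_le[OF Ly]) (simp add: L_def)
  have Lz: "L-lipschitz_on UNIV z" by (rule lipschitz_on_le[OF Lz]) (simp add: L_def)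
  have Lshift: "L-lipschitz_on UNIV (\<lambda>s. f s + q)" if "L-lipschitz_on UNIV f" for f :: "real \<Rightarrow> real^3" and q
    using lipschitz_on_add[OF that lipschitz_on_constant[of UNIV q]] by simp
  define \<epsilon> where "\<epsilon> = \<kappa> / 4 / L"
  have \<epsilon>: "0 < \<epsilon>" "\<epsilon> * L = \<kappa> / 4" using \<kappa> L by (simp_all add: \<epsilon>_def)
  have "\<exists>h. kernel_sum h \<and> (\<kappa> / 4)-lipschitz_on UNIV (\<lambda>s. h (y s) - g s $ i)" for i
    using kernel_sums_dense[OF y C1_loop_nth[OF g] \<kappa>] by metis
  then obtain h1 where h1: "\<And>i. kernel_sum (h1 i)" "\<And>i. (\<kappa> / 4)-lipschitz_on UNIV (\<lambda>s. h1 i (y s) - g s $ i)" by metis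
  have "\<exists>h. kernel_sum h \<and> (\<kappa> / 4)-lipschitz_on UNIV (\<lambda>s. h (z s) - k s $ i)" for i
    using kernel_sums_dense[OF z C1_loop_nth[OF k] \<kappa>] by metis
  then obtain h2 where h2: "\<And>i. kernel_sum (h2 i)" "\<And>i. (\<kappa> / 4)-lipschitz_on UNIV (\<lambda>s. h2 i (z s) - k s $ i)" by metis
  have "\<exists>\<rho>. \<forall>p. \<rho> \<le> norm p \<longrightarrow> \<epsilon>-lipschitz_on (cball p B) (h1 i)" for i
    using kernel_sum_flat_at_infinity[OF h1(1) \<epsilon>(1), of B i] by metis
  then obtain \<rho>1 where \<rho>1: "\<And>i p. \<rho>1 i \<le> norm p \<Longrightarrow> \<epsilon>-lipschitz_on (cball p B) (h1 i)" by metis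
  have "\<exists>\<rho>. \<forall>p. \<rho> \<le> norm p \<longrightarrow> \<epsilon>-lipschitz_on (cball p B) (h2 i)" for i
    using kernel_sum_flat_at_infinity[OF h2(1) \<epsilon>(1), of B i] by metis
  then obtain \<rho>2 where \<rho>2: "\<And>i p. \<rho>2 i \<le> norm p \<Longrightarrow> \<epsilon>-lipschitz_on (cball p B) (h2 i)" by metis
  have "\<exists>r>0. \<forall>q. norm q \<le> r \<longrightarrow> \<epsilon>-lipschitz_on (cball 0 B) (\<lambda>u. h2 i (u + q) - h2 i u)" for i
    using kernel_sum_shift_continuous[OF h2(1) \<epsilon>(1), of B i] by metis
  then obtain r0 where r0: "\<And>i. 0 < r0 i" "\<And>i q. norm q \<le> r0 i \<Longrightarrow> \<epsilon>-lipschitz_on (cball 0 B) (\<lambda>u. h2 i (u + q) - h2 i u)" by metis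
  define \<rho> where "\<rho> = Max (range \<rho>1 \<union> range \<rho>2)"
  have \<rho>: "\<rho>1 i \<le> \<rho>" "\<rho>2 i \<le> \<rho>" for i unfolding \<rho>_def by (intro Max_ge; simp)+
  define r where "r = min 1 (Min (range r0))"
  have r: "0 < r" "r \<le> 1" "r \<le> r0 i" for i
  proof -
    show "0 < r" using r0(1) by (simp add: r_def)
    show "r \<le> 1" by (simp add: r_def)
    have "Min (range r0) \<le> r0 i" by (rule Min_le) auto
    then show "r \<le> r0 i" by (simp add: r_def min.coboundedI2)
  qed
  \<comment> \<open>any vector of this length would do\<close>
  define p :: "real^3" where "p = (\<bar>\<rho>\<bar> + 1) *\<^sub>R axis 1 1"
  have p: "norm p = \<bar>\<rho>\<bar> + 1" by (simp add: p_def)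
  define h where "h i u = h1 i u + h2 i (u - p)" for i u
  define R where "R = B + \<bar>\<rho>\<bar> + 3"
  show ?thesis
  proof (rule that[of h r \<epsilon> R p])
    show "kernel_sum (h i)" for i
      unfolding h_def by (intro kernel_sum_add h1(1) kernel_sum_translate h2(1))
    show "0 < r" by (rule r(1))
    show "0 < \<epsilon>" by (rule \<epsilon>(1))
    fix F :: "real^3 \<Rightarrow> real^3" and q :: "real^3"
    assume F: "\<And>i. \<epsilon>-lipschitz_on (ball 0 R) (\<lambda>u. F u $ i - h i u)" and q: "norm (q - p) < r"
    have nq: "norm q \<le> \<bar>\<rho>\<bar> + 2" "\<bar>\<rho>\<bar> \<le> norm q"
      using norm_triangle_ineq2[of q p] norm_triangle_ineq3[of q p] q r(2) p by (auto simp: abs_le_iff)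
    have "\<kappa>-lipschitz_on UNIV (\<lambda>s. (F (y s) - g s) $ i)" for i
    proof -
      have 1: "(\<epsilon> * L)-lipschitz_on UNIV (\<lambda>s. F (y s) $ i - h i (y s))"
      proof (rule lipschitz_on_compose_loop[OF F Ly])
        show "y s \<in> ball 0 R" for s using B(2)[of s] by (simp add: R_def)
      qed
      have 2: "(\<epsilon> * L)-lipschitz_on UNIV (\<lambda>s. h2 i (y s + - p))"
      proof (rule lipschitz_on_compose_loop[OF \<rho>2 Lshift[OF Ly]])
        show "\<rho>2 i \<le> norm (- p)" using \<rho>(2)[of i] p by simp
        show "y s + - p \<in> cball (- p) B" for s using B(2)[of s] by (simp add: dist_norm)
      qed
      have "(\<epsilon> * L + (\<epsilon> * L + \<kappa> / 4))-lipschitz_on UNIV (\<lambda>s. (F (y s) $ i - h i (y s)) + (h2 i (y s + - p) + (h1 i (y s) - g s $ i)))"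
        by (intro lipschitz_on_add 1 2 h1(2))
      then have "(\<epsilon> * L + (\<epsilon> * L + \<kappa> / 4))-lipschitz_on UNIV (\<lambda>s. (F (y s) - g s) $ i)"
        by (simp add: h_def)
      then show ?thesis by (rule lipschitz_on_le) (use \<epsilon>(2) \<kappa> in linarith)
    qed
    then have a: "(3 * \<kappa>)-lipschitz_on UNIV (\<lambda>s. F (y s) - g s)" by (rule lipschitz_on_vec)
    have "\<kappa>-lipschitz_on UNIV (\<lambda>s. (F (z s + q) - k s) $ i)" for i
    proof -
      have 1: "(\<epsilon> * L)-lipschitz_on UNIV (\<lambda>s. F (z s + q) $ i - h i (z s + q))"
      proof (rule lipschitz_on_compose_loop[OF F Lshift[OF Lz]])
        show "z s + q \<in> ball 0 R" for s
          using B(3)[of s] nq(1) norm_triangle_ineq[of "z s" q] by (simp add: R_def)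
      qed
      have 2: "(\<epsilon> * L)-lipschitz_on UNIV (\<lambda>s. h1 i (z s + q))"
      proof (rule lipschitz_on_compose_loop[OF \<rho>1 Lshift[OF Lz]])
        show "\<rho>1 i \<le> norm q" using \<rho>(1)[of i] nq(2) by linarith
        show "z s + q \<in> cball q B" for s using B(3)[of s] by (simp add: dist_norm)
      qed
      have 3: "(\<epsilon> * L)-lipschitz_on UNIV (\<lambda>s. h2 i (z s + (q - p)) - h2 i (z s))"
      proof (rule lipschitz_on_compose_loop[OF r0(2) Lz])
        show "norm (q - p) \<le> r0 i" using q r(3)[of i] by linarith
        show "z s \<in> cball 0 B" for s using B(3)[of s] by simp
      qed
      have "(\<epsilon> * L + (\<epsilon> * L + (\<epsilon> * L + \<kappa> / 4)))-lipschitz_on UNIV (\<lambda>s. (F (z s + q) $ i - h i (z s + q)) +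
          (h1 i (z s + q) + ((h2 i (z s + (q - p)) - h2 i (z s)) + (h2 i (z s) - k s $ i))))"
        by (intro lipschitz_on_add 1 2 3 h2(2))
      then have "(\<epsilon> * L + (\<epsilon> * L + (\<epsilon> * L + \<kappa> / 4)))-lipschitz_on UNIV (\<lambda>s. (F (z s + q) - k s) $ i)"
        by (simp add: h_def add_diff_eq)
      then show ?thesis by (rule lipschitz_on_le) (use \<epsilon>(2) in linarith)
    qed
    then have b: "(3 * \<kappa>)-lipschitz_on UNIV (\<lambda>s. F (z s + q) - k s)" by (rule lipschitz_on_vec)
    show "e-lipschitz_on UNIV (\<lambda>s. F (y s) - g s) \<and> e-lipschitz_on UNIV (\<lambda>s. F (z s + q) - k s)"
      using a b by (simp add: \<kappa>_def)
  qed
qed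

context random_shift
begin

lemma target_probability:
  fixes R :: real
  assumes h: "\<And>i. kernel_sum (h i)" and d: "0 < d" and D: "countable D"
    and WB: "0 < prob {\<omega> \<in> space M. W \<omega> \<in> ball p r}"
  defines "E \<equiv> {\<omega> \<in> space M. W \<omega> \<in> ball p r} \<inter> {\<omega> \<in> space M. \<forall>i. (\<lambda>u. \<xi> u \<omega> $ i) \<in> lip_near D R d (h i)}"
  shows "E \<in> sets M" "0 < prob E"
proof -
  define T where "T = {F :: real^3 \<Rightarrow> real^3. \<forall>i. (\<lambda>u. F u $ i) \<in> lip_near D R d (h i)}"
  have cm: "(\<lambda>F u. F u $ i) \<in> measurable (Pi\<^sub>M UNIV (\<lambda>_. borel :: (real^3) measure)) (Pi\<^sub>M UNIV (\<lambda>_ :: real^3. borel :: real measure))" for i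
    by (auto intro!: measurable_PiM_single')
  have T: "T \<in> sets (Pi\<^sub>M UNIV (\<lambda>_. borel))"
  proof -
    have "T = (\<Inter>i\<in>UNIV. (\<lambda>F u. F u $ i) -` lip_near D R d (h i) \<inter> space (Pi\<^sub>M UNIV (\<lambda>_. borel :: (real^3) measure)))"
      by (auto simp: T_def space_PiM)
    also have "\<dots> \<in> sets (Pi\<^sub>M UNIV (\<lambda>_. borel))"
      by (intro sets.finite_INT measurable_sets[OF cm sets_lip_near[OF D]]) auto
    finally show ?thesis .
  qed
  have fm: "(\<lambda>\<omega> u. \<xi> u \<omega>) \<in> measurable M (Pi\<^sub>M UNIV (\<lambda>_. borel))"
    by (auto intro!: measurable_PiM_single')
  have E: "E = {\<omega> \<in> space M. W \<omega> \<in> ball p r} \<inter> {\<omega> \<in> space M. (\<lambda>u. \<xi> u \<omega>) \<in> T}"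
    by (simp add: E_def T_def)
  have "{\<omega> \<in> space M. (\<lambda>u. \<xi> u \<omega>) \<in> T} = (\<lambda>\<omega> u. \<xi> u \<omega>) -` T \<inter> space M" by auto
  then have "{\<omega> \<in> space M. (\<lambda>u. \<xi> u \<omega>) \<in> T} \<in> sets M" using measurable_sets[OF fm T] by simp
  moreover have "{\<omega> \<in> space M. W \<omega> \<in> ball p r} = W -` ball p r \<inter> space M" by auto
  then have "{\<omega> \<in> space M. W \<omega> \<in> ball p r} \<in> sets M" using measurable_sets[OF W, of "ball p r"] by simp
  ultimately show "E \<in> sets M" unfolding E by (intro sets.Int)
  have "0 < prob {\<omega> \<in> space M. (\<lambda>u. \<xi> u \<omega> $ i) \<in> lip_near D R d (h i)}" for i
  proof -
    obtain V a where V: "finite V" "h i = (\<lambda>u. \<Sum>v\<in>V. a v * exp (- (norm (u - v))\<^sup>2))"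
      using kernel_sum_finite_sum[OF h] .
    obtain L where "L-lipschitz_on UNIV (h i)" using kernel_sum_lipschitz[OF h] .
    then show ?thesis
      by (intro gaussian_field_support[OF prob_space_axioms coord coord_C1 V(1) _ _ d D]) (simp_all add: V(2) cov)
  qed
  then have "0 < (\<Prod>i\<in>(UNIV::3 set). prob {\<omega> \<in> space M. (\<lambda>u. \<xi> u \<omega> $ i) \<in> lip_near D R d (h i)})"
    by (intro prod_pos) auto
  also have "\<dots> = prob {\<omega> \<in> space M. \<forall>i. (\<lambda>u. \<xi> u \<omega> $ i) \<in> lip_near D R d (h i)}"
    by (rule indep_coord[symmetric]) (rule sets_lip_near[OF D])
  finally have "0 < prob {\<omega> \<in> space M. (\<lambda>u. \<xi> u \<omega>) \<in> T}" by (simp add: T_def)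
  moreover have "prob E = prob {\<omega> \<in> space M. W \<omega> \<in> ball p r} * prob {\<omega> \<in> space M. (\<lambda>u. \<xi> u \<omega>) \<in> T}"
    unfolding E by (rule indep[OF _ T]) simp
  ultimately show "0 < prob E" using WB by simp
qed

end

section \<open>The flow is a random rigid motion\<close>

lemma bounded_linear_matrix_vector_left: "bounded_linear (\<lambda>M :: real^'n^'m. M *v z)"
  by (rule linear_conv_bounded_linear[THEN iffD1])
     (rule linearI, simp_all add: matrix_vector_mult_add_rdistrib scaleR_matrix_vector_assoc)

lemma orthogonal_matrix_norm:
  fixes U :: "real^'n^'n"
  assumes "orthogonal_matrix U" shows "norm (U *v z) = norm z"
proof -
  have "orthogonal_transformation ((*v) U)"
    using assms by (simp add: orthogonal_transformation_matrix)
  then show ?thesis by (rule orthogonal_transformation_norm)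
qed

text \<open>Differentiate \<open>\<bar>U\<^sub>t z\<bar>\<^sup>2 = \<bar>z\<bar>\<^sup>2\<close> at \<open>t = 0\<close>.\<close>

lemma orthogonal_group_generator_skew:
  fixes A :: "real^3^3"
  assumes U0: "U 0 = mat 1"
    and U': "\<And>t. 0 \<le> t \<Longrightarrow> (U has_vector_derivative A ** U t) (at t within {0..})"
    and orth: "\<And>t. 0 \<le> t \<Longrightarrow> orthogonal_matrix (U t)"
  shows "(A *v z) \<bullet> z = 0"
proof -
  have "((\<lambda>t. U t *v z) has_vector_derivative (A ** U 0) *v z) (at 0 within {0..})"
    by (rule bounded_linear.has_vector_derivative[OF bounded_linear_matrix_vector_left U']) simp
  then have "((\<lambda>t. U t *v z) has_vector_derivative A *v z) (at 0 within {0..})"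
    by (simp add: U0)
  then have "((\<lambda>t. U t *v z) has_derivative (\<lambda>h. h *\<^sub>R (A *v z))) (at 0 within {0..})"
    by (simp add: has_vector_derivative_def)
  from has_derivative_inner[OF this this]
  have 1: "((\<lambda>t. (U t *v z) \<bullet> (U t *v z)) has_vector_derivative 2 * ((A *v z) \<bullet> z)) (at 0 within {0..})"
    unfolding has_vector_derivative_def
    by (rule has_derivative_eq_rhs) (auto simp: U0 fun_eq_iff inner_commute algebra_simps)
  have 2: "((\<lambda>t. (U t *v z) \<bullet> (U t *v z)) has_vector_derivative 0) (at 0 within {0..})"
  proof (rule has_vector_derivative_transform[of 0 "{0..}" _ "\<lambda>_. z \<bullet> z"])
    show "(U t *v z) \<bullet> (U t *v z) = z \<bullet> z" if "t \<in> {0..}" for t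
      using orthogonal_matrix_norm[OF orth, of t z] that by (simp add: norm_eq)
  qed auto
  have "at (0::real) within {0..} \<noteq> bot"
    by (simp add: at_within_Ici_at_right)
  then have "2 * ((A *v z) \<bullet> z) = 0"
    using vector_derivative_unique_within[OF _ 1 2] by auto
  then show ?thesis by simp
qed

text \<open>For a skew matrix the norm of a solution is constant, so only the zero solution starts at \<open>0\<close>.\<close>

lemma skew_linear_ode_unique:
  fixes A :: "real^'n^'n" and d :: "real \<Rightarrow> real^'n"
  assumes skew: "\<And>z. (A *v z) \<bullet> z = 0"
    and cont: "continuous_on {0..} d"
    and eq: "\<And>t. 0 \<le> t \<Longrightarrow> ((\<lambda>r. A *v d r) has_integral d t) {0..t}"
    and t: "0 \<le> t"
  shows "d t = 0"
proof -
  have cA: "continuous_on {0..t} (\<lambda>r. A *v d r)"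
    by (intro continuous_on_compose2[OF linear_continuous_on[OF matrix_vector_mul_bounded_linear] , of _ d UNIV]
          continuous_on_subset[OF cont]) auto
  have D: "(d has_vector_derivative A *v d r) (at r within {0..t})" if r: "r \<in> {0..t}" for r
  proof (rule has_vector_derivative_transform[OF r])
    show "((\<lambda>u. integral {0..u} (\<lambda>r. A *v d r)) has_vector_derivative A *v d r) (at r within {0..t})"
      by (rule integral_has_vector_derivative[OF cA r])
    show "d s = integral {0..s} (\<lambda>r. A *v d r)" if "s \<in> {0..t}" for s
      using integral_unique[OF eq[of s]] that by simp
  qed
  have N: "((\<lambda>r. d r \<bullet> d r) has_vector_derivative 0) (at r within {0..t})" if r: "r \<in> {0..t}" for r
  proof -
    have "(d has_derivative (\<lambda>h. h *\<^sub>R (A *v d r))) (at r within {0..t})"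
      using D[OF r] by (simp add: has_vector_derivative_def)
    from has_derivative_inner[OF this this] show ?thesis
      unfolding has_vector_derivative_def
      by (rule has_derivative_eq_rhs) (auto simp: fun_eq_iff skew inner_commute[of "d r"])
  qed
  obtain c where c: "\<And>r. r \<in> {0..t} \<Longrightarrow> d r \<bullet> d r = c"
    using has_vector_derivative_zero_constant[of "{0..t}" "\<lambda>r. d r \<bullet> d r"] N by auto
  have "d 0 = 0" using has_integral_unique[OF eq[of 0, OF order_refl]] has_integral_refl(2)[of "\<lambda>r. A *v d r" 0]
    by (simp add: cbox_interval)
  then show ?thesis using c[of 0] c[of t] t by simp
qed

text \<open>The difference of two trajectories solves \<open>d' = A d\<close>, which gives \<open>x v t = x 0 t + U t v\<close> and, after
integration, the mean \<open>x 0 t + U t m\<close>. So the drift of \<open>x 0\<close> is \<open>- A (U t m)\<close>, the derivative of \<open>- U t m\<close>.\<close>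

lemma flow_equation_solution:
  fixes A :: "real^3^3"
  assumes U0: "U 0 = mat 1"
    and U': "\<And>t. 0 \<le> t \<Longrightarrow> (U has_vector_derivative A ** U t) (at t within {0..})"
    and orth: "\<And>t. 0 \<le> t \<Longrightarrow> orthogonal_matrix (U t)"
    and \<mu>: "prob_space \<mu>"
    and sol: "solves_flow_equation A \<mu> w x"
    and t: "0 \<le> t"
  defines "m \<equiv> (\<integral>v. v \<partial>\<mu>)"
  shows "x u t = U t *v (u - m) + m + w t"
proof -
  interpret prob_space \<mu> by (rule \<mu>)
  let ?I = "\<lambda>r. \<integral>v. x v r \<partial>\<mu>"
  have int: "\<And>t. 0 \<le> t \<Longrightarrow> integrable \<mu> (\<lambda>v. x v t)"
    and cont: "\<And>u. continuous_on {0..} (x u)"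
    and x0: "\<And>u. x u 0 = u"
    and eq: "\<And>u t. 0 \<le> t \<Longrightarrow> ((\<lambda>r. A *v (x u r - ?I r)) has_integral (x u t - u - w t)) {0..t}"
    using sol by (auto simp: solves_flow_equation_def)
  have Uz': "((\<lambda>t. U t *v z) has_vector_derivative A *v (U t *v z)) (at t within {0..})" if "0 \<le> t" for z t
    using bounded_linear.has_vector_derivative[OF bounded_linear_matrix_vector_left U'[OF that], of z]
    by (simp add: matrix_vector_mul_assoc)
  have Uz: "((\<lambda>r. A *v (U r *v z)) has_integral (U t *v z - z)) {0..t}" if "0 \<le> t" for z t
  proof -
    have "((\<lambda>r. A *v (U r *v z)) has_integral (U t *v z - U 0 *v z)) {0..t}"
      using that by (intro fundamental_theorem_of_calculus has_vector_derivative_within_subset[OF Uz']) auto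
    then show ?thesis by (simp add: U0)
  qed
  have Ucont: "continuous_on {0..} (\<lambda>t. U t *v z)" for z
    unfolding continuous_on_eq_continuous_within
    using Uz' has_vector_derivative_continuous by fastforce
  have diff: "x v r = x 0 r + U r *v v" if r: "0 \<le> r" for v r
  proof -
    have "x v r - x 0 r - U r *v v = 0"
    proof (rule skew_linear_ode_unique[OF orthogonal_group_generator_skew[OF U0 U' orth] _ _ r])
      show "continuous_on {0..} (\<lambda>r. x v r - x 0 r - U r *v v)"
        by (intro continuous_intros cont Ucont)
      fix t :: real assume t: "0 \<le> t"
      have "((\<lambda>r. A *v (x v r - ?I r) - A *v (x 0 r - ?I r) - A *v (U r *v v)) has_integral
        (x v t - v - w t) - (x 0 t - 0 - w t) - (U t *v v - v)) {0..t}"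
        by (intro has_integral_diff eq Uz t)
      then show "((\<lambda>r. A *v (x v r - x 0 r - U r *v v)) has_integral x v t - x 0 t - U t *v v) {0..t}"
        by (simp add: matrix_vector_mult_diff_distrib algebra_simps)
    qed auto
    then show ?thesis by (simp add: algebra_simps)
  qed
  have id_int: "integrable \<mu> (\<lambda>v. v)" using int[of 0] by (simp add: x0)
  have mean: "?I r = x 0 r + U r *v m" if r: "0 \<le> r" for r
  proof -
    have "?I r = (\<integral>v. x 0 r + U r *v v \<partial>\<mu>)"
      by (intro Bochner_Integration.integral_cong refl diff[OF r])
    also have "\<dots> = x 0 r + (\<integral>v. U r *v v \<partial>\<mu>)"
      using Bochner_Integration.integral_add[OF integrable_const[of "x 0 r"]
          integrable_bounded_linear[OF matrix_vector_mul_bounded_linear[of "U r"] id_int]] by (simp add: prob_space)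
    also have "(\<integral>v. U r *v v \<partial>\<mu>) = U r *v m"
      unfolding m_def by (rule integral_bounded_linear[OF matrix_vector_mul_bounded_linear id_int])
    finally show ?thesis .
  qed
  have "((\<lambda>r. - (A *v (U r *v m))) has_integral (x 0 t - 0 - w t)) {0..t}"
  proof (rule has_integral_eq[OF _ eq[OF t]])
    fix r assume "r \<in> {0..t}"
    then have "x 0 r - ?I r = 0 - U r *v m" using mean[of r] by simp
    then show "A *v (x 0 r - ?I r) = - (A *v (U r *v m))"
      by (simp only: matrix_vector_mult_diff_distrib) simp
  qed
  moreover have "((\<lambda>r. - (A *v (U r *v m))) has_integral - (U t *v m - m)) {0..t}"
    by (intro has_integral_neg Uz t)
  ultimately have "x 0 t - 0 - w t = - (U t *v m - m)" by (rule has_integral_unique)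
  then have "x 0 t = w t + m - U t *v m" by (simp add: algebra_simps)
  then show ?thesis unfolding diff[OF t, of u] by (simp add: matrix_vector_mult_diff_distrib)
qed

section \<open>Knots, the Wiener process and the modified field\<close>

lemma C_k_1_loop:
  fixes f :: "real \<Rightarrow> real^3"
  assumes "C_k (Suc 0) f" "\<And>s. f (s + 2 * pi) = f s"
  shows "C1_loop f (\<lambda>s. frechet_derivative f (at s) 1)"
  unfolding C1_loop_def
proof (intro conjI allI)
  have "f differentiable_on UNIV \<and> (\<forall>v. C_k 0 (\<lambda>x. frechet_derivative f (at x) v))"
    using assms(1) by (rule C_k.simps(2)[THEN iffD1])
  then have d: "f differentiable_on UNIV" and c: "continuous_on UNIV (\<lambda>x. frechet_derivative f (at x) 1)" by simp_all
  show "continuous_on UNIV (\<lambda>s. frechet_derivative f (at s) 1)" by (rule c)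
  fix s
  have D: "(f has_derivative frechet_derivative f (at s)) (at s)"
    by (rule frechet_derivative_works[THEN iffD1]) (use d in \<open>simp add: differentiable_on_def\<close>)
  have "frechet_derivative f (at s) h = h *\<^sub>R frechet_derivative f (at s) 1" for h
    using linear_scale[OF has_derivative_linear[OF D], of h 1] by simp
  then have eq: "frechet_derivative f (at s) = (\<lambda>h. h *\<^sub>R frechet_derivative f (at s) 1)" by (rule ext)
  show "(f has_vector_derivative frechet_derivative f (at s) 1) (at s)"
    unfolding has_vector_derivative_def using D eq by (rule has_derivative_eq_rhs)
qed (rule assms(2))

lemma knot_parametrization_loop:
  assumes "knot_parametrization f"
  obtains f' f'' where "C1_loop f f'" "C1_loop f' f''" "\<forall>s. f' s \<noteq> 0" "no_self_intersections f"
proof -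
  have per: "f (s + 2 * pi) = f s" for s using assms by (simp add: knot_parametrization_def C2_periodic_def)
  have C2: "C_k (Suc (Suc 0)) f"
    using assms unfolding knot_parametrization_def C2_periodic_def numeral_2_eq_2 by blast
  define f' where "f' s = frechet_derivative f (at s) 1" for s
  have f': "C1_loop f f'" unfolding f'_def by (rule C_k_1_loop[OF C_k_2_imp_C_k_1(1)[OF C2] per])
  have "C1_loop f' (\<lambda>s. frechet_derivative f' (at s) 1)"
    by (rule C_k_1_loop) (use C_k_2_imp_C_k_1(2)[OF C2, of 1] C1_loop_derivative_periodic[OF f'] in \<open>simp_all add: f'_def[abs_def]\<close>)
  moreover have "\<forall>s. f' s \<noteq> 0"
  proof
    fix s
    have "vector_derivative f (at s) = f' s"
      by (rule vector_derivative_at) (use f' in \<open>simp add: C1_loop_def\<close>)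
    then show "f' s \<noteq> 0" using assms unfolding knot_parametrization_def by (elim conjE) (metis (no_types))
  qed
  moreover have "no_self_intersections f" using assms by (simp add: knot_parametrization_def)
  ultimately show ?thesis by (rule that[OF f'])
qed

lemma knot_bilipschitz_loop:
  assumes "knot G"
  obtains g g' m where "C1_loop g g'" "0 < m" "bilipschitz_loop m g" "G = g ` {0..2 * pi}"
proof -
  obtain g where g: "knot_parametrization g" "G = g ` {0..2 * pi}" using assms by (auto simp: knot_def)
  obtain g' g'' where g': "C1_loop g g'" "C1_loop g' g''" "\<forall>s. g' s \<noteq> 0" "no_self_intersections g"
    using knot_parametrization_loop[OF g(1)] .
  obtain m where "0 < m" "bilipschitz_loop m g" using immersed_loop_bilipschitz[OF g'(1) g'(3)[rule_format] g'(4)] .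
  then show ?thesis by (rule that[OF g'(1) _ _ g(2)])
qed

lemma C1_loop_isometry:
  fixes U :: "real^3^3"
  assumes "C1_loop y y'" shows "C1_loop (\<lambda>s. U *v (y s - m) + q) (\<lambda>s. U *v y' s)"
  unfolding C1_loop_def
proof (intro conjI allI)
  show "continuous_on UNIV (\<lambda>s. U *v y' s)"
    by (rule continuous_on_compose2[OF linear_continuous_on[OF matrix_vector_mul_bounded_linear]])
       (use assms in \<open>auto simp: C1_loop_def\<close>)
  fix s
  have "((\<lambda>s. y s - m) has_vector_derivative y' s) (at s)"
    using has_vector_derivative_diff[OF _ has_vector_derivative_const, of y "y' s" "at s" m] assms
    by (simp add: C1_loop_def)
  from has_vector_derivative_add[OF bounded_linear.has_vector_derivative[OF matrix_vector_mul_bounded_linear this] has_vector_derivative_const, of U q]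
  show "((\<lambda>s. U *v (y s - m) + q) has_vector_derivative U *v y' s) (at s)" by simp
qed (use assms in \<open>auto simp: C1_loop_def\<close>)

lemma smooth_zero: "smooth (\<lambda>u. 0)"
proof -
  have "C_k k (\<lambda>u :: 'a. 0 :: 'b)" for k by (induction k) simp_all
  then show ?thesis by (simp add: smooth_def)
qed

lemma wiener_ball_probability:
  assumes M: "prob_space M" and w: "wiener_process M w" and r: "0 < r"
  shows "0 < measure M {\<omega> \<in> space M. w 1 \<omega> \<in> ball p r}"
proof -
  interpret prob_space M by fact
  have [measurable]: "w 1 \<in> borel_measurable M" "w 0 \<in> borel_measurable M"
    using w by (simp_all add: wiener_process_def)
  have w0: "AE \<omega> in M. w 0 \<omega> = 0" using w by (simp add: wiener_process_def)
  note incr = w[unfolded wiener_process_def, THEN conjunct2, THEN conjunct2, THEN conjunct2, THEN conjunct2,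
      THEN spec[of _ 0], THEN spec[of _ 1], THEN mp]
  have d: "distributed M lborel (\<lambda>\<omega>. (w 1 \<omega> - w 0 \<omega>) $ i) (normal_density 0 (sqrt (1 - 0)))" for i
    using incr[THEN conjunct1, THEN spec[of _ i]] by simp
  have ind: "indep_vars (\<lambda>_. borel) (\<lambda>i \<omega>. (w 1 \<omega> - w 0 \<omega>) $ i) (UNIV :: 3 set)"
    using incr[THEN conjunct2] by simp
  define J where "J i = {p $ i - r / 4 <..< p $ i + r / 4}" for i
  have J: "J i \<in> sets borel" for i by (simp add: J_def)
  let ?Z = "\<lambda>i \<omega>. (w 1 \<omega> - w 0 \<omega>) $ i"
  have "prob (?Z i -` J i \<inter> space M) = measure std_normal_distribution (J i)" for i
  proof -
    have "prob (?Z i -` J i \<inter> space M) = measure (distr M lborel (?Z i)) (J i)"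
      using J[of i] by (subst measure_distr) auto
    also have "distr M lborel (?Z i) = std_normal_distribution"
      using distributed_distr_eq_density[OF d[of i]] by simp
    finally show ?thesis .
  qed
  then have "0 < prob (?Z i -` J i \<inter> space M)" for i
    using std_normal_interval_pos[of "p $ i - r / 4" "p $ i + r / 4"] r by (simp add: J_def)
  then have "0 < (\<Prod>i\<in>(UNIV::3 set). prob (?Z i -` J i \<inter> space M))" by (intro prod_pos) auto
  also have "\<dots> = prob (\<Inter>i\<in>UNIV. ?Z i -` J i \<inter> space M)"
    by (rule indep_varsD_finite[OF ind, symmetric]) (use J in auto)
  also have "\<dots> \<le> prob {\<omega> \<in> space M. w 1 \<omega> \<in> ball p r}"
  proof (rule finite_measure_mono_AE)
    show "AE \<omega> in M. \<omega> \<in> (\<Inter>i\<in>UNIV. ?Z i -` J i \<inter> space M) \<longrightarrow> \<omega> \<in> {\<omega> \<in> space M. w 1 \<omega> \<in> ball p r}"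
      using w0
    proof (eventually_elim, intro impI)
      fix \<omega> assume 0: "w 0 \<omega> = 0" and in_J: "\<omega> \<in> (\<Inter>i\<in>UNIV. ?Z i -` J i \<inter> space M)"
      have b: "\<bar>(p - w 1 \<omega>) $ i\<bar> \<le> r / 4" for i
      proof -
        have "(w 1 \<omega> - w 0 \<omega>) $ i \<in> J i" using in_J by blast
        then have "w 1 \<omega> $ i \<in> J i" using 0 by simp
        then have "p $ i - r / 4 < w 1 \<omega> $ i" "w 1 \<omega> $ i < p $ i + r / 4" by (simp_all add: J_def)
        then have "\<bar>p $ i - w 1 \<omega> $ i\<bar> \<le> r / 4" by linarith
        then show ?thesis by simp
      qed
      have "norm (p - w 1 \<omega>) \<le> (\<Sum>i\<in>UNIV. \<bar>(p - w 1 \<omega>) $ i\<bar>)" by (rule norm_le_l1_cart)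
      also have "\<dots> \<le> (\<Sum>i\<in>(UNIV::3 set). r / 4)" by (intro sum_mono b)
      finally have "norm (p - w 1 \<omega>) < r" using r by simp
      then show "\<omega> \<in> {\<omega> \<in> space M. w 1 \<omega> \<in> ball p r}" using in_J by (simp add: dist_norm)
    qed
  next
    show "{\<omega> \<in> space M. w 1 \<omega> \<in> ball p r} \<in> sets M"
      using measurable_sets[of "w 1" M borel "ball p r"] by (simp add: vimage_def Int_def conj_commute)
  qed
  finally show ?thesis .
qed

text \<open>Setting the field to zero on a null set makes all paths smooth and changes the probabilities of no events.\<close>

lemma random_shift_modification:
  assumes M: "prob_space M" and \<xi>: "smooth_gaussian_field M \<xi>"
    and N: "N \<in> null_sets M" and smooth: "\<And>\<omega>. \<omega> \<in> space M \<Longrightarrow> \<omega> \<notin> N \<Longrightarrow> smooth (\<lambda>u. \<xi> u \<omega>)"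
    and W: "W \<in> borel_measurable M"
    and indep: "\<And>B T. B \<in> sets borel \<Longrightarrow> T \<in> sets (Pi\<^sub>M UNIV (\<lambda>_. borel)) \<Longrightarrow>
      measure M ({\<omega> \<in> space M. W \<omega> \<in> B} \<inter> {\<omega> \<in> space M. (\<lambda>u. \<xi> u \<omega>) \<in> T}) =
      measure M {\<omega> \<in> space M. W \<omega> \<in> B} * measure M {\<omega> \<in> space M. (\<lambda>u. \<xi> u \<omega>) \<in> T}"
  shows "random_shift M (\<lambda>u \<omega>. if \<omega> \<in> space M - N then \<xi> u \<omega> else 0) W"
proof -
  interpret prob_space M by fact
  let ?\<xi> = "\<lambda>u \<omega>. if \<omega> \<in> space M - N then \<xi> u \<omega> else 0"
  have mN[measurable]: "N \<in> sets M" using N by auto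
  have ae: "AE \<omega> in M. \<omega> \<in> space M - N"
    using AE_not_in[OF N] AE_space by eventually_elim simp
  have coord: "centered_gaussian_process M (\<lambda>u \<omega>. \<xi> u \<omega> $ i)" for i using \<xi> by (simp add: smooth_gaussian_field_def)
  have mc[measurable]: "(\<lambda>\<omega>. \<xi> u \<omega> $ i) \<in> borel_measurable M" for u i
    by (rule centered_gaussian_facts(1)[OF M centered_gaussian_processD(2)[OF coord]])
  have mf[measurable]: "\<xi> u \<in> borel_measurable M" for u by (rule borel_measurable_vecI[OF mc])
  have mf'[measurable]: "?\<xi> u \<in> borel_measurable M" for u by measurable
  have mF: "(\<lambda>\<omega> u. \<xi> u \<omega>) \<in> measurable M (Pi\<^sub>M UNIV (\<lambda>_. borel))" "(\<lambda>\<omega> u. ?\<xi> u \<omega>) \<in> measurable M (Pi\<^sub>M UNIV (\<lambda>_. borel))"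
    by (rule measurable_PiM_single'; use mf mf' in simp)+
  have mFi: "(\<lambda>\<omega> u. \<xi> u \<omega> $ i) \<in> measurable M (Pi\<^sub>M UNIV (\<lambda>_. borel))" "(\<lambda>\<omega> u. ?\<xi> u \<omega> $ i) \<in> measurable M (Pi\<^sub>M UNIV (\<lambda>_. borel))" for i
    by (rule measurable_PiM_single'; simp)+
  have ev: "{\<omega> \<in> space M. X \<omega> \<in> A} \<in> sets M" if "X \<in> measurable M P" "A \<in> sets P" for X P and A :: "'z set"
    using measurable_sets[OF that] by (simp add: vimage_def Int_def conj_commute)
  show ?thesis
  proof (unfold_locales)
    fix i
    show "centered_gaussian_process M (\<lambda>u \<omega>. ?\<xi> u \<omega> $ i)"
      unfolding centered_gaussian_process_def
    proof (intro allI impI)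
      fix F :: "(real^3) set" and c :: "real^3 \<Rightarrow> real" assume F: "finite F"
      have cg: "centered_gaussian M (\<lambda>\<omega>. \<Sum>u\<in>F. c u * \<xi> u \<omega> $ i)" by (rule centered_gaussian_processD(1)[OF coord F])
      have "distr M borel (\<lambda>\<omega>. \<Sum>u\<in>F. c u * ?\<xi> u \<omega> $ i) = distr M borel (\<lambda>\<omega>. \<Sum>u\<in>F. c u * \<xi> u \<omega> $ i)"
        by (rule distr_cong_AE) (use ae in \<open>auto elim!: eventually_mono\<close>)
      then show "centered_gaussian M (\<lambda>\<omega>. \<Sum>u\<in>F. c u * ?\<xi> u \<omega> $ i)"
        using cg unfolding centered_gaussian_def by simp
    qed
    fix u v
    have "(\<integral>\<omega>. ?\<xi> u \<omega> $ i * ?\<xi> v \<omega> $ i \<partial>M) = (\<integral>\<omega>. \<xi> u \<omega> $ i * \<xi> v \<omega> $ i \<partial>M)"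
      by (rule integral_cong_AE) (use ae in \<open>auto elim!: eventually_mono\<close>)
    then show "(\<integral>\<omega>. ?\<xi> u \<omega> $ i * ?\<xi> v \<omega> $ i \<partial>M) = exp (- (norm (u - v))\<^sup>2)"
      using \<xi> by (simp add: smooth_gaussian_field_def)
  next
    fix A :: "3 \<Rightarrow> (real^3 \<Rightarrow> real) set" assume A: "\<And>i. A i \<in> sets (Pi\<^sub>M UNIV (\<lambda>_. borel))"
    have iv: "indep_vars (\<lambda>_. Pi\<^sub>M UNIV (\<lambda>_. borel)) (\<lambda>i \<omega> u. \<xi> u \<omega> $ i) UNIV"
      using \<xi> by (simp add: smooth_gaussian_field_def)
    have one: "prob {\<omega> \<in> space M. (\<lambda>u. ?\<xi> u \<omega> $ i) \<in> A i} = prob ((\<lambda>\<omega> u. \<xi> u \<omega> $ i) -` A i \<inter> space M)" for i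
    proof (rule finite_measure_eq_AE)
      show "AE \<omega> in M. \<omega> \<in> {\<omega> \<in> space M. (\<lambda>u. ?\<xi> u \<omega> $ i) \<in> A i} \<longleftrightarrow> \<omega> \<in> (\<lambda>\<omega> u. \<xi> u \<omega> $ i) -` A i \<inter> space M"
        using ae by eventually_elim auto
    qed (rule ev[OF mFi(2) A], rule measurable_sets[OF mFi(1) A])
    have "prob {\<omega> \<in> space M. \<forall>i. (\<lambda>u. ?\<xi> u \<omega> $ i) \<in> A i} = prob (\<Inter>i\<in>UNIV. (\<lambda>\<omega> u. \<xi> u \<omega> $ i) -` A i \<inter> space M)"
    proof (rule finite_measure_eq_AE)
      show "AE \<omega> in M. \<omega> \<in> {\<omega> \<in> space M. \<forall>i. (\<lambda>u. ?\<xi> u \<omega> $ i) \<in> A i} \<longleftrightarrow> \<omega> \<in> (\<Inter>i\<in>UNIV. (\<lambda>\<omega> u. \<xi> u \<omega> $ i) -` A i \<inter> space M)"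
        using ae by eventually_elim auto
      have "{\<omega> \<in> space M. \<forall>i. (\<lambda>u. ?\<xi> u \<omega> $ i) \<in> A i} = (\<Inter>i\<in>UNIV. {\<omega> \<in> space M. (\<lambda>u. ?\<xi> u \<omega> $ i) \<in> A i})" by auto
      then show "{\<omega> \<in> space M. \<forall>i. (\<lambda>u. ?\<xi> u \<omega> $ i) \<in> A i} \<in> sets M"
        using ev[OF mFi(2) A] by (simp only:) (rule sets.finite_INT, auto)
      show "(\<Inter>i\<in>UNIV. (\<lambda>\<omega> u. \<xi> u \<omega> $ i) -` A i \<inter> space M) \<in> sets M"
        by (intro sets.finite_INT measurable_sets[OF mFi(1) A]) auto
    qed
    also have "\<dots> = (\<Prod>i\<in>UNIV. prob ((\<lambda>\<omega> u. \<xi> u \<omega> $ i) -` A i \<inter> space M))"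
      by (rule indep_varsD_finite[OF iv]) (use A in auto)
    finally show "prob {\<omega> \<in> space M. \<forall>i. (\<lambda>u. ?\<xi> u \<omega> $ i) \<in> A i} = (\<Prod>i\<in>UNIV. prob {\<omega> \<in> space M. (\<lambda>u. ?\<xi> u \<omega> $ i) \<in> A i})"
      by (simp only: one)
  next
    fix \<omega>
    show "smooth (\<lambda>u. ?\<xi> u \<omega>)" using smooth[of \<omega>] smooth_zero by (cases "\<omega> \<in> space M - N") auto
  next
    show "W \<in> borel_measurable M" by (rule W)
  next
    fix B :: "(real^3) set" and T :: "(real^3 \<Rightarrow> real^3) set"
    assume B: "B \<in> sets borel" and T: "T \<in> sets (Pi\<^sub>M UNIV (\<lambda>_. borel))"
    have "prob {\<omega> \<in> space M. (\<lambda>u. ?\<xi> u \<omega>) \<in> T} = prob {\<omega> \<in> space M. (\<lambda>u. \<xi> u \<omega>) \<in> T}"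
      by (rule finite_measure_eq_AE[OF _ ev[OF mF(2) T] ev[OF mF(1) T]]) (use ae in \<open>eventually_elim, auto\<close>)
    moreover have "prob ({\<omega> \<in> space M. W \<omega> \<in> B} \<inter> {\<omega> \<in> space M. (\<lambda>u. ?\<xi> u \<omega>) \<in> T}) =
        prob ({\<omega> \<in> space M. W \<omega> \<in> B} \<inter> {\<omega> \<in> space M. (\<lambda>u. \<xi> u \<omega>) \<in> T})"
      by (rule finite_measure_eq_AE[OF _ sets.Int[OF ev[OF W B] ev[OF mF(2) T]] sets.Int[OF ev[OF W B] ev[OF mF(1) T]]])
         (use ae in \<open>eventually_elim, auto\<close>)
    ultimately show "prob ({\<omega> \<in> space M. W \<omega> \<in> B} \<inter> {\<omega> \<in> space M. (\<lambda>u. ?\<xi> u \<omega>) \<in> T}) =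
        prob {\<omega> \<in> space M. W \<omega> \<in> B} * prob {\<omega> \<in> space M. (\<lambda>u. ?\<xi> u \<omega>) \<in> T}"
      using indep[OF B T] by simp
  qed
qed

section \<open>Both knot types occur\<close>

theorem theorem3p2:
  fixes M :: "'w measure"
    and \<xi> :: "real^3 \<Rightarrow> 'w \<Rightarrow> real^3"
    and w :: "real \<Rightarrow> 'w \<Rightarrow> real^3"
    and A :: "real^3^3"
    and f\<^sub>0 :: "real \<Rightarrow> real^3"
    and x :: "real^3 \<Rightarrow> real \<Rightarrow> 'w \<Rightarrow> real^3"
    and G\<^sub>1 G\<^sub>2 :: "(real^3) set"
  assumes "prob_space M"
    and "smooth_gaussian_field M \<xi>"
    and "wiener_process M w"
    and "independent_processes M \<xi> w"
    and "generates_orthogonal_group A"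
    and "knot_parametrization f\<^sub>0"
    and "AE \<omega> in M. solves_flow_equation A (visitation_measure f\<^sub>0) (\<lambda>t. w t \<omega>) (\<lambda>u t. x u t \<omega>)"
    and "knot G\<^sub>1" and "knot G\<^sub>2" and "\<not> same_type G\<^sub>1 G\<^sub>2"
  shows "\<exists>t\<^sub>0>0. measure (completion M)
           {\<omega> \<in> space M. has_type (\<lambda>s. \<xi> (x (f\<^sub>0 s) 0 \<omega>) \<omega>) G\<^sub>1 \<and>
                         has_type (\<lambda>s. \<xi> (x (f\<^sub>0 s) t\<^sub>0 \<omega>) \<omega>) G\<^sub>2} > 0"
proof -
  interpret prob_space M by fact
  interpret C: prob_space "completion M" by (rule prob_space_completion)
  obtain U :: "real \<Rightarrow> real^3^3" where U: "U 0 = mat 1"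
    "\<And>t. 0 \<le> t \<Longrightarrow> (U has_vector_derivative A ** U t) (at t within {0..})"
    "\<And>t. 0 \<le> t \<Longrightarrow> orthogonal_matrix (U t)"
    using assms(5) unfolding generates_orthogonal_group_def by blast
  define m where "m = (\<integral>v. v \<partial>visitation_measure f\<^sub>0)"
  obtain f' f'' where f: "C1_loop f\<^sub>0 f'" "C1_loop f' f''" "\<forall>s. f' s \<noteq> 0" "no_self_intersections f\<^sub>0"
    using knot_parametrization_loop[OF assms(6)] .
  define z where "z s = U 1 *v (f\<^sub>0 s - m) + m" for s
  define z' where "z' s = U 1 *v f' s" for s
  define z'' where "z'' s = U 1 *v f'' s" for s
  have z1: "C1_loop z z'" unfolding z_def z'_def by (rule C1_loop_isometry[OF f(1)])
  have z2: "C1_loop z' z''" using C1_loop_isometry[OF f(2), of "U 1" 0 0] by (simp add: z'_def[abs_def] z''_def[abs_def])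
  have U1: "norm (U 1 *v v) = norm v" for v using U(3)[of 1] by (simp add: orthogonal_matrix_norm)
  have z3: "z' s \<noteq> 0" for s using f(3) U1[of "f' s"] unfolding z'_def by (metis norm_eq_zero)
  have z4: "no_self_intersections z"
    unfolding no_self_intersections_def
  proof (rule inj_onI)
    fix s t assume st: "s \<in> {0..<2 * pi}" "t \<in> {0..<2 * pi}" "z s = z t"
    then have "U 1 *v (f\<^sub>0 s - m) - U 1 *v (f\<^sub>0 t - m) = 0" by (simp add: z_def)
    then have "norm (U 1 *v (f\<^sub>0 s - f\<^sub>0 t)) = 0" by (simp add: matrix_vector_mult_diff_distrib)
    then have "f\<^sub>0 s = f\<^sub>0 t" unfolding U1 by simp
    then show "s = t" using f(4) st(1,2) unfolding no_self_intersections_def inj_on_def by blast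
  qed
  obtain mf where mf: "0 < mf" "bilipschitz_loop mf f\<^sub>0" using immersed_loop_bilipschitz[OF f(1) f(3)[rule_format] f(4)] .
  obtain mz where mz: "0 < mz" "bilipschitz_loop mz z" using immersed_loop_bilipschitz[OF z1 z3 z4] .
  have "AE \<omega> in M. smooth (\<lambda>u. \<xi> u \<omega>)" using assms(2) by (simp add: smooth_gaussian_field_def)
  moreover have "AE \<omega> in M. (\<forall>u. x u 0 \<omega> = u) \<and> (\<forall>u. x u 1 \<omega> = U 1 *v (u - m) + m + w 1 \<omega>)"
    using assms(7)
  proof eventually_elim
    fix \<omega> assume sol: "solves_flow_equation A (visitation_measure f\<^sub>0) (\<lambda>t. w t \<omega>) (\<lambda>u t. x u t \<omega>)"
    have f0: "f\<^sub>0 \<in> borel_measurable borel"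
      by (rule borel_measurable_continuous_onI[OF C1_loop_continuous[OF f(1)]])
    have "prob_space (uniform_measure lborel {0..2 * pi})"
      by (rule prob_space_uniform_measure) simp_all
    then have "prob_space (visitation_measure f\<^sub>0)"
      unfolding visitation_measure_def by (rule prob_space.prob_space_distr) (use f0 in simp)
    from flow_equation_solution[OF U this sol, of 1, folded m_def]
    have "\<forall>u. x u 1 \<omega> = U 1 *v (u - m) + m + w 1 \<omega>" by simp
    moreover have "\<forall>u. x u 0 \<omega> = u" using sol by (simp add: solves_flow_equation_def)
    ultimately show "(\<forall>u. x u 0 \<omega> = u) \<and> (\<forall>u. x u 1 \<omega> = U 1 *v (u - m) + m + w 1 \<omega>)" by simp
  qed
  ultimately have ae: "AE \<omega> in M. smooth (\<lambda>u. \<xi> u \<omega>) \<and> (\<forall>u. x u 0 \<omega> = u) \<and> (\<forall>u. x u 1 \<omega> = U 1 *v (u - m) + m + w 1 \<omega>)"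
    by eventually_elim simp
  obtain N where N: "N \<in> null_sets M" and good: "\<And>\<omega>. \<omega> \<in> space M - N \<Longrightarrow>
      smooth (\<lambda>u. \<xi> u \<omega>) \<and> (\<forall>u. x u 0 \<omega> = u) \<and> (\<forall>u. x u 1 \<omega> = U 1 *v (u - m) + m + w 1 \<omega>)"
    using ae by (rule AE_E3) (rule that)
  have w1[measurable]: "w 1 \<in> borel_measurable M" using assms(3) by (simp add: wiener_process_def)
  define \<zeta> where "\<zeta> = (\<lambda>u \<omega>. if \<omega> \<in> space M - N then \<xi> u \<omega> else 0)"
  have prob_triv: "prob ({\<omega> \<in> space M. (0 :: real^3) \<in> B} \<inter> S) = prob {\<omega> \<in> space M. (0 :: real^3) \<in> B} * prob S"
    if "S \<subseteq> space M" for B S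
    using that by (cases "0 \<in> B") (simp_all add: Int_absorb1 prob_space)
  \<comment> \<open>the loop at time \<open>0\<close> is not shifted\<close>
  interpret S0: random_shift M \<zeta> "\<lambda>_. 0"
    unfolding \<zeta>_def
    by (rule random_shift_modification[OF assms(1,2) N]) (use good in blast, simp, rule prob_triv, auto)
  have indep1: "prob ({\<omega> \<in> space M. w 1 \<omega> \<in> B} \<inter> {\<omega> \<in> space M. (\<lambda>u. \<xi> u \<omega>) \<in> T}) =
      prob {\<omega> \<in> space M. w 1 \<omega> \<in> B} * prob {\<omega> \<in> space M. (\<lambda>u. \<xi> u \<omega>) \<in> T}"
    if B: "B \<in> sets borel" and T: "T \<in> sets (Pi\<^sub>M UNIV (\<lambda>_. borel))" for B and T :: "(real^3 \<Rightarrow> real^3) set"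
  proof -
    have a: "(\<lambda>\<omega> u. \<xi> u \<omega>) -` T \<inter> space M \<in> sets (vimage_algebra (space M) (\<lambda>\<omega> u. \<xi> u \<omega>) (Pi\<^sub>M UNIV (\<lambda>_. borel)))"
      by (rule in_vimage_algebra[OF T])
    let ?P = "Pi\<^sub>M {0..} (\<lambda>_. borel) :: (real \<Rightarrow> real^3) measure"
    have "(\<lambda>F. F 1) \<in> measurable ?P borel" by (rule measurable_component_singleton) simp
    from measurable_sets[OF this B] have "(\<lambda>F. F 1) -` B \<inter> space ?P \<in> sets ?P" .
    from in_vimage_algebra[OF this, of "\<lambda>\<omega>. \<lambda>t\<in>{0..}. w t \<omega>" "space M"]
    have b: "(\<lambda>\<omega>. \<lambda>t\<in>{0..}. w t \<omega>) -` ((\<lambda>F. F 1) -` B \<inter> space ?P) \<inter> space M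
        \<in> sets (vimage_algebra (space M) (\<lambda>\<omega>. \<lambda>t\<in>{0..}. w t \<omega>) ?P)" .
    have eq: "(\<lambda>\<omega>. \<lambda>t\<in>{0..}. w t \<omega>) -` ((\<lambda>F. F 1) -` B \<inter> space ?P) \<inter> space M = {\<omega> \<in> space M. w 1 \<omega> \<in> B}"
      by (auto simp: space_PiM)
    have eq': "(\<lambda>\<omega> u. \<xi> u \<omega>) -` T \<inter> space M = {\<omega> \<in> space M. (\<lambda>u. \<xi> u \<omega>) \<in> T}" by auto
    from indep_setD[OF assms(4)[unfolded independent_processes_def] a b]
    show ?thesis unfolding eq eq' by (simp add: Int_commute mult.commute)
  qed
  \<comment> \<open>the loop at time \<open>1\<close> is shifted by the Wiener process\<close>
  interpret S1: random_shift M \<zeta> "w 1"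
    unfolding \<zeta>_def
    by (rule random_shift_modification[OF assms(1,2) N _ w1 indep1]) (use good in blast)
  define E where "E = {\<omega> \<in> space M. has_type (\<lambda>s. \<xi> (x (f\<^sub>0 s) 0 \<omega>) \<omega>) G\<^sub>1 \<and> has_type (\<lambda>s. \<xi> (x (f\<^sub>0 s) 1 \<omega>) \<omega>) G\<^sub>2}"
  define E' where "E' = {\<omega> \<in> space M. has_type (\<lambda>s. \<zeta> (f\<^sub>0 s + 0) \<omega>) G\<^sub>1} \<inter> {\<omega> \<in> space M. has_type (\<lambda>s. \<zeta> (z s + w 1 \<omega>) \<omega>) G\<^sub>2}"
  have E': "E' \<in> sets (completion M)"
    unfolding E'_def by (intro sets.Int S0.has_type_measurable[OF f(1,2) mf] S1.has_type_measurable[OF z1 z2 mz])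
  \<comment> \<open>off the null set \<open>N\<close> the field is its modification and the flow is the rigid motion\<close>
  have EE': "\<omega> \<in> E \<longleftrightarrow> \<omega> \<in> E'" if "\<omega> \<notin> N" for \<omega>
  proof (cases "\<omega> \<in> space M")
    case True
    then have "(\<forall>u. x u 0 \<omega> = u) \<and> (\<forall>u. x u 1 \<omega> = U 1 *v (u - m) + m + w 1 \<omega>)" using good[of \<omega>] True that by blast
    then show ?thesis using True that by (simp add: E_def E'_def \<zeta>_def z_def)
  qed (simp add: E_def E'_def)
  have Nc: "N \<in> sets (completion M)" using N by auto
  have "E \<inter> N \<in> null_sets (completion M)"
    by (rule null_sets_completion_subset[of _ N]) (use N in \<open>auto intro: null_sets_completionI\<close>)
  moreover have "E = (E' - N) \<union> (E \<inter> N)" using EE' by blast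
  ultimately have E: "E \<in> sets (completion M)" using E' Nc by (metis null_setsD2 sets.Diff sets.Un)
  obtain g g' mg where g: "C1_loop g g'" "0 < mg" "bilipschitz_loop mg g" "G\<^sub>1 = g ` {0..2 * pi}"
    using knot_bilipschitz_loop[OF assms(8)] .
  obtain k k' mk where k: "C1_loop k k'" "0 < mk" "bilipschitz_loop mk k" "G\<^sub>2 = k ` {0..2 * pi}"
    using knot_bilipschitz_loop[OF assms(9)] .
  define e where "e = min mg mk / 5"
  have e: "0 < e" "4 * e < mg" "4 * e < mk" using g(2) k(2) by (auto simp: e_def min_def)
  obtain D :: "(real^3) set" where D: "countable D" "\<And>X. open X \<Longrightarrow> X \<noteq> {} \<Longrightarrow> \<exists>d\<in>D. d \<in> X"
    by (rule countable_dense_setE) (erule that, blast)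
  show ?thesis
  proof (rule two_loop_target[OF f(1) f(3)[rule_format] f(4) z1 z3 z4 g(1) k(1) e(1)])
    fix h :: "3 \<Rightarrow> real^3 \<Rightarrow> real" and p r R d
    assume h: "\<And>i. kernel_sum (h i)" and r: "0 < r" and d: "0 < d"
      and close: "\<And>F q. (\<And>i. d-lipschitz_on (ball 0 R) (\<lambda>u. F u $ i - h i u)) \<Longrightarrow> norm (q - p) < r \<Longrightarrow>
        e-lipschitz_on UNIV (\<lambda>s. F (f\<^sub>0 s) - g s) \<and> e-lipschitz_on UNIV (\<lambda>s. F (z s + q) - k s)"
    define Q where "Q = {\<omega> \<in> space M. w 1 \<omega> \<in> ball p r} \<inter> {\<omega> \<in> space M. \<forall>i. (\<lambda>u. \<zeta> u \<omega> $ i) \<in> lip_near D R d (h i)}"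
    have Q: "Q \<in> sets M" "0 < prob Q"
      unfolding Q_def by (rule S1.target_probability[OF h d D(1) wiener_ball_probability[OF assms(1,3) r]])+
    have hc: "continuous_on UNIV (h i)" for i
      using kernel_sum_lipschitz[OF h[of i]] lipschitz_on_continuous_on by blast
    have self: "same_type (c ` {0..2 * pi}) (c ` {0..2 * pi})" if c: "bilipschitz_loop mc c" "0 < mc" for c mc
      by (rule same_type_if_lipschitz_close[OF c, of c 0])
         (use c in \<open>auto simp: bilipschitz_loop_def intro: lipschitz_on_constant\<close>)
    \<comment> \<open>the event \<open>Q\<close> that the shift is near \<open>p\<close> and the field near \<open>h\<close> has positive probability and forces both types\<close>
    have sub: "Q - N \<subseteq> E"
    proof
      fix \<omega> assume w: "\<omega> \<in> Q - N"
      have "d-lipschitz_on (ball 0 R) (\<lambda>u. \<zeta> u \<omega> $ i - h i u)" for i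
        by (rule lip_near_lipschitz[OF _ D(2) S1.coord_continuous hc]) (use w d in \<open>auto simp: Q_def\<close>)
      moreover have "norm (w 1 \<omega> - p) < r" using w by (simp add: Q_def dist_norm norm_minus_commute)
      ultimately have lip: "e-lipschitz_on UNIV (\<lambda>s. \<zeta> (f\<^sub>0 s) \<omega> - g s)" "e-lipschitz_on UNIV (\<lambda>s. \<zeta> (z s + w 1 \<omega>) \<omega> - k s)"
        using close[of "\<lambda>u. \<zeta> u \<omega>" "w 1 \<omega>"] by blast+
      have "has_type (\<lambda>s. \<zeta> (f\<^sub>0 s) \<omega>) G\<^sub>1"
        unfolding g(4) by (rule has_type_stable[OF g(3,2) _ lip(1) e(2) self[OF g(3,2)]]) (use f(1) in \<open>simp add: C1_loop_def\<close>)
      moreover have "has_type (\<lambda>s. \<zeta> (z s + w 1 \<omega>) \<omega>) G\<^sub>2"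
        unfolding k(4) by (rule has_type_stable[OF k(3,2) _ lip(2) e(3) self[OF k(3,2)]]) (use z1 in \<open>simp add: C1_loop_def\<close>)
      moreover have "\<omega> \<in> space M" using w by (simp add: Q_def)
      ultimately have "\<omega> \<in> E'" by (simp add: E'_def)
      then show "\<omega> \<in> E" using EE' w by blast
    qed
    have mN: "N \<in> sets M" using N by auto
    have "emeasure M Q = emeasure M (Q - N)" by (rule emeasure_Diff_null_set[symmetric, OF N Q(1)])
    also have "\<dots> = emeasure (completion M) (Q - N)" using Q(1) mN by simp
    also have "\<dots> \<le> emeasure (completion M) E" by (rule emeasure_mono[OF sub E])
    finally have "0 < measure (completion M) E"
      using Q(2) by (simp add: emeasure_eq_measure C.emeasure_eq_measure)
    then show ?thesis unfolding E_def by (intro exI[of _ 1]) simp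
  qed
qed

end
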